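(* (a) For all $R,\widetilde R,R_1,R_2,R_3\in\mathcal B_{(0,1]}$ we have $d_{\text{q-uni}}(R,\widetilde R)\ge 0$, $d_{\text{q-uni}}(R,R)=0$, $d_{\text{q-uni}}(R,\widetilde R)=d_{\text{q-uni}}(\widetilde R,R)$ and $$d_{\text{q-uni}}(R_1,R_3)\le\Phi\bigl(d_{\text{q-uni}}(R_1,R_2),d_{\text{q-uni}}(R_2,R_3)\bigr),$$ where $\Phi(a,b):=3(a+b)+(a+b)^2+2ab+(a+b)^3+a^2b^2$. (b) Let $R,\widetilde R\in\mathcal B_{(0,1]}$. If $d_{\text{q-uni}}(R,\widetilde R)=0$, then the essential spectra of $R$ and $\widetilde R$ agree. Also the discrete spectra agree, and have the same multiplicity. (c) If $R$ and $\widetilde R$ are compact, i.e. $R,\widetilde R\in\mathcal K_{(0,1]}$, then $d_{\text{q-uni}}(R,\widetilde R)=0$ if and only if $R$ and $\widetilde R$ are unitarily equivalent. In particular, $d_{\text{q-uni}}$ induces a semimetric (satisfying the relaxed triangle inequality of (a)) on $\mathsf K_{(0,1]}$ and hence on $\Sigma$.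
   Context: Let $\mathsf{HS}$ be a fixed set of separable infinite-dimensional Hilbert spaces. For a Hilbert space $\mathcal H$, let $\mathcal B_{(0,1]}(\mathcal H)$ be the set of bounded self-adjoint injective operators on $\mathcal H$ with spectrum in $[0,1]$, and $\mathcal K_{(0,1]}(\mathcal H)$ its subset of compact operators. Set $\mathcal B_{(0,1]}:=\bigcup_{\mathcal H\in\mathsf{HS}}\mathcal B_{(0,1]}(\mathcal H)$, $\mathcal K_{(0,1]}:=\bigcup_{\mathcal H\in\mathsf{HS}}\mathcal K_{(0,1]}(\mathcal H)$ and $\mathsf K_{(0,1]}:=\mathcal K_{(0,1]}/{\sim}$, where $\sim$ denotes unitary equivalence (i.e. $\widetilde R=URU^*$ for some unitary $U\colon\mathcal H\to\widetilde{\mathcal H}$). Let $\Sigma$ be the set of sequences $(\mu_k)_{k\in\mathbb N}$ with $\lim_k\mu_k=0$ and $0<\mu_{k+1}\le\mu_k\le1$ for all $k$. Mapping $R\in\mathcal K_{(0,1]}$ to its non-increasingly ordered sequence of eigenvalues (repeated according to multiplicity) induces a bijection $\mathsf K_{(0,1]}\to\Sigma$, by which functions on $\mathsf K_{(0,1]}\times\mathsf K_{(0,1]}$ are transported to $\Sigma\times\Sigma$. For $\delta\ge0$, $R\in\mathcal B_{(0,1]}(\mathcal H)$ and $\widetilde R\in\mathcal B_{(0,1]}(\widetilde{\mathcal H})$ are called $\delta$-quasi-unitarily equivalent if there are bounded operators $J\colon\mathcal H\to\widetilde{\mathcal H}$ and $J'\colon\widetilde{\mathcal H}\to\mathcal H$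 (identification operators) such that $\|J\|\le1+\delta$, $\|J'\|\le1+\delta$, $\|J'-J^*\|\le\delta$, $\|(\mathrm{id}_{\mathcal H}-J'J)R\|\le\delta$, $\|(\mathrm{id}_{\widetilde{\mathcal H}}-JJ')\widetilde R\|\le\delta$, $\|JR-\widetilde RJ\|\le\delta$ and $\|J'\widetilde R-RJ'\|\le\delta$. Define $$d_{\text{q-uni}}(R,\widetilde R):=\inf\{\delta\ge0 : R\text{ and }\widetilde R\text{ are }\delta\text{-quasi-unitarily equivalent}\}.$$ The discrete spectrum is the set of isolated eigenvalues of finite multiplicity; the essential spectrum is its complement in the spectrum. A semimetric is a symmetric, non-negative function $d$ with $d(x,y)=0$ if and only if $x=y$; the ordinary triangle inequality is not required. *)

theory Defs
  imports "HOL-Analysis.Analysis" "Jordan_Normal_Form.VS_Connect"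
begin

section \<open>Hilbert spaces\<close>

text \<open>
  A set of Hilbert spaces is a set of records, each with its own carrier and operations on the
  common type \<open>'a\<close>; this permits unions over the set. The scalars are the complex numbers, and
  the fields \<open>mult\<close> and \<open>one\<close> that modules inherit from rings are never used.
  Outside the carriers the operations are arbitrary.
\<close>

record 'a hspace = "(complex, 'a) module" +
  ip :: "'a \<Rightarrow> 'a \<Rightarrow> complex"

definition hnorm :: "'a hspace \<Rightarrow> 'a \<Rightarrow> real" where
  "hnorm H x = sqrt (Re (ip H x x))"

text \<open>
  The locale \<^locale>\<open>Metric_space\<close> demands symmetry and non-negativity on the
  whole type, hence the value 0 outside the carrier.
\<close>

definition hdist :: "'a hspace \<Rightarrow> 'a \<Rightarrow> 'a \<Rightarrow> real" where
  "hdist H x y =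
    (if x \<in> carrier H \<and> y \<in> carrier H then hnorm H (x \<ominus>\<^bsub>H\<^esub> y) else 0)"

definition htopology :: "'a hspace \<Rightarrow> 'a topology" where
  "htopology H = Metric_space.mtopology (carrier H) (hdist H)"

locale hilbert_space = vectorspace "class_ring :: complex ring" H
  for H :: "'a hspace" (structure) +
  assumes ip_add_right: "\<lbrakk>x \<in> carrier H; y \<in> carrier H; z \<in> carrier H\<rbrakk>
      \<Longrightarrow> ip H x (y \<oplus> z) = ip H x y + ip H x z"
    and ip_smult_right: "\<lbrakk>x \<in> carrier H; y \<in> carrier H\<rbrakk>
      \<Longrightarrow> ip H x (c \<odot> y) = c * ip H x y"
    and ip_cnj: "\<lbrakk>x \<in> carrier H; y \<in> carrier H\<rbrakk> \<Longrightarrow> ip H y x = cnj (ip H x y)"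
    and ip_pos: "\<lbrakk>x \<in> carrier H; x \<noteq> \<zero>\<rbrakk> \<Longrightarrow> 0 < Re (ip H x x)"
    and complete: "Metric_space.mcomplete (carrier H) (hdist H)"

definition separable_infinite_hilbert :: "'a hspace \<Rightarrow> bool" where
  "separable_infinite_hilbert H \<longleftrightarrow>
    hilbert_space H \<and> separable_space (htopology H) \<and>
    \<not> vectorspace.fin_dim (class_ring :: complex ring) H"

section \<open>Bounded operators\<close>

text \<open>
  Operators are functions on the whole type of which only the values on the carrier
  of the domain matter.
\<close>

definition bounded_ops :: "'a hspace \<Rightarrow> 'a hspace \<Rightarrow> ('a \<Rightarrow> 'a) set" where
  "bounded_ops H K = {T \<in> LinearCombinations.module_hom class_ring H K.
     \<exists>C. \<forall>x\<in>carrier H. hnorm K (T x) \<le> C * hnorm H x}"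

definition op_norm :: "'a hspace \<Rightarrow> 'a hspace \<Rightarrow> ('a \<Rightarrow> 'a) \<Rightarrow> real" where
  "op_norm H K T = Sup {hnorm K (T x) | x. x \<in> carrier H \<and> hnorm H x \<le> 1}"

definition adj :: "'a hspace \<Rightarrow> 'a hspace \<Rightarrow> ('a \<Rightarrow> 'a) \<Rightarrow> 'a \<Rightarrow> 'a" where
  "adj H K T y = (THE z. z \<in> carrier H \<and> (\<forall>x\<in>carrier H. ip K (T x) y = ip H x z))"

definition unitary :: "'a hspace \<Rightarrow> 'a hspace \<Rightarrow> ('a \<Rightarrow> 'a) \<Rightarrow> bool" where
  "unitary H K U \<longleftrightarrow> U \<in> bounded_ops H K \<and>
     (\<forall>x\<in>carrier H. adj H K U (U x) = x) \<and> (\<forall>y\<in>carrier K. U (adj H K U y) = y)"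

definition spectrum :: "'a hspace \<Rightarrow> ('a \<Rightarrow> 'a) \<Rightarrow> complex set" where
  "spectrum H T = {z. \<not> (\<exists>S\<in>bounded_ops H H. \<forall>x\<in>carrier H.
     S (T x \<ominus>\<^bsub>H\<^esub> z \<odot>\<^bsub>H\<^esub> x) = x \<and> T (S x) \<ominus>\<^bsub>H\<^esub> z \<odot>\<^bsub>H\<^esub> S x = x)}"

definition eigspace :: "'a hspace \<Rightarrow> ('a \<Rightarrow> 'a) \<Rightarrow> complex \<Rightarrow> 'a hspace" where
  "eigspace H T z = H\<lparr>carrier := {x \<in> carrier H. T x = z \<odot>\<^bsub>H\<^esub> x}\<rparr>"

definition is_eigenvalue :: "'a hspace \<Rightarrow> ('a \<Rightarrow> 'a) \<Rightarrow> complex \<Rightarrow> bool" where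
  "is_eigenvalue H T z \<longleftrightarrow> (\<exists>x\<in>carrier (eigspace H T z). x \<noteq> \<zero>\<^bsub>H\<^esub>)"

definition finite_mult :: "'a hspace \<Rightarrow> ('a \<Rightarrow> 'a) \<Rightarrow> complex \<Rightarrow> bool" where
  "finite_mult H T z \<longleftrightarrow> vectorspace.fin_dim (class_ring :: complex ring) (eigspace H T z)"

text \<open>
  All operators below are self-adjoint, so the dimension of the eigenspace is the
  multiplicity; the value is meaningful only for a finite-dimensional eigenspace.
\<close>

definition mult_eig :: "'a hspace \<Rightarrow> ('a \<Rightarrow> 'a) \<Rightarrow> complex \<Rightarrow> nat" where
  "mult_eig H T z = vectorspace.dim (class_ring :: complex ring) (eigspace H T z)"

definition disc_spectrum :: "'a hspace \<Rightarrow> ('a \<Rightarrow> 'a) \<Rightarrow> complex set" where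
  "disc_spectrum H T =
    {z. z isolated_in spectrum H T \<and> is_eigenvalue H T z \<and> finite_mult H T z}"

definition ess_spectrum :: "'a hspace \<Rightarrow> ('a \<Rightarrow> 'a) \<Rightarrow> complex set" where
  "ess_spectrum H T = spectrum H T - disc_spectrum H T"

definition compact_op :: "'a hspace \<Rightarrow> ('a \<Rightarrow> 'a) \<Rightarrow> bool" where
  "compact_op H T \<longleftrightarrow> T \<in> bounded_ops H H \<and>
     compactin (htopology H)
       (htopology H closure_of (T ` {x \<in> carrier H. hnorm H x \<le> 1}))"

definition B01 :: "'a hspace \<Rightarrow> ('a \<Rightarrow> 'a) set" where
  "B01 H = {R \<in> bounded_ops H H.
     (\<forall>x\<in>carrier H. adj H H R x = R x) \<and> inj_on R (carrier H) \<and>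
     spectrum H R \<subseteq> complex_of_real ` {0..1}}"

definition K01 :: "'a hspace \<Rightarrow> ('a \<Rightarrow> 'a) set" where
  "K01 H = {R \<in> B01 H. compact_op H R}"

text \<open>
  An operator carries its space with it, so that the unions over all spaces in \<open>HS\<close>
  become sets of pairs.
\<close>

type_synonym 'a hop = "'a hspace \<times> ('a \<Rightarrow> 'a)"

definition Bops :: "'a hspace set \<Rightarrow> 'a hop set" where
  "Bops HS = (SIGMA H:HS. B01 H)"

definition Kops :: "'a hspace set \<Rightarrow> 'a hop set" where
  "Kops HS = (SIGMA H:HS. K01 H)"

definition unitarily_equivalent :: "'a hop \<Rightarrow> 'a hop \<Rightarrow> bool" where
  "unitarily_equivalent = (\<lambda>(H, R) (K, S).
     \<exists>U. unitary H K U \<and> (\<forall>y\<in>carrier K. S y = U (R (adj H K U y))))"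

section \<open>The quasi-unitary distance\<close>

definition quasi_unitarily_equivalent :: "real \<Rightarrow> 'a hop \<Rightarrow> 'a hop \<Rightarrow> bool" where
  "quasi_unitarily_equivalent \<delta> = (\<lambda>(H, R) (K, S).
     \<exists>J \<in> bounded_ops H K. \<exists>J' \<in> bounded_ops K H.
       op_norm H K J \<le> 1 + \<delta> \<and> op_norm K H J' \<le> 1 + \<delta> \<and>
       op_norm K H (\<lambda>y. J' y \<ominus>\<^bsub>H\<^esub> adj H K J y) \<le> \<delta> \<and>
       op_norm H H (\<lambda>x. R x \<ominus>\<^bsub>H\<^esub> J' (J (R x))) \<le> \<delta> \<and>
       op_norm K K (\<lambda>y. S y \<ominus>\<^bsub>K\<^esub> J (J' (S y))) \<le> \<delta> \<and>
       op_norm H K (\<lambda>x. J (R x) \<ominus>\<^bsub>K\<^esub> S (J x)) \<le> \<delta> \<and>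
       op_norm K H (\<lambda>y. J' (S y) \<ominus>\<^bsub>H\<^esub> R (J' y)) \<le> \<delta>)"

definition d_quni :: "'a hop \<Rightarrow> 'a hop \<Rightarrow> real" where
  "d_quni R S = Inf {\<delta>. 0 \<le> \<delta> \<and> quasi_unitarily_equivalent \<delta> R S}"

definition \<Phi> :: "real \<Rightarrow> real \<Rightarrow> real" where
  "\<Phi> a b = 3 * (a + b) + (a + b)^2 + 2 * a * b + (a + b)^3 + a^2 * b^2"

definition semimetric_on :: "'b set \<Rightarrow> ('b \<Rightarrow> 'b \<Rightarrow> real) \<Rightarrow> bool" where
  "semimetric_on M d \<longleftrightarrow> (\<forall>x\<in>M. \<forall>y\<in>M.
     0 \<le> d x y \<and> d x y = d y x \<and> (d x y = 0 \<longleftrightarrow> x = y))"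

definition relaxed_triangle_on :: "'b set \<Rightarrow> ('b \<Rightarrow> 'b \<Rightarrow> real) \<Rightarrow> bool" where
  "relaxed_triangle_on M d \<longleftrightarrow>
     (\<forall>x\<in>M. \<forall>y\<in>M. \<forall>z\<in>M. d x z \<le> \<Phi> (d x y) (d y z))"

section \<open>Unitary equivalence classes and eigenvalue sequences\<close>

definition unitary_rel :: "'a hspace set \<Rightarrow> 'a hop rel" where
  "unitary_rel HS = {(p, q). p \<in> Kops HS \<and> q \<in> Kops HS \<and> unitarily_equivalent p q}"

definition Kclasses :: "'a hspace set \<Rightarrow> 'a hop set set" where
  "Kclasses HS = Kops HS // unitary_rel HS"

definition d_class :: "'a hop set \<Rightarrow> 'a hop set \<Rightarrow> real" where
  "d_class X Y = d_quni (SOME p. p \<in> X) (SOME q. q \<in> Y)"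

definition Sigma_seq :: "(nat \<Rightarrow> real) set" where
  "Sigma_seq = {\<mu>. \<mu> \<longlonglongrightarrow> 0 \<and> (\<forall>k. 0 < \<mu> (Suc k) \<and> \<mu> (Suc k) \<le> \<mu> k \<and> \<mu> k \<le> 1)}"

text \<open>The non-increasing sequence of eigenvalues, repeated according to multiplicity.\<close>

definition eig_seq :: "'a hop \<Rightarrow> nat \<Rightarrow> real" where
  "eig_seq = (\<lambda>(H, R). THE \<mu>. decseq \<mu> \<and>
     (\<forall>k. is_eigenvalue H R (complex_of_real (\<mu> k))) \<and>
     (\<forall>z. is_eigenvalue H R z \<longrightarrow>
        finite {k. complex_of_real (\<mu> k) = z} \<and>
        card {k. complex_of_real (\<mu> k) = z} = mult_eig H R z))"

definition class_eig_seq :: "'a hop set \<Rightarrow> nat \<Rightarrow> real" where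
  "class_eig_seq X = eig_seq (SOME p. p \<in> X)"

text \<open>
  The distance on classes, transported along the bijection \<^const>\<open>class_eig_seq\<close>
  from \<^term>\<open>Kclasses HS\<close> to \<^const>\<open>Sigma_seq\<close>.
\<close>

definition d_Sigma :: "'a hspace set \<Rightarrow> (nat \<Rightarrow> real) \<Rightarrow> (nat \<Rightarrow> real) \<Rightarrow> real" where
  "d_Sigma HS \<mu> \<nu> =
     d_class (inv_into (Kclasses HS) class_eig_seq \<mu>) (inv_into (Kclasses HS) class_eig_seq \<nu>)"

end

theory Submission
  imports Defs
begin

text \<open>
  Quasi-unitary equivalence composes up to constants, which gives the relaxed triangle inequality:
  in the composition \<open>LJ\<close> the defect \<open>1 - L'L\<close> acts on \<open>JR\<close>, which is close to
  \<open>R\<^sub>2J\<close>, and on the range of \<open>R\<^sub>2\<close> this defect is small by assumption. Elsewhere it is almost a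
  contraction as long as the norms of the identification operators are close to 1
  (\<open>id_minus_JJ_bound\<close>). Large parameters need no estimate, since 1 bounds every distance:
  an operator whose spectrum lies in the unit interval is a contraction.

  The spectra are compared through a numerical invariant that survives perturbation,
  namely the largest number \<open>n\<close> such that for every \<open>\<epsilon>\<close> there are \<open>n\<close> almost orthonormal
  vectors \<open>f\<close> with \<open>\<parallel>Rf - zf\<parallel> \<le> \<epsilon>\<close> (\<open>almost_eig\<close>). A number \<open>z\<close> is in the spectrum if and only if
  \<open>n \<ge> 1\<close>; the invariant is infinite on the essential spectrum, and it is the multiplicity on
  the discrete spectrum. The last two facts rest on the behaviour of \<open>A = R - z\<close> at an isolated
  point \<open>z\<close> of the spectrum: \<open>A\<close> is bounded below on the orthogonal complement of its kernel
  (\<open>gap_bound_on_range\<close>, \<open>bound_on_kernel_complement\<close>). This is proved without functional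
  calculus, by factoring a polynomial in \<open>A\<close> of degree 4. For \<open>z \<noteq> 0\<close> an approximate
  eigenvector nearly lies in the range of \<open>R\<close>, where \<open>J'J\<close> is close to the identity, so \<open>J\<close>
  transports such families; the point 0 is never in the discrete spectrum, because \<open>R\<close> is
  injective, and it is an accumulation point of the spectrum if it belongs to it.

  Compact operators have an orthonormal basis of eigenvectors
  (\<open>spectral_theorem_compact\<close>), and all eigenvalues are in the discrete spectrum. Hence distance
  0 forces equal eigenvalue sequences, and two operators with equal sequences are unitarily
  equivalent by the map that matches their eigenbases. So unitary equivalence on compact
  operators is equality of eigenvalue sequences, and every sequence in \<open>Sigma_seq\<close> occurs,
  as a diagonal operator. The statements on classes and on sequences follow once the
  distance is known to be invariant under unitary equivalence.
\<close>

section \<open>Inner product calculus\<close>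

context hilbert_space
begin

lemma minus_as_add:
  assumes "x \<in> carrier H" "y \<in> carrier H"
  shows "x \<ominus> y = x \<oplus> (-1) \<odot> y"
  using assms smult_minus_1[of y] by (simp add: a_minus_def class_ring_simps)

lemma smult_mem [simp]: "x \<in> carrier H \<Longrightarrow> c \<odot> x \<in> carrier H"
  by simp

lemma ip_add_left:
  assumes "x \<in> carrier H" "y \<in> carrier H" "z \<in> carrier H"
  shows "ip H (x \<oplus> y) z = ip H x z + ip H y z"
  using assms ip_add_right[of z x y] ip_cnj[of z "x \<oplus> y"] ip_cnj[of z x] ip_cnj[of z y] by simp

lemma ip_smult_left:
  assumes "x \<in> carrier H" "y \<in> carrier H"
  shows "ip H (c \<odot> x) y = cnj c * ip H x y"
  using assms ip_smult_right[of y x c] ip_cnj[of y "c \<odot> x"] ip_cnj[of y x] by simp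

lemma ip_zero_right [simp]: "x \<in> carrier H \<Longrightarrow> ip H x \<zero> = 0"
  using ip_add_right[of x \<zero> \<zero>] by simp

lemma ip_zero_left [simp]: "x \<in> carrier H \<Longrightarrow> ip H \<zero> x = 0"
  using ip_cnj[of x \<zero>] by simp

lemma ip_diff_right:
  assumes "x \<in> carrier H" "y \<in> carrier H" "z \<in> carrier H"
  shows "ip H x (y \<ominus> z) = ip H x y - ip H x z"
  using assms by (simp add: minus_as_add ip_add_right ip_smult_right)

lemma ip_diff_left:
  assumes "x \<in> carrier H" "y \<in> carrier H" "z \<in> carrier H"
  shows "ip H (x \<ominus> y) z = ip H x z - ip H y z"
  using assms by (simp add: minus_as_add ip_add_left ip_smult_left)

lemmas ip_simps = ip_add_right ip_add_left ip_smult_right ip_smult_left ip_diff_right ip_diff_left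

lemma Re_ip_self_nonneg: "x \<in> carrier H \<Longrightarrow> 0 \<le> Re (ip H x x)"
  using ip_pos[of x] by (cases "x = \<zero>") auto

lemma hnorm_nonneg [simp]: "x \<in> carrier H \<Longrightarrow> 0 \<le> hnorm H x"
  using Re_ip_self_nonneg by (simp add: hnorm_def)

lemma ip_self: "x \<in> carrier H \<Longrightarrow> ip H x x = complex_of_real ((hnorm H x)\<^sup>2)"
  using Re_ip_self_nonneg[of x] ip_cnj[of x x]
  by (simp add: hnorm_def complex_eq_iff)

lemma hnorm_sq: "x \<in> carrier H \<Longrightarrow> (hnorm H x)\<^sup>2 = Re (ip H x x)"
  by (simp add: ip_self)

lemma hnorm_eq_0_iff: "x \<in> carrier H \<Longrightarrow> hnorm H x = 0 \<longleftrightarrow> x = \<zero>"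
  using ip_pos[of x] Re_ip_self_nonneg[of x] by (cases "x = \<zero>") (auto simp: hnorm_def)

lemma hnorm_zero [simp]: "hnorm H \<zero> = 0"
  by (simp add: hnorm_def)

lemma hnorm_pos: "x \<in> carrier H \<Longrightarrow> x \<noteq> \<zero> \<Longrightarrow> 0 < hnorm H x"
  using hnorm_eq_0_iff[of x] hnorm_nonneg[of x] by linarith

lemma hnorm_smult: "x \<in> carrier H \<Longrightarrow> hnorm H (c \<odot> x) = cmod c * hnorm H x"
proof -
  assume x: "x \<in> carrier H"
  have "ip H (c \<odot> x) (c \<odot> x) = (cnj c * c) * ip H x x"
    using x by (simp add: ip_simps)
  also have "\<dots> = complex_of_real ((cmod c * hnorm H x)\<^sup>2)"
    using x by (simp add: ip_self complex_norm_square power_mult_distrib mult.commute del: of_real_power)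
  finally have "complex_of_real ((hnorm H (c \<odot> x))\<^sup>2) = complex_of_real ((cmod c * hnorm H x)\<^sup>2)"
    using x by (simp only: ip_self smult_mem)
  then have "(hnorm H (c \<odot> x))\<^sup>2 = (cmod c * hnorm H x)\<^sup>2"
    by (simp only: of_real_eq_iff)
  then show ?thesis using x by (simp add: power2_eq_iff_nonneg)
qed

lemma diff_eq_zero_iff:
  "x \<in> carrier H \<Longrightarrow> y \<in> carrier H \<Longrightarrow> x \<ominus> y = \<zero> \<longleftrightarrow> x = y"
  by simp

text \<open>Vectors are determined by their inner products, so that identities between vectors
  reduce to identities between complex numbers.\<close>

lemma ip_ext:
  assumes "x \<in> carrier H" "y \<in> carrier H" "\<And>z. z \<in> carrier H \<Longrightarrow> ip H z x = ip H z y"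
  shows "x = y"
proof -
  have "ip H (x \<ominus> y) (x \<ominus> y) = 0"
    using assms by (simp add: ip_diff_right)
  then have "hnorm H (x \<ominus> y) = 0" by (simp add: hnorm_def)
  then show ?thesis using assms by (simp add: hnorm_eq_0_iff diff_eq_zero_iff)
qed

lemma smult_simps [simp]:
  "x \<in> carrier H \<Longrightarrow> 0 \<odot> x = \<zero>" "c \<odot> \<zero> = \<zero>" "x \<in> carrier H \<Longrightarrow> 1 \<odot> x = x"
  by (rule ip_ext; simp add: ip_simps)+

lemma diff_self [simp]: "x \<in> carrier H \<Longrightarrow> x \<ominus> x = \<zero>"
  by simp

lemma diff_zero [simp]: "x \<in> carrier H \<Longrightarrow> x \<ominus> \<zero> = x"
  by (rule ip_ext) (simp_all add: ip_simps)

lemma hnorm_sq_add: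
  assumes "x \<in> carrier H" "y \<in> carrier H"
  shows "(hnorm H (x \<oplus> y))\<^sup>2 = (hnorm H x)\<^sup>2 + (hnorm H y)\<^sup>2 + 2 * Re (ip H x y)"
  using assms ip_cnj[of x y] by (simp add: hnorm_sq ip_simps)

lemma hnorm_sq_diff:
  assumes "x \<in> carrier H" "y \<in> carrier H"
  shows "(hnorm H (x \<ominus> y))\<^sup>2 = (hnorm H x)\<^sup>2 + (hnorm H y)\<^sup>2 - 2 * Re (ip H x y)"
  using assms ip_cnj[of x y] by (simp add: hnorm_sq ip_simps)

lemma hnorm_sq_diff_component:
  assumes "m \<in> carrier H" "w \<in> carrier H"
  shows "(hnorm H (w \<ominus> (ip H m w / complex_of_real ((hnorm H m)\<^sup>2)) \<odot> m))\<^sup>2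
    = (hnorm H w)\<^sup>2 - (cmod (ip H m w))\<^sup>2 / (hnorm H m)\<^sup>2"
proof (cases "hnorm H m = 0")
  case True
  then show ?thesis using assms by (simp add: hnorm_sq_diff ip_smult_right hnorm_smult)
next
  case False
  let ?p = "ip H m w" and ?n = "(hnorm H m)\<^sup>2"
  have w: "ip H w m = cnj ?p" using assms ip_cnj[of m w] by simp
  have e: "?p * cnj ?p = complex_of_real ((cmod ?p)\<^sup>2)" by (simp only: complex_norm_square)
  have "Re (ip H w ((?p / complex_of_real ?n) \<odot> m)) = (cmod ?p)\<^sup>2 / ?n"
    using assms w e by (simp add: ip_smult_right del: of_real_power) 
      
  moreover have "(hnorm H ((?p / complex_of_real ?n) \<odot> m))\<^sup>2 = (cmod ?p)\<^sup>2 / ?n"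
    using assms False by (simp add: hnorm_smult norm_divide power_mult_distrib power_divide norm_power)
      (simp add: power2_eq_square power4_eq_xxxx field_simps)
  ultimately show ?thesis using assms by (simp add: hnorm_sq_diff)
qed

lemma cauchy_schwarz:
  assumes "x \<in> carrier H" "y \<in> carrier H"
  shows "cmod (ip H x y) \<le> hnorm H x * hnorm H y"
proof (cases "x = \<zero>")
  case False
  then have p: "0 < hnorm H x" using assms hnorm_pos by simp
  have "0 \<le> (hnorm H y)\<^sup>2 - (cmod (ip H x y))\<^sup>2 / (hnorm H x)\<^sup>2"
    using hnorm_sq_diff_component[OF assms] by (metis zero_le_power2)
  then have "(cmod (ip H x y))\<^sup>2 \<le> (hnorm H x * hnorm H y)\<^sup>2"
    using p by (simp add: field_simps power_mult_distrib)
  then show ?thesis using assms by (simp add: power2_le_iff_abs_le)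
qed (use assms in simp)

lemma hnorm_triangle:
  assumes "x \<in> carrier H" "y \<in> carrier H"
  shows "hnorm H (x \<oplus> y) \<le> hnorm H x + hnorm H y"
proof -
  have "Re (ip H x y) \<le> hnorm H x * hnorm H y"
    using cauchy_schwarz[OF assms] complex_Re_le_cmod order_trans by blast
  then have "(hnorm H (x \<oplus> y))\<^sup>2 \<le> (hnorm H x + hnorm H y)\<^sup>2"
    using hnorm_sq_add[OF assms] by (simp add: power2_sum)
  then show ?thesis using assms by (simp add: power2_le_iff_abs_le)
qed

lemma hnorm_diff_triangle:
  assumes "x \<in> carrier H" "y \<in> carrier H"
  shows "hnorm H (x \<ominus> y) \<le> hnorm H x + hnorm H y"
  using hnorm_triangle[of x "(-1) \<odot> y"] assms by (simp add: minus_as_add hnorm_smult)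

lemma hnorm_minus_commute:
  assumes "x \<in> carrier H" "y \<in> carrier H"
  shows "hnorm H (x \<ominus> y) = hnorm H (y \<ominus> x)"
proof -
  have "x \<ominus> y = (-1) \<odot> (y \<ominus> x)"
    by (rule ip_ext) (use assms in \<open>simp_all add: ip_simps\<close>)
  then show ?thesis using assms hnorm_smult[of "y \<ominus> x" "-1"] by simp
qed

lemma hnorm_triangle_via:
  assumes "x \<in> carrier H" "y \<in> carrier H" "z \<in> carrier H"
  shows "hnorm H (x \<ominus> z) \<le> hnorm H (x \<ominus> y) + hnorm H (y \<ominus> z)"
proof -
  have "x \<ominus> z = (x \<ominus> y) \<oplus> (y \<ominus> z)"
    by (rule ip_ext) (use assms in \<open>simp_all add: ip_simps\<close>)
  then show ?thesis using assms hnorm_triangle[of "x \<ominus> y" "y \<ominus> z"] by simp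
qed

lemma hnorm_le_diff_add:
  assumes "x \<in> carrier H" "y \<in> carrier H"
  shows "hnorm H x \<le> hnorm H (x \<ominus> y) + hnorm H y"
proof -
  have "x = (x \<ominus> y) \<oplus> y"
    by (rule ip_ext) (use assms in \<open>simp_all add: ip_simps\<close>)
  then show ?thesis using assms hnorm_triangle[of "x \<ominus> y" y] by simp
qed

section \<open>Limits and completeness\<close>

lemma metric_space_hdist: "Metric_space (carrier H) (hdist H)"
proof
  show "0 \<le> hdist H x y" for x y by (simp add: hdist_def)
  show "hdist H x y = hdist H y x" for x y
    by (simp add: hdist_def hnorm_minus_commute)
  show "hdist H x y = 0 \<longleftrightarrow> x = y" if "x \<in> carrier H" "y \<in> carrier H" for x y
    using that by (simp add: hdist_def hnorm_eq_0_iff diff_eq_zero_iff)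
  show "hdist H x z \<le> hdist H x y + hdist H y z"
    if "x \<in> carrier H" "y \<in> carrier H" "z \<in> carrier H" for x y z
    using that hnorm_triangle_via by (simp add: hdist_def)
qed

sublocale MS: Metric_space "carrier H" "hdist H"
  by (rule metric_space_hdist)

lemma limitin_iff:
  assumes "\<And>n. s n \<in> carrier H" "l \<in> carrier H"
  shows "limitin (htopology H) s l sequentially \<longleftrightarrow> (\<lambda>n. hnorm H (s n \<ominus> l)) \<longlonglongrightarrow> 0"
  using assms by (simp add: htopology_def MS.limitin_metric_dist_null hdist_def)

lemma cauchy_limit:
  assumes s: "\<And>n. s n \<in> carrier H"
    and c: "\<And>e. e > 0 \<Longrightarrow> \<exists>N. \<forall>m\<ge>N. \<forall>n\<ge>N. hnorm H (s m \<ominus> s n) < e"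
  shows "\<exists>l\<in>carrier H. (\<lambda>n. hnorm H (s n \<ominus> l)) \<longlonglongrightarrow> 0"
proof -
  have "MS.MCauchy s"
    unfolding MS.MCauchy_def hdist_def using s c by fastforce
  then obtain l where l: "limitin (htopology H) s l sequentially"
    using complete unfolding MS.mcomplete_def htopology_def by blast
  then have "l \<in> carrier H" by (simp add: htopology_def MS.limitin_mspace)
  then show ?thesis using l s limitin_iff by blast
qed

lemma tendsto_ip:
  assumes "\<And>n. s n \<in> carrier H" "l \<in> carrier H" "y \<in> carrier H"
    "(\<lambda>n. hnorm H (s n \<ominus> l)) \<longlonglongrightarrow> 0"
  shows "(\<lambda>n. ip H y (s n)) \<longlonglongrightarrow> ip H y l"
proof -
  have "(\<lambda>n. ip H y (s n) - ip H y l) \<longlonglongrightarrow> 0"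
  proof (rule Lim_null_comparison)
    show "(\<lambda>n. hnorm H y * hnorm H (s n \<ominus> l)) \<longlonglongrightarrow> 0"
      using tendsto_mult_left[OF assms(4), of "hnorm H y"] by simp
    show "\<forall>\<^sub>F n in sequentially. cmod (ip H y (s n) - ip H y l) \<le> hnorm H y * hnorm H (s n \<ominus> l)"
      using cauchy_schwarz[of y "s _ \<ominus> l"] assms by (simp add: ip_diff_right)
  qed
  then show ?thesis by (simp add: LIM_zero_iff)
qed

lemma abs_hnorm_diff:
  assumes "x \<in> carrier H" "y \<in> carrier H"
  shows "\<bar>hnorm H x - hnorm H y\<bar> \<le> hnorm H (x \<ominus> y)"
  using hnorm_le_diff_add[of x y] hnorm_le_diff_add[of y x] hnorm_minus_commute[of x y] assms
  by linarith

lemma tendsto_hnorm: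
  assumes "\<And>n. s n \<in> carrier H" "l \<in> carrier H"
    "(\<lambda>n. hnorm H (s n \<ominus> l)) \<longlonglongrightarrow> 0"
  shows "(\<lambda>n. hnorm H (s n)) \<longlonglongrightarrow> hnorm H l"
proof -
  have "(\<lambda>n. hnorm H (s n) - hnorm H l) \<longlonglongrightarrow> 0"
    by (rule Lim_null_comparison[OF _ assms(3)]) (use assms abs_hnorm_diff in simp)
  then show ?thesis by (simp add: LIM_zero_iff)
qed

section \<open>Orthogonal projections and the Riesz representation\<close>

lemma best_approximation_orthogonal:
  assumes M: "M \<subseteq> carrier H" "\<And>a b. a \<in> M \<Longrightarrow> b \<in> M \<Longrightarrow> a \<oplus> b \<in> M"
      "\<And>c a. a \<in> M \<Longrightarrow> c \<odot> a \<in> M"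
    and z: "z \<in> M" "y \<in> carrier H"
    and best: "\<And>m. m \<in> M \<Longrightarrow> hnorm H (y \<ominus> z) \<le> hnorm H (y \<ominus> m)"
    and m: "m \<in> M"
  shows "ip H m (y \<ominus> z) = 0"
proof (cases "m = \<zero>")
  case True
  then show ?thesis using z M by (simp add: subset_iff)
next
  case False
  have mc: "m \<in> carrier H" "z \<in> carrier H" using m z M by auto
  let ?w = "y \<ominus> z"
  let ?c = "ip H m ?w / complex_of_real ((hnorm H m)\<^sup>2)"
  have p: "0 < (hnorm H m)\<^sup>2" using hnorm_pos[OF mc(1) False] by simp
  have "y \<ominus> (z \<oplus> ?c \<odot> m) = ?w \<ominus> ?c \<odot> m"
    by (rule ip_ext) (use mc z in \<open>simp_all add: ip_simps\<close>)
  then have "hnorm H ?w \<le> hnorm H (?w \<ominus> ?c \<odot> m)"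
    using best[of "z \<oplus> ?c \<odot> m"] M z m by simp
  then have "(hnorm H ?w)\<^sup>2 \<le> (hnorm H (?w \<ominus> ?c \<odot> m))\<^sup>2"
    by (rule power_mono) (use mc z in simp)
  then have "(cmod (ip H m ?w))\<^sup>2 / (hnorm H m)\<^sup>2 \<le> 0"
    unfolding hnorm_sq_diff_component[OF mc(1) M.minus_closed[OF z(2) mc(2)]] by linarith
  then show ?thesis using p by (simp add: divide_le_0_iff)
qed

text \<open>A minimizing sequence for the distance to a closed subspace is a Cauchy sequence by the
  parallelogram law; its limit is the orthogonal projection.\<close>

lemma orthogonal_projection:
  assumes M: "M \<subseteq> carrier H" "M \<noteq> {}" "\<And>a b. a \<in> M \<Longrightarrow> b \<in> M \<Longrightarrow> a \<oplus> b \<in> M"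
      "\<And>c a. a \<in> M \<Longrightarrow> c \<odot> a \<in> M"
    and closed: "\<And>s l. (\<And>n. s n \<in> M) \<Longrightarrow> l \<in> carrier H \<Longrightarrow>
        (\<lambda>n. hnorm H (s n \<ominus> l)) \<longlonglongrightarrow> 0 \<Longrightarrow> l \<in> M"
    and y: "y \<in> carrier H"
  shows "\<exists>z\<in>M. \<forall>m\<in>M. ip H m (y \<ominus> z) = 0"
proof -
  define D where "D = (\<lambda>m. (hnorm H (y \<ominus> m))\<^sup>2) ` M"
  define d where "d = Inf D"
  have bdd: "bdd_below D" unfolding D_def by (rule bdd_belowI[of _ 0]) auto
  have dle: "d \<le> (hnorm H (y \<ominus> m))\<^sup>2" if "m \<in> M" for m
    unfolding d_def by (rule cInf_lower[OF _ bdd]) (use that in \<open>auto simp: D_def\<close>)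
  have "\<exists>m\<in>M. (hnorm H (y \<ominus> m))\<^sup>2 < d + 1 / real (Suc n)" for n
    using cInf_lessD[of D "d + 1 / real (Suc n)"] M(2) unfolding d_def D_def by auto
  then obtain s where s: "\<And>n. s n \<in> M" "\<And>n. (hnorm H (y \<ominus> s n))\<^sup>2 < d + 1 / real (Suc n)"
    by metis
  have sc: "s n \<in> carrier H" for n using s M by auto
  have par: "(hnorm H (s m \<ominus> s n))\<^sup>2 \<le> 2 / real (Suc m) + 2 / real (Suc n)" for m n
  proof -
    let ?h = "(1/2) \<odot> (s m \<oplus> s n)"
    have h: "?h \<in> M" using s M by blast
    have e: "s m \<ominus> s n = (y \<ominus> s n) \<ominus> (y \<ominus> s m)"
      by (rule ip_ext) (use sc y in \<open>simp_all add: ip_simps\<close>)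
    have e2: "2 \<odot> (y \<ominus> ?h) = (y \<ominus> s n) \<oplus> (y \<ominus> s m)"
      by (rule ip_ext) (use sc y in \<open>simp_all add: ip_simps algebra_simps\<close>)
    have "(hnorm H (2 \<odot> (y \<ominus> ?h)))\<^sup>2 = 4 * (hnorm H (y \<ominus> ?h))\<^sup>2"
      using y sc by (simp add: hnorm_smult power_mult_distrib)
    then have "4 * d \<le> (hnorm H ((y \<ominus> s n) \<oplus> (y \<ominus> s m)))\<^sup>2"
      using dle[OF h] e2 by simp
    then show ?thesis
      unfolding e using hnorm_sq_add[of "y \<ominus> s n" "y \<ominus> s m"] hnorm_sq_diff[of "y \<ominus> s n" "y \<ominus> s m"]
        s(2)[of n] s(2)[of m] y sc by simp
  qed
  have "\<exists>l\<in>carrier H. (\<lambda>n. hnorm H (s n \<ominus> l)) \<longlonglongrightarrow> 0"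
  proof (rule cauchy_limit[OF sc])
    fix e :: real assume e: "e > 0"
    obtain N where "4 / e\<^sup>2 < real N"
      using reals_Archimedean2 by blast
    then have N: "4 / e\<^sup>2 < real (Suc N)" by simp
    have "hnorm H (s m \<ominus> s n) < e" if "m \<ge> N" "n \<ge> N" for m n
    proof -
      have "2 / real (Suc m) \<le> 2 / real (Suc N)" "2 / real (Suc n) \<le> 2 / real (Suc N)"
        using that by (simp_all add: frac_le)
      then have "2 / real (Suc m) + 2 / real (Suc n) \<le> 4 / real (Suc N)"
        by linarith
      also have "\<dots> < e\<^sup>2" using N e by (simp add: field_simps)
      finally have "(hnorm H (s m \<ominus> s n))\<^sup>2 < e\<^sup>2" using par[of m n] by linarith
      then show ?thesis using e by (simp add: power_less_imp_less_base)
    qed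
    then show "\<exists>N. \<forall>m\<ge>N. \<forall>n\<ge>N. hnorm H (s m \<ominus> s n) < e" by blast
  qed
  then obtain z where z: "z \<in> carrier H" "(\<lambda>n. hnorm H (s n \<ominus> z)) \<longlonglongrightarrow> 0" by blast
  have zM: "z \<in> M" by (rule closed[OF s(1) z])
  have "(\<lambda>n. hnorm H ((y \<ominus> s n) \<ominus> (y \<ominus> z))) \<longlonglongrightarrow> 0"
  proof -
    have "(y \<ominus> s n) \<ominus> (y \<ominus> z) = z \<ominus> s n" for n
      by (rule ip_ext) (use sc y z in \<open>simp_all add: ip_simps\<close>)
    then show ?thesis using z sc hnorm_minus_commute by simp
  qed
  then have "(\<lambda>n. hnorm H (y \<ominus> s n)) \<longlonglongrightarrow> hnorm H (y \<ominus> z)"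
    by (intro tendsto_hnorm) (use sc y z in auto)
  then have "(\<lambda>n. (hnorm H (y \<ominus> s n))\<^sup>2) \<longlonglongrightarrow> (hnorm H (y \<ominus> z))\<^sup>2"
    by (rule tendsto_power)
  moreover have "(\<lambda>n. d + 1 / real (Suc n)) \<longlonglongrightarrow> d + 0"
    by (intro tendsto_add tendsto_const LIMSEQ_Suc[OF lim_1_over_n])
  ultimately have "(hnorm H (y \<ominus> z))\<^sup>2 \<le> d + 0"
    by (rule LIMSEQ_le) (intro exI allI impI less_imp_le s(2))
  then have zd: "(hnorm H (y \<ominus> z))\<^sup>2 \<le> d" by simp
  have "hnorm H (y \<ominus> z) \<le> hnorm H (y \<ominus> m)" if "m \<in> M" for m
    using order_trans[OF zd dle[OF that]] that M(1) y
    by (intro power2_le_imp_le[of "hnorm H (y \<ominus> z)"]) auto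
  then have "\<forall>m\<in>M. ip H m (y \<ominus> z) = 0"
    by (intro ballI best_approximation_orthogonal[OF M(1,3,4) zM y])
  with zM show ?thesis by blast
qed

lemma riesz_representation:
  assumes add: "\<And>x y. x \<in> carrier H \<Longrightarrow> y \<in> carrier H \<Longrightarrow> f (x \<oplus> y) = f x + f y"
    and smult: "\<And>c x. x \<in> carrier H \<Longrightarrow> f (c \<odot> x) = c * f x"
    and bound: "\<And>x. x \<in> carrier H \<Longrightarrow> cmod (f x) \<le> C * hnorm H x"
  shows "\<exists>z\<in>carrier H. \<forall>x\<in>carrier H. f x = ip H z x"
proof (cases "\<forall>x\<in>carrier H. f x = 0")
  case True
  then show ?thesis by (intro bexI[of _ \<zero>]) auto
next
  case False
  then obtain y where y: "y \<in> carrier H" "f y \<noteq> 0" by blast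
  have diff: "f (x \<ominus> y) = f x - f y" if "x \<in> carrier H" "y \<in> carrier H" for x y
    using that by (simp add: minus_as_add add smult)
  define M where "M = {x \<in> carrier H. f x = 0}"
  have "\<exists>z\<in>M. \<forall>m\<in>M. ip H m (y \<ominus> z) = 0"
  proof (rule orthogonal_projection)
    have "\<zero> \<in> M" using smult[of \<zero> 0] by (simp add: M_def)
    then show "M \<noteq> {}" by blast
    fix s l
    assume s: "\<And>n. s n \<in> M" "l \<in> carrier H" "(\<lambda>n. hnorm H (s n \<ominus> l)) \<longlonglongrightarrow> 0"
    have "(\<lambda>n. f (s n \<ominus> l)) \<longlonglongrightarrow> 0"
    proof (rule Lim_null_comparison)
      show "\<forall>\<^sub>F n in sequentially. cmod (f (s n \<ominus> l)) \<le> C * hnorm H (s n \<ominus> l)"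
        using bound[of "s _ \<ominus> l"] s(1,2) by (simp add: M_def)
      show "(\<lambda>n. C * hnorm H (s n \<ominus> l)) \<longlonglongrightarrow> 0"
        using tendsto_mult_left[OF s(3), of C] by simp
    qed
    moreover have "f (s n \<ominus> l) = - f l" for n using s(1)[of n] s(2) diff[of "s n" l] by (simp add: M_def)
    ultimately show "l \<in> M" using s(2) by (simp add: M_def LIMSEQ_const_iff)
  next
    show "y \<in> carrier H" by (fact y(1))
  qed (simp_all add: M_def add smult subset_iff)
  then obtain z where z: "z \<in> M" "\<And>m. m \<in> M \<Longrightarrow> ip H m (y \<ominus> z) = 0" by blast
  have zc: "z \<in> carrier H" "f z = 0" using z(1) by (simp_all add: M_def)
  define w where "w = y \<ominus> z"
  have w: "w \<in> carrier H" "f w \<noteq> 0" unfolding w_def using zc y by (simp_all add: diff)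
  have wM: "ip H m w = 0" if "m \<in> M" for m using z(2)[OF that] by (simp add: w_def)
  have f0: "f \<zero> = 0" using smult[of \<zero> 0] by simp
  have n: "hnorm H w \<noteq> 0" using w f0 hnorm_eq_0_iff[OF w(1)] by metis
  let ?c = "cnj (f w) / complex_of_real ((hnorm H w)\<^sup>2)"
  have "f x = ip H (?c \<odot> w) x" if x: "x \<in> carrier H" for x
  proof -
    let ?m = "x \<ominus> (f x / f w) \<odot> w"
    have m: "?m \<in> carrier H" using x w by simp
    have "f ?m = 0" using x w diff[of x "(f x / f w) \<odot> w"] smult[of w "f x / f w"] by simp
    then have "ip H ?m w = 0" using m by (intro wM) (simp add: M_def)
    then have "ip H w ?m = 0" using ip_cnj[OF m w(1)] by simp
    then have "ip H w x = (f x / f w) * complex_of_real ((hnorm H w)\<^sup>2)"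
      using x w by (simp add: ip_diff_right ip_smult_right ip_self)
    then show ?thesis using x w n by (simp add: ip_smult_left)
  qed
  moreover have "?c \<odot> w \<in> carrier H" using w by simp
  ultimately show ?thesis by blast
qed

end

section \<open>Bounded operators and adjoints\<close>

lemma bops_mem: "T \<in> bounded_ops H K \<Longrightarrow> x \<in> carrier H \<Longrightarrow> T x \<in> carrier K"
  by (auto simp: bounded_ops_def LinearCombinations.module_hom_def)

lemma bops_add: "T \<in> bounded_ops H K \<Longrightarrow> x \<in> carrier H \<Longrightarrow> y \<in> carrier H \<Longrightarrow>
    T (x \<oplus>\<^bsub>H\<^esub> y) = T x \<oplus>\<^bsub>K\<^esub> T y"
  by (auto simp: bounded_ops_def LinearCombinations.module_hom_def)

lemma bops_smult: "T \<in> bounded_ops H K \<Longrightarrow> x \<in> carrier H \<Longrightarrow> T (c \<odot>\<^bsub>H\<^esub> x) = c \<odot>\<^bsub>K\<^esub> T x"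
  by (auto simp: bounded_ops_def LinearCombinations.module_hom_def)

lemma bopsI:
  assumes "\<And>x. x \<in> carrier H \<Longrightarrow> T x \<in> carrier K"
    "\<And>x y. x \<in> carrier H \<Longrightarrow> y \<in> carrier H \<Longrightarrow> T (x \<oplus>\<^bsub>H\<^esub> y) = T x \<oplus>\<^bsub>K\<^esub> T y"
    "\<And>c x. x \<in> carrier H \<Longrightarrow> T (c \<odot>\<^bsub>H\<^esub> x) = c \<odot>\<^bsub>K\<^esub> T x"
    "\<And>x. x \<in> carrier H \<Longrightarrow> hnorm K (T x) \<le> C * hnorm H x"
  shows "T \<in> bounded_ops H K"
  using assms unfolding bounded_ops_def LinearCombinations.module_hom_def by blast

locale hilbert_pair = H: hilbert_space H + K: hilbert_space K for H K :: "'a hspace"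
begin

lemma bops_zero: "T \<in> bounded_ops H K \<Longrightarrow> T \<zero>\<^bsub>H\<^esub> = \<zero>\<^bsub>K\<^esub>"
  using bops_smult[of T H K "\<zero>\<^bsub>H\<^esub>" 0] bops_mem[of T H K "\<zero>\<^bsub>H\<^esub>"] by (metis H.M.zero_closed H.smult_simps(1) K.smult_simps(1))

lemma bops_diff: "T \<in> bounded_ops H K \<Longrightarrow> x \<in> carrier H \<Longrightarrow> y \<in> carrier H \<Longrightarrow>
    T (x \<ominus>\<^bsub>H\<^esub> y) = T x \<ominus>\<^bsub>K\<^esub> T y"
  by (simp add: H.minus_as_add K.minus_as_add bops_add bops_smult bops_mem)

lemma bops_bound:
  assumes "T \<in> bounded_ops H K"
  shows "\<exists>C>0. \<forall>x\<in>carrier H. hnorm K (T x) \<le> C * hnorm H x"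
proof -
  obtain C where C: "\<And>x. x \<in> carrier H \<Longrightarrow> hnorm K (T x) \<le> C * hnorm H x"
    using assms by (auto simp: bounded_ops_def)
  have "hnorm K (T x) \<le> (\<bar>C\<bar> + 1) * hnorm H x" if "x \<in> carrier H" for x
  proof -
    have "C * hnorm H x \<le> (\<bar>C\<bar> + 1) * hnorm H x"
      using that by (intro mult_right_mono) auto
    then show ?thesis using C[OF that] by linarith
  qed
  then show ?thesis by (intro exI[of _ "\<bar>C\<bar> + 1"]) auto
qed

lemma bops_minus:
  assumes "S \<in> bounded_ops H K" "T \<in> bounded_ops H K"
  shows "(\<lambda>x. S x \<ominus>\<^bsub>K\<^esub> T x) \<in> bounded_ops H K"
proof -
  obtain C where C: "\<And>x. x \<in> carrier H \<Longrightarrow> hnorm K (S x) \<le> C * hnorm H x"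
    using bops_bound[OF assms(1)] by blast
  obtain D where D: "\<And>x. x \<in> carrier H \<Longrightarrow> hnorm K (T x) \<le> D * hnorm H x"
    using bops_bound[OF assms(2)] by blast
  note m = bops_mem[OF assms(1)] bops_mem[OF assms(2)]
  show ?thesis
  proof (rule bopsI[where C = "C + D"])
    fix x y assume xy: "x \<in> carrier H" "y \<in> carrier H"
    show "S (x \<oplus>\<^bsub>H\<^esub> y) \<ominus>\<^bsub>K\<^esub> T (x \<oplus>\<^bsub>H\<^esub> y) = S x \<ominus>\<^bsub>K\<^esub> T x \<oplus>\<^bsub>K\<^esub> (S y \<ominus>\<^bsub>K\<^esub> T y)"
      by (rule K.ip_ext) (use m xy in \<open>simp_all add: bops_add[OF assms(1)] bops_add[OF assms(2)] K.ip_simps\<close>)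
  next
    fix c x assume x: "x \<in> carrier H"
    show "S (c \<odot>\<^bsub>H\<^esub> x) \<ominus>\<^bsub>K\<^esub> T (c \<odot>\<^bsub>H\<^esub> x) = c \<odot>\<^bsub>K\<^esub> (S x \<ominus>\<^bsub>K\<^esub> T x)"
      by (rule K.ip_ext) (use m x in \<open>simp_all add: bops_smult[OF assms(1)] bops_smult[OF assms(2)]
        K.ip_simps algebra_simps\<close>)
  next
    fix x assume x: "x \<in> carrier H"
    show "hnorm K (S x \<ominus>\<^bsub>K\<^esub> T x) \<le> (C + D) * hnorm H x"
      using K.hnorm_diff_triangle[OF m(1)[OF x] m(2)[OF x]] C[OF x] D[OF x]
      by (simp add: distrib_right)
  qed (use m in simp)
qed

lemma zero_bops: "(\<lambda>x. \<zero>\<^bsub>K\<^esub>) \<in> bounded_ops H K"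
  by (rule bopsI[where C = 0]) simp_all

lemma op_norm_le_iff:
  assumes T: "T \<in> bounded_ops H K" and d: "0 \<le> d"
  shows "op_norm H K T \<le> d \<longleftrightarrow> (\<forall>x\<in>carrier H. hnorm K (T x) \<le> d * hnorm H x)"
proof -
  let ?A = "{hnorm K (T x) | x. x \<in> carrier H \<and> hnorm H x \<le> 1}"
  obtain C where C: "C > 0" "\<And>x. x \<in> carrier H \<Longrightarrow> hnorm K (T x) \<le> C * hnorm H x"
    using bops_bound[OF T] by blast
  have ne: "?A \<noteq> {}" by (auto intro!: exI[of _ "\<zero>\<^bsub>H\<^esub>"])
  have bdd: "bdd_above ?A"
  proof (rule bdd_aboveI[of _ C])
    fix r assume "r \<in> ?A"
    then obtain x where x: "x \<in> carrier H" "hnorm H x \<le> 1" "r = hnorm K (T x)" by blast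
    then show "r \<le> C" using C(2)[OF x(1)] mult_left_mono[OF x(2), of C] C(1) by linarith
  qed
  show ?thesis
  proof
    assume le: "op_norm H K T \<le> d"
    show "\<forall>x\<in>carrier H. hnorm K (T x) \<le> d * hnorm H x"
    proof
      fix x assume x: "x \<in> carrier H"
      show "hnorm K (T x) \<le> d * hnorm H x"
      proof (cases "x = \<zero>\<^bsub>H\<^esub>")
        case True
        then show ?thesis using bops_zero[OF T] by simp
      next
        case False
        then have p: "0 < hnorm H x" using H.hnorm_pos x by blast
        let ?u = "complex_of_real (1 / hnorm H x) \<odot>\<^bsub>H\<^esub> x"
        have u: "?u \<in> carrier H" "hnorm H ?u = 1" using x p
          by (simp_all add: H.hnorm_smult norm_divide)
        then have "hnorm K (T ?u) \<le> Sup ?A" by (intro cSup_upper[OF _ bdd]) force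
        then have "hnorm K (T ?u) \<le> d" using le by (simp add: op_norm_def)
        moreover have "hnorm K (T ?u) = hnorm K (T x) / hnorm H x"
          unfolding bops_smult[OF T x] using p x bops_mem[OF T x] by (simp add: K.hnorm_smult norm_divide)
        ultimately have "hnorm K (T x) / hnorm H x \<le> d" by linarith
        then show ?thesis using p by (simp add: field_simps)
      qed
    qed
  next
    assume le: "\<forall>x\<in>carrier H. hnorm K (T x) \<le> d * hnorm H x"
    have "r \<le> d" if r: "r \<in> ?A" for r
    proof -
      obtain x where x: "x \<in> carrier H" "hnorm H x \<le> 1" "r = hnorm K (T x)" using r by blast
      then show "r \<le> d" using le mult_left_mono[OF x(2) d] by fastforce
    qed
    then show "op_norm H K T \<le> d" unfolding op_norm_def by (intro cSup_least[OF ne]) auto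
  qed
qed

lemma adj_exists:
  assumes T: "T \<in> bounded_ops H K" and y: "y \<in> carrier K"
  shows "\<exists>!z. z \<in> carrier H \<and> (\<forall>x\<in>carrier H. ip K (T x) y = ip H x z)"
proof -
  obtain C where C: "C > 0" "\<And>x. x \<in> carrier H \<Longrightarrow> hnorm K (T x) \<le> C * hnorm H x"
    using bops_bound[OF T] by blast
  have "\<exists>z\<in>carrier H. \<forall>x\<in>carrier H. ip K y (T x) = ip H z x"
  proof (rule H.riesz_representation)
    fix x assume x: "x \<in> carrier H"
    have "cmod (ip K y (T x)) \<le> hnorm K y * hnorm K (T x)"
      by (rule K.cauchy_schwarz[OF y bops_mem[OF T x]])
    also have "\<dots> \<le> hnorm K y * (C * hnorm H x)"
      using C(2)[OF x] y by (intro mult_left_mono) auto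
    finally show "cmod (ip K y (T x)) \<le> (hnorm K y * C) * hnorm H x" by (simp add: mult.assoc)
  qed (use y in \<open>simp_all add: bops_add[OF T] bops_smult[OF T] bops_mem[OF T] K.ip_simps\<close>)
  then obtain z where z: "z \<in> carrier H" "\<And>x. x \<in> carrier H \<Longrightarrow> ip K y (T x) = ip H z x" by blast
  show ?thesis
  proof (rule ex1I[of _ z], intro conjI ballI)
    fix x assume x: "x \<in> carrier H"
    show "ip K (T x) y = ip H x z"
      using z(2)[OF x] H.ip_cnj[OF z(1) x] K.ip_cnj[OF y bops_mem[OF T x]] by simp
  next
    fix w assume w: "w \<in> carrier H \<and> (\<forall>x\<in>carrier H. ip K (T x) y = ip H x w)"
    show "w = z"
    proof (rule H.ip_ext)
      fix x assume x: "x \<in> carrier H"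
      have "ip H x w = ip K (T x) y" using w x by simp
      also have "\<dots> = ip H x z"
        using z(2)[OF x] H.ip_cnj[OF z(1) x] K.ip_cnj[OF y bops_mem[OF T x]] by simp
      finally show "ip H x w = ip H x z" .
    qed (use w z in auto)
  qed (rule z(1))
qed

lemma adj_mem: "T \<in> bounded_ops H K \<Longrightarrow> y \<in> carrier K \<Longrightarrow> adj H K T y \<in> carrier H"
  using theI'[OF adj_exists, of T y] unfolding adj_def by blast

lemma adj_ip: "T \<in> bounded_ops H K \<Longrightarrow> x \<in> carrier H \<Longrightarrow> y \<in> carrier K \<Longrightarrow>
    ip H x (adj H K T y) = ip K (T x) y"
  using theI'[OF adj_exists, of T y] unfolding adj_def by force

lemma adj_ip': "T \<in> bounded_ops H K \<Longrightarrow> x \<in> carrier H \<Longrightarrow> y \<in> carrier K \<Longrightarrow>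
    ip H (adj H K T y) x = ip K y (T x)"
  using adj_ip[of T x y] H.ip_cnj[of x "adj H K T y"] K.ip_cnj[of "T x" y] adj_mem[of T y]
    bops_mem[of T H K x] by simp

lemma adj_eqI:
  assumes "T \<in> bounded_ops H K" "y \<in> carrier K" "z \<in> carrier H"
    "\<And>x. x \<in> carrier H \<Longrightarrow> ip K (T x) y = ip H x z"
  shows "adj H K T y = z"
  by (rule H.ip_ext) (use assms adj_mem adj_ip in auto)

lemma adj_bops:
  assumes T: "T \<in> bounded_ops H K"
  shows "adj H K T \<in> bounded_ops K H"
proof -
  obtain C where C: "C > 0" "\<And>x. x \<in> carrier H \<Longrightarrow> hnorm K (T x) \<le> C * hnorm H x"
    using bops_bound[OF T] by blast
  note m = adj_mem[OF T] bops_mem[OF T]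
  show ?thesis
  proof (rule bopsI[where C = C])
    fix x y assume xy: "x \<in> carrier K" "y \<in> carrier K"
    show "adj H K T (x \<oplus>\<^bsub>K\<^esub> y) = adj H K T x \<oplus>\<^bsub>H\<^esub> adj H K T y"
      by (rule adj_eqI[OF T]) (use xy m in \<open>simp_all add: K.ip_simps H.ip_simps adj_ip[OF T]\<close>)
  next
    fix c x assume x: "x \<in> carrier K"
    show "adj H K T (c \<odot>\<^bsub>K\<^esub> x) = c \<odot>\<^bsub>H\<^esub> adj H K T x"
      by (rule adj_eqI[OF T]) (use x m in \<open>simp_all add: K.ip_simps H.ip_simps adj_ip[OF T]\<close>)
  next
    fix y assume y: "y \<in> carrier K"
    let ?z = "adj H K T y"
    have z: "?z \<in> carrier H" using m y by simp
    have "(hnorm H ?z)\<^sup>2 = cmod (ip H ?z ?z)" unfolding H.ip_self[OF z] norm_of_real by simp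
    also have "\<dots> = cmod (ip K (T ?z) y)" using adj_ip[OF T z y] by simp
    also have "\<dots> \<le> hnorm K (T ?z) * hnorm K y" using K.cauchy_schwarz m z y by simp
    also have "\<dots> \<le> (C * hnorm H ?z) * hnorm K y" using C(2)[OF z] y by (intro mult_right_mono) auto
    finally have "hnorm H ?z * hnorm H ?z \<le> (C * hnorm K y) * hnorm H ?z"
      by (simp add: power2_eq_square mult_ac)
    then show "hnorm H ?z \<le> C * hnorm K y"
      using H.hnorm_nonneg[OF z] C(1) y by (cases "hnorm H ?z = 0") (auto dest: mult_right_le_imp_le)
  qed (use m in simp)
qed

end

lemma bops_comp:
  assumes "hilbert_space H" "hilbert_space K" "hilbert_space L"
    and S: "S \<in> bounded_ops H K" and T: "T \<in> bounded_ops K L"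
  shows "(\<lambda>x. T (S x)) \<in> bounded_ops H L"
proof -
  interpret HK: hilbert_pair H K using assms by (simp add: hilbert_pair_def)
  interpret KL: hilbert_pair K L using assms by (simp add: hilbert_pair_def)
  obtain C where C: "C > 0" "\<And>x. x \<in> carrier H \<Longrightarrow> hnorm K (S x) \<le> C * hnorm H x"
    using HK.bops_bound[OF S] by blast
  obtain D where D: "D > 0" "\<And>x. x \<in> carrier K \<Longrightarrow> hnorm L (T x) \<le> D * hnorm K x"
    using KL.bops_bound[OF T] by blast
  show ?thesis
  proof (rule bopsI[where C = "D * C"])
    fix x assume x: "x \<in> carrier H"
    have "hnorm L (T (S x)) \<le> D * hnorm K (S x)" by (rule D(2)[OF bops_mem[OF S x]])
    also have "\<dots> \<le> D * (C * hnorm H x)" using C(2)[OF x] D(1) by simp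
    finally show "hnorm L (T (S x)) \<le> D * C * hnorm H x" by (simp add: mult.assoc)
  qed (simp_all add: bops_mem[OF S] bops_mem[OF T] bops_add[OF S] bops_add[OF T] bops_smult[OF S] bops_smult[OF T])
qed

lemma id_bops: "(\<lambda>x. x) \<in> bounded_ops H H"
  by (rule bopsI[where C = 1]) simp_all

lemma (in hilbert_pair) unitary_props:
  assumes U: "unitary H K U"
  shows "U \<in> bounded_ops H K" "adj H K U \<in> bounded_ops K H"
    "x \<in> carrier H \<Longrightarrow> adj H K U (U x) = x" "y \<in> carrier K \<Longrightarrow> U (adj H K U y) = y"
    "x \<in> carrier H \<Longrightarrow> x' \<in> carrier H \<Longrightarrow> ip K (U x) (U x') = ip H x x'"
    "y \<in> carrier K \<Longrightarrow> y' \<in> carrier K \<Longrightarrow> ip H (adj H K U y) (adj H K U y') = ip K y y'"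
    "x \<in> carrier H \<Longrightarrow> hnorm K (U x) = hnorm H x"
    "y \<in> carrier K \<Longrightarrow> hnorm H (adj H K U y) = hnorm K y"
proof -
  show 1: "U \<in> bounded_ops H K" using U by (simp add: unitary_def)
  then show 2: "adj H K U \<in> bounded_ops K H" by (rule adj_bops)
  show 3: "adj H K U (U x) = x" if "x \<in> carrier H" for x using U that by (simp add: unitary_def)
  show 4: "U (adj H K U y) = y" if "y \<in> carrier K" for y using U that by (simp add: unitary_def)
  show 5: "ip K (U x) (U x') = ip H x x'" if "x \<in> carrier H" "x' \<in> carrier H" for x x'
    using adj_ip[OF 1 that(1) bops_mem[OF 1 that(2)]] 3[OF that(2)] by simp
  show 6: "ip H (adj H K U y) (adj H K U y') = ip K y y'" if "y \<in> carrier K" "y' \<in> carrier K" for y y'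
    using adj_ip[OF 1 adj_mem[OF 1 that(1)] that(2)] 4[OF that(1)] by simp
  show "hnorm K (U x) = hnorm H x" if "x \<in> carrier H" for x using 5[OF that that] by (simp add: hnorm_def)
  show "hnorm H (adj H K U y) = hnorm K y" if "y \<in> carrier K" for y using 6[OF that that] by (simp add: hnorm_def)
qed

section \<open>Quasi-unitary equivalence without operator norms\<close>

text \<open>The condition \<open>\<parallel>J' - J\<^sup>*\<parallel> \<le> \<delta>\<close> is expressed by the form \<open>\<langle>x, J'y\<rangle> - \<langle>Jx, y\<rangle>\<close>; in this
  version it is visibly symmetric in the two operators, and adjoints disappear.\<close>

definition quasi_unitary :: "real \<Rightarrow> 'a hspace \<Rightarrow> ('a \<Rightarrow> 'a) \<Rightarrow> 'a hspace \<Rightarrow> ('a \<Rightarrow> 'a) \<Rightarrow> ('a \<Rightarrow> 'a) \<Rightarrow> ('a \<Rightarrow> 'a) \<Rightarrow> bool" where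
  "quasi_unitary \<delta> H R K S J J' \<longleftrightarrow> J \<in> bounded_ops H K \<and> J' \<in> bounded_ops K H \<and>
     (\<forall>x\<in>carrier H. hnorm K (J x) \<le> (1 + \<delta>) * hnorm H x) \<and>
     (\<forall>y\<in>carrier K. hnorm H (J' y) \<le> (1 + \<delta>) * hnorm K y) \<and>
     (\<forall>x\<in>carrier H. \<forall>y\<in>carrier K. cmod (ip H x (J' y) - ip K (J x) y) \<le> \<delta> * (hnorm H x * hnorm K y)) \<and>
     (\<forall>x\<in>carrier H. hnorm H (R x \<ominus>\<^bsub>H\<^esub> J' (J (R x))) \<le> \<delta> * hnorm H x) \<and>
     (\<forall>y\<in>carrier K. hnorm K (S y \<ominus>\<^bsub>K\<^esub> J (J' (S y))) \<le> \<delta> * hnorm K y) \<and>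
     (\<forall>x\<in>carrier H. hnorm K (J (R x) \<ominus>\<^bsub>K\<^esub> S (J x)) \<le> \<delta> * hnorm H x) \<and>
     (\<forall>y\<in>carrier K. hnorm H (J' (S y) \<ominus>\<^bsub>H\<^esub> R (J' y)) \<le> \<delta> * hnorm K y)"

lemma quasi_unitaryD:
  assumes "quasi_unitary \<delta> H R K S J J'"
  shows "J \<in> bounded_ops H K" "J' \<in> bounded_ops K H"
    "x \<in> carrier H \<Longrightarrow> hnorm K (J x) \<le> (1 + \<delta>) * hnorm H x"
    "y \<in> carrier K \<Longrightarrow> hnorm H (J' y) \<le> (1 + \<delta>) * hnorm K y"
    "x \<in> carrier H \<Longrightarrow> y \<in> carrier K \<Longrightarrow>
      cmod (ip H x (J' y) - ip K (J x) y) \<le> \<delta> * (hnorm H x * hnorm K y)"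
    "x \<in> carrier H \<Longrightarrow> hnorm H (R x \<ominus>\<^bsub>H\<^esub> J' (J (R x))) \<le> \<delta> * hnorm H x"
    "y \<in> carrier K \<Longrightarrow> hnorm K (S y \<ominus>\<^bsub>K\<^esub> J (J' (S y))) \<le> \<delta> * hnorm K y"
    "x \<in> carrier H \<Longrightarrow> hnorm K (J (R x) \<ominus>\<^bsub>K\<^esub> S (J x)) \<le> \<delta> * hnorm H x"
    "y \<in> carrier K \<Longrightarrow> hnorm H (J' (S y) \<ominus>\<^bsub>H\<^esub> R (J' y)) \<le> \<delta> * hnorm K y"
  using assms unfolding quasi_unitary_def by blast+

lemma (in hilbert_space) norm_le_of_sq:
  assumes "x \<in> carrier H" "0 \<le> C" "(hnorm H x)\<^sup>2 \<le> C * hnorm H x"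
  shows "hnorm H x \<le> C"
proof (cases "hnorm H x = 0")
  case False
  then have "0 < hnorm H x" using hnorm_nonneg[OF assms(1)] by linarith
  then show ?thesis using assms(3) by (simp add: power2_eq_square)
qed (use assms in simp)

lemma (in hilbert_pair) quasi_unitarily_equivalent_iff:
  assumes R: "R \<in> bounded_ops H H" and S: "S \<in> bounded_ops K K" and d: "0 \<le> \<delta>"
  shows "quasi_unitarily_equivalent \<delta> (H, R) (K, S) \<longleftrightarrow> (\<exists>J J'. quasi_unitary \<delta> H R K S J J')"
proof -
  interpret KH: hilbert_pair K H by unfold_locales
  interpret HH: hilbert_pair H H by unfold_locales
  interpret KK: hilbert_pair K K by unfold_locales
  note c1 = bops_comp[OF H.hilbert_space_axioms K.hilbert_space_axioms H.hilbert_space_axioms]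
  note c2 = bops_comp[OF K.hilbert_space_axioms H.hilbert_space_axioms K.hilbert_space_axioms]
  note c3 = bops_comp[OF H.hilbert_space_axioms H.hilbert_space_axioms K.hilbert_space_axioms]
  note c4 = bops_comp[OF H.hilbert_space_axioms K.hilbert_space_axioms K.hilbert_space_axioms]
  note c5 = bops_comp[OF K.hilbert_space_axioms K.hilbert_space_axioms H.hilbert_space_axioms]
  note c6 = bops_comp[OF K.hilbert_space_axioms H.hilbert_space_axioms H.hilbert_space_axioms]
  have third: "op_norm K H (\<lambda>y. J' y \<ominus>\<^bsub>H\<^esub> adj H K J y) \<le> \<delta> \<longleftrightarrow>
     (\<forall>x\<in>carrier H. \<forall>y\<in>carrier K. cmod (ip H x (J' y) - ip K (J x) y) \<le> \<delta> * (hnorm H x * hnorm K y))"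
    (is "?l \<longleftrightarrow> ?r")
    if J: "J \<in> bounded_ops H K" and J': "J' \<in> bounded_ops K H" for J J'
  proof -
    note m = bops_mem[OF J'] adj_mem[OF J]
    have e: "ip H x (J' y) - ip K (J x) y = ip H x (J' y \<ominus>\<^bsub>H\<^esub> adj H K J y)"
      if "x \<in> carrier H" "y \<in> carrier K" for x y
      using that m by (simp add: H.ip_simps adj_ip[OF J])
    have l: "?l \<longleftrightarrow> (\<forall>y\<in>carrier K. hnorm H (J' y \<ominus>\<^bsub>H\<^esub> adj H K J y) \<le> \<delta> * hnorm K y)"
      by (rule KH.op_norm_le_iff[OF KH.bops_minus[OF J' adj_bops[OF J]] d])
    show ?thesis
    proof
      assume "?l"
      then have A: "hnorm H (J' y \<ominus>\<^bsub>H\<^esub> adj H K J y) \<le> \<delta> * hnorm K y" if "y \<in> carrier K" for y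
        using l that by blast
      show "?r"
      proof (intro ballI)
        fix x y assume xy: "x \<in> carrier H" "y \<in> carrier K"
        have "cmod (ip H x (J' y) - ip K (J x) y) \<le> hnorm H x * hnorm H (J' y \<ominus>\<^bsub>H\<^esub> adj H K J y)"
          unfolding e[OF xy] by (rule H.cauchy_schwarz) (use xy m in auto)
        also have "\<dots> \<le> hnorm H x * (\<delta> * hnorm K y)"
          using A[OF xy(2)] xy by (intro mult_left_mono) auto
        finally show "cmod (ip H x (J' y) - ip K (J x) y) \<le> \<delta> * (hnorm H x * hnorm K y)"
          by (simp add: mult_ac)
      qed
    next
      assume r: "?r"
      show "?l" unfolding l
      proof
        fix y assume y: "y \<in> carrier K"
        let ?z = "J' y \<ominus>\<^bsub>H\<^esub> adj H K J y"
        have z: "?z \<in> carrier H" using m y by simp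
        have "(hnorm H ?z)\<^sup>2 = cmod (ip H ?z (J' y) - ip K (J ?z) y)"
          unfolding e[OF z y] H.ip_self[OF z] norm_of_real by simp
        also have "\<dots> \<le> \<delta> * (hnorm H ?z * hnorm K y)" using r z y by blast
        finally show "hnorm H ?z \<le> \<delta> * hnorm K y"
          using d y by (intro H.norm_le_of_sq z) (auto simp: mult_ac)
      qed
    qed
  qed
  have *: "(op_norm H K J \<le> 1 + \<delta> \<and> op_norm K H J' \<le> 1 + \<delta> \<and>
       op_norm K H (\<lambda>y. J' y \<ominus>\<^bsub>H\<^esub> adj H K J y) \<le> \<delta> \<and>
       op_norm H H (\<lambda>x. R x \<ominus>\<^bsub>H\<^esub> J' (J (R x))) \<le> \<delta> \<and>
       op_norm K K (\<lambda>y. S y \<ominus>\<^bsub>K\<^esub> J (J' (S y))) \<le> \<delta> \<and>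
       op_norm H K (\<lambda>x. J (R x) \<ominus>\<^bsub>K\<^esub> S (J x)) \<le> \<delta> \<and>
       op_norm K H (\<lambda>y. J' (S y) \<ominus>\<^bsub>H\<^esub> R (J' y)) \<le> \<delta>) \<longleftrightarrow> quasi_unitary \<delta> H R K S J J'"
    if J: "J \<in> bounded_ops H K" and J': "J' \<in> bounded_ops K H" for J J'
    unfolding quasi_unitary_def third[OF J J']
      op_norm_le_iff[OF J add_nonneg_nonneg[OF zero_le_one d]]
      KH.op_norm_le_iff[OF J' add_nonneg_nonneg[OF zero_le_one d]]
      HH.op_norm_le_iff[OF HH.bops_minus[OF R c1[OF c3[OF R J] J']] d]
      KK.op_norm_le_iff[OF KK.bops_minus[OF S c2[OF c5[OF S J'] J]] d]
      op_norm_le_iff[OF bops_minus[OF c3[OF R J] c4[OF J S]] d]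
      KH.op_norm_le_iff[OF KH.bops_minus[OF c5[OF S J'] c6[OF J' R]] d]
    using J J' by simp
  have "quasi_unitarily_equivalent \<delta> (H, R) (K, S) \<longleftrightarrow>
      (\<exists>J\<in>bounded_ops H K. \<exists>J'\<in>bounded_ops K H. quasi_unitary \<delta> H R K S J J')"
    unfolding quasi_unitarily_equivalent_def prod.case by (intro bex_cong[OF refl] *)
  then show ?thesis by (auto simp: quasi_unitary_def)
qed

context hilbert_pair
begin

lemma quasi_unitary_sym:
  assumes "quasi_unitary \<delta> H R K S J J'"
  shows "quasi_unitary \<delta> K S H R J' J"
proof -
  have "cmod (ip K y (J x) - ip H (J' y) x) \<le> \<delta> * (hnorm K y * hnorm H x)"
    if "x \<in> carrier H" "y \<in> carrier K" for x y
  proof -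
    have J: "J x \<in> carrier K" "J' y \<in> carrier H" using assms that bops_mem by (auto simp: quasi_unitary_def)
    have "ip K y (J x) - ip H (J' y) x = - cnj (ip H x (J' y) - ip K (J x) y)"
      using H.ip_cnj[OF that(1) J(2)] K.ip_cnj[OF J(1) that(2)] by simp
    then have "cmod (ip K y (J x) - ip H (J' y) x) = cmod (ip H x (J' y) - ip K (J x) y)"
      by (simp del: complex_cnj_diff)
    also have "\<dots> \<le> \<delta> * (hnorm H x * hnorm K y)" using assms that by (simp add: quasi_unitary_def)
    finally show ?thesis by (simp add: mult_ac)
  qed
  then show ?thesis using assms by (simp add: quasi_unitary_def)
qed

lemma quasi_unitary_mono:
  assumes q: "quasi_unitary \<delta> H R K S J J'" and le: "\<delta> \<le> \<epsilon>"
  shows "quasi_unitary \<epsilon> H R K S J J'"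
proof -
  have a: "\<delta> * hnorm H x \<le> \<epsilon> * hnorm H x" "(1 + \<delta>) * hnorm H x \<le> (1 + \<epsilon>) * hnorm H x" if "x \<in> carrier H" for x
    using le that by (auto intro: mult_right_mono)
  have b: "\<delta> * hnorm K x \<le> \<epsilon> * hnorm K x" "(1 + \<delta>) * hnorm K x \<le> (1 + \<epsilon>) * hnorm K x" if "x \<in> carrier K" for x
    using le that by (auto intro: mult_right_mono)
  have c: "\<delta> * (hnorm H x * hnorm K y) \<le> \<epsilon> * (hnorm H x * hnorm K y)"
    if "x \<in> carrier H" "y \<in> carrier K" for x y
    using le that by (auto intro!: mult_right_mono)
  show ?thesis
    using q unfolding quasi_unitary_def
    by (intro conjI ballI; elim conjE) (blast intro: order_trans[OF _ a(1)] order_trans[OF _ a(2)]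
      order_trans[OF _ b(1)] order_trans[OF _ b(2)] order_trans[OF _ c])+
qed

lemma quasi_unitary_one:
  assumes "R \<in> bounded_ops H H" "S \<in> bounded_ops K K"
    and "\<And>x. x \<in> carrier H \<Longrightarrow> hnorm H (R x) \<le> hnorm H x"
    and "\<And>y. y \<in> carrier K \<Longrightarrow> hnorm K (S y) \<le> hnorm K y"
  shows "quasi_unitary 1 H R K S (\<lambda>x. \<zero>\<^bsub>K\<^esub>) (\<lambda>y. \<zero>\<^bsub>H\<^esub>)"
proof -
  interpret KH: hilbert_pair K H by unfold_locales
  interpret HH: hilbert_pair H H by unfold_locales
  interpret KK: hilbert_pair K K by unfold_locales
  show ?thesis
    using assms(3,4) bops_mem[OF assms(1)] bops_mem[OF assms(2)] zero_bops KH.zero_bops HH.bops_zero[OF assms(1)] KK.bops_zero[OF assms(2)]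
    by (simp add: quasi_unitary_def)
qed

end

lemma (in hilbert_space) quasi_unitary_refl:
  assumes "R \<in> bounded_ops H H"
  shows "quasi_unitary 0 H R H R (\<lambda>x. x) (\<lambda>x. x)"
  using id_bops[of H] bops_mem[OF assms] by (simp add: quasi_unitary_def)

section \<open>The relaxed triangle inequality\<close>

text \<open>For \<open>\<parallel>J\<parallel>\<^sup>2 \<le> 2\<close> the operator \<open>1 - J\<^sup>*J\<close> is a contraction, so that \<open>1 - J'J\<close> is
  bounded by \<open>1 + \<delta>(1 + \<delta>)\<close> rather than by \<open>1 + (1 + \<delta>)\<^sup>2\<close>.\<close>

lemma (in hilbert_pair) id_minus_JJ_bound:
  assumes J: "J \<in> bounded_ops H K" and J': "J' \<in> bounded_ops K H"
    and b: "0 \<le> b" "(1 + b)\<^sup>2 \<le> 2"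
    and n: "\<And>x. x \<in> carrier H \<Longrightarrow> hnorm K (J x) \<le> (1 + b) * hnorm H x"
    and s: "\<And>x y. x \<in> carrier H \<Longrightarrow> y \<in> carrier K \<Longrightarrow>
      cmod (ip H x (J' y) - ip K (J x) y) \<le> b * (hnorm H x * hnorm K y)"
    and e: "e \<in> carrier H"
  shows "hnorm H (e \<ominus>\<^bsub>H\<^esub> J' (J e)) \<le> (1 + b + b\<^sup>2) * hnorm H e"
proof -
  let ?g = "adj H K J (J e)"
  have Je: "J e \<in> carrier K" using bops_mem[OF J e] .
  have g: "?g \<in> carrier H" using adj_mem[OF J Je] .
  have j: "J' (J e) \<in> carrier H" using bops_mem[OF J' Je] .
  have g2: "(hnorm H ?g)\<^sup>2 = cmod (ip K (J ?g) (J e))"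
    unfolding adj_ip[OF J g Je, symmetric] H.ip_self[OF g] norm_of_real by simp
  also have "\<dots> \<le> hnorm K (J ?g) * hnorm K (J e)" by (rule K.cauchy_schwarz[OF bops_mem[OF J g] Je])
  also have "\<dots> \<le> ((1 + b) * hnorm H ?g) * hnorm K (J e)" using n[OF g] Je by (intro mult_right_mono) auto
  finally have "hnorm H ?g \<le> (1 + b) * hnorm K (J e)"
    using b Je by (intro H.norm_le_of_sq[OF g]) (auto simp: mult_ac)
  then have "(hnorm H ?g)\<^sup>2 \<le> ((1 + b) * hnorm K (J e))\<^sup>2" by (rule power_mono[OF _ H.hnorm_nonneg[OF g]])
  also have "\<dots> \<le> 2 * (hnorm K (J e))\<^sup>2"
    unfolding power_mult_distrib using b by (intro mult_right_mono) auto
  finally have "(hnorm H (e \<ominus>\<^bsub>H\<^esub> ?g))\<^sup>2 \<le> (hnorm H e)\<^sup>2"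
    using H.hnorm_sq_diff[OF e g] adj_ip[OF J e Je] K.ip_self[OF Je] by simp
  then have A: "hnorm H (e \<ominus>\<^bsub>H\<^esub> ?g) \<le> hnorm H e"
    by (rule power2_le_imp_le[OF _ H.hnorm_nonneg[OF e]])
  let ?p = "?g \<ominus>\<^bsub>H\<^esub> J' (J e)"
  have p: "?p \<in> carrier H" using g j by simp
  have "ip H ?p ?p = - (ip H ?p (J' (J e)) - ip K (J ?p) (J e))"
    using p g j adj_ip[OF J p Je] H.ip_diff_right[OF p g j] by simp
  then have "cmod (ip H ?p ?p) = cmod (ip H ?p (J' (J e)) - ip K (J ?p) (J e))"
    by (simp add: norm_minus_commute)
  then have "(hnorm H ?p)\<^sup>2 = cmod (ip H ?p (J' (J e)) - ip K (J ?p) (J e))"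
    unfolding H.ip_self[OF p] norm_of_real by simp
  also have "\<dots> \<le> b * (hnorm H ?p * hnorm K (J e))" by (rule s[OF p Je])
  finally have "hnorm H ?p \<le> b * hnorm K (J e)"
    using b Je by (intro H.norm_le_of_sq[OF p]) (auto simp: mult_ac)
  also have "\<dots> \<le> b * ((1 + b) * hnorm H e)" using n[OF e] b by (intro mult_left_mono) auto
  finally have "hnorm H (e \<ominus>\<^bsub>H\<^esub> J' (J e)) \<le> hnorm H e + b * ((1 + b) * hnorm H e)"
    using A H.hnorm_triangle_via[OF e g j] by linarith
  then show ?thesis by (simp add: algebra_simps power2_eq_square)
qed

text \<open>Let \<open>D = 1 - L'L\<close>. The defect of the composition is the defect of \<open>(J, J')\<close> plus
  \<open>J'DJR\<^sub>1\<close>. Here \<open>JR\<^sub>1\<close> is \<open>R\<^sub>2J\<close> plus a commutator of norm at most \<open>a\<close>; by assumption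
  \<open>\<parallel>DR\<^sub>2\<parallel> \<le> b\<close>, and the preceding lemma bounds \<open>D\<close> on the range of the commutator.\<close>

lemma quasi_unitary_trans_defect:
  assumes hs: "hilbert_space H1" "hilbert_space H2" "hilbert_space H3"
    and ab: "0 \<le> a" "0 \<le> b" "(1 + b)\<^sup>2 \<le> 2"
    and R: "R1 \<in> bounded_ops H1 H1" "R2 \<in> bounded_ops H2 H2"
    and q1: "quasi_unitary a H1 R1 H2 R2 J J'" and q2: "quasi_unitary b H2 R2 H3 R3 L L'"
    and x: "x \<in> carrier H1"
  shows "hnorm H1 (R1 x \<ominus>\<^bsub>H1\<^esub> J' (L' (L (J (R1 x))))) \<le> \<Phi> a b * hnorm H1 x"
proof -
  interpret P12: hilbert_pair H1 H2 using hs by (simp add: hilbert_pair_def)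
  interpret P23: hilbert_pair H2 H3 using hs by (simp add: hilbert_pair_def)
  interpret P21: hilbert_pair H2 H1 by unfold_locales
  interpret P32: hilbert_pair H3 H2 by unfold_locales
  have J: "J \<in> bounded_ops H1 H2" "J' \<in> bounded_ops H2 H1" "L \<in> bounded_ops H2 H3" "L' \<in> bounded_ops H3 H2"
    using quasi_unitaryD(1,2)[OF q1] quasi_unitaryD(1,2)[OF q2] by simp_all
  define n where "n = hnorm H1 x"
  have n0: "0 \<le> n" using x by (simp add: n_def)
  define u where "u = J (R1 x)"
  define v where "v = R2 (J x)"
  define e where "e = u \<ominus>\<^bsub>H2\<^esub> v"
  have c: "R1 x \<in> carrier H1" "J x \<in> carrier H2" "u \<in> carrier H2" "v \<in> carrier H2" "e \<in> carrier H2"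
    using x bops_mem[OF R(1)] bops_mem[OF R(2)] bops_mem[OF J(1)] by (simp_all add: u_def v_def e_def)
  have LL: "L' (L z) \<in> carrier H2" if "z \<in> carrier H2" for z
    using that bops_mem[OF J(4)] bops_mem[OF J(3)] by simp
  let ?D = "\<lambda>z. z \<ominus>\<^bsub>H2\<^esub> L' (L z)"
  have D: "?D z \<in> carrier H2" if "z \<in> carrier H2" for z using that LL by simp
  have en: "hnorm H2 e \<le> a * n" using quasi_unitaryD(8)[OF q1 x] by (simp add: e_def u_def v_def n_def)
  have "hnorm H2 (?D e) \<le> (1 + b + b\<^sup>2) * hnorm H2 e"
    by (rule P23.id_minus_JJ_bound[OF J(3,4) ab(2,3)]) (use quasi_unitaryD[OF q2] c in blast)+
  also have "\<dots> \<le> (1 + b + b\<^sup>2) * (a * n)" using ab by (intro mult_left_mono[OF en]) simp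
  finally have De: "hnorm H2 (?D e) \<le> (1 + b + b\<^sup>2) * (a * n)" .
  have "hnorm H2 (?D v) \<le> b * hnorm H2 (J x)" using quasi_unitaryD(6)[OF q2 c(2)] by (simp add: v_def)
  also have "\<dots> \<le> b * ((1 + a) * n)" unfolding n_def by (rule mult_left_mono[OF quasi_unitaryD(3)[OF q1 x] ab(2)])
  finally have Dv: "hnorm H2 (?D v) \<le> b * ((1 + a) * n)" .
  have "?D u = ?D e \<oplus>\<^bsub>H2\<^esub> ?D v"
  proof -
    have "L' (L e) = L' (L u) \<ominus>\<^bsub>H2\<^esub> L' (L v)"
      using c bops_mem[OF J(3)] by (simp add: e_def P23.bops_diff[OF J(3)] P32.bops_diff[OF J(4)])
    then show ?thesis
      by (intro P12.K.ip_ext) (use c LL in \<open>simp_all add: P12.K.ip_simps e_def\<close>)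
  qed
  then have "hnorm H2 (?D u) \<le> hnorm H2 (?D e) + hnorm H2 (?D v)"
    using P12.K.hnorm_triangle[OF D D] c by simp
  also have "\<dots> \<le> (1 + b + b\<^sup>2) * (a * n) + b * ((1 + a) * n)" using De Dv by linarith
  finally have Du: "hnorm H2 (?D u) \<le> (1 + b + b\<^sup>2) * (a * n) + b * ((1 + a) * n)" .
  have "hnorm H1 (J' (?D u)) \<le> (1 + a) * hnorm H2 (?D u)" by (rule quasi_unitaryD(4)[OF q1 D[OF c(3)]])
  also have "\<dots> \<le> (1 + a) * ((1 + b + b\<^sup>2) * (a * n) + b * ((1 + a) * n))"
    using Du ab by (intro mult_left_mono) auto
  finally have JD: "hnorm H1 (J' u \<ominus>\<^bsub>H1\<^esub> J' (L' (L u))) \<le> (1 + a) * ((1 + b + b\<^sup>2) * (a * n) + b * ((1 + a) * n))"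
    using c LL by (simp add: P21.bops_diff[OF J(2)])
  have "hnorm H1 (R1 x \<ominus>\<^bsub>H1\<^esub> J' u) \<le> a * n" using quasi_unitaryD(6)[OF q1 x] by (simp add: u_def n_def)
  then have "hnorm H1 (R1 x \<ominus>\<^bsub>H1\<^esub> J' (L' (L u)))
      \<le> a * n + (1 + a) * ((1 + b + b\<^sup>2) * (a * n) + b * ((1 + a) * n))"
    using JD P12.H.hnorm_triangle_via[OF c(1) bops_mem[OF J(2) c(3)] bops_mem[OF J(2) LL[OF c(3)]]] by linarith
  also have "\<dots> = (a + (1 + a) * ((1 + b + b\<^sup>2) * a + b * (1 + a))) * n" by (simp add: algebra_simps)
  also have "\<dots> \<le> \<Phi> a b * n"
  proof (rule mult_right_mono[OF _ n0])
    have "\<Phi> a b - (a + (1 + a) * ((1 + b + b\<^sup>2) * a + b * (1 + a)))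
        = a + 2 * b + b\<^sup>2 + a * b + a^3 + b^3 + a\<^sup>2 * b + 2 * a * b\<^sup>2"
      by (simp add: \<Phi>_def algebra_simps power2_eq_square power3_eq_cube)
    also have "\<dots> \<ge> 0" using ab by simp
    finally show "a + (1 + a) * ((1 + b + b\<^sup>2) * a + b * (1 + a)) \<le> \<Phi> a b" by simp
  qed
  finally show ?thesis by (simp add: u_def n_def)
qed

lemma Phi_commute: "\<Phi> a b = \<Phi> b a"
  by (simp add: \<Phi>_def algebra_simps)

lemma quasi_unitary_trans_commutator:
  assumes hs: "hilbert_space H1" "hilbert_space H2" "hilbert_space H3"
    and ab: "0 \<le> a" "0 \<le> b"
    and R: "R1 \<in> bounded_ops H1 H1" "R2 \<in> bounded_ops H2 H2" "R3 \<in> bounded_ops H3 H3"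
    and q1: "quasi_unitary a H1 R1 H2 R2 J J'" and q2: "quasi_unitary b H2 R2 H3 R3 L L'"
    and x: "x \<in> carrier H1"
  shows "hnorm H3 (L (J (R1 x)) \<ominus>\<^bsub>H3\<^esub> R3 (L (J x))) \<le> ((1 + b) * a + b * (1 + a)) * hnorm H1 x"
proof -
  interpret P12: hilbert_pair H1 H2 using hs by (simp add: hilbert_pair_def)
  interpret P23: hilbert_pair H2 H3 using hs by (simp add: hilbert_pair_def)
  have J: "J \<in> bounded_ops H1 H2" "L \<in> bounded_ops H2 H3"
    using quasi_unitaryD(1,2)[OF q1] quasi_unitaryD(1,2)[OF q2] by simp_all
  have c: "J (R1 x) \<in> carrier H2" "J x \<in> carrier H2" "R2 (J x) \<in> carrier H2"
    using x bops_mem[OF R(1)] bops_mem[OF R(2)] bops_mem[OF J(1)] by simp_all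
  have "hnorm H3 (L (J (R1 x) \<ominus>\<^bsub>H2\<^esub> R2 (J x))) \<le> (1 + b) * hnorm H2 (J (R1 x) \<ominus>\<^bsub>H2\<^esub> R2 (J x))"
    by (rule quasi_unitaryD(3)[OF q2]) (use c in simp)
  also have "\<dots> \<le> (1 + b) * (a * hnorm H1 x)"
    by (rule mult_left_mono[OF quasi_unitaryD(8)[OF q1 x]]) (use ab in simp)
  finally have 1: "hnorm H3 (L (J (R1 x)) \<ominus>\<^bsub>H3\<^esub> L (R2 (J x))) \<le> (1 + b) * (a * hnorm H1 x)"
    using c by (simp add: P23.bops_diff[OF J(2)])
  have "hnorm H3 (L (R2 (J x)) \<ominus>\<^bsub>H3\<^esub> R3 (L (J x))) \<le> b * hnorm H2 (J x)" by (rule quasi_unitaryD(8)[OF q2 c(2)])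
  also have "\<dots> \<le> b * ((1 + a) * hnorm H1 x)" by (rule mult_left_mono[OF quasi_unitaryD(3)[OF q1 x] ab(2)])
  finally have 2: "hnorm H3 (L (R2 (J x)) \<ominus>\<^bsub>H3\<^esub> R3 (L (J x))) \<le> b * ((1 + a) * hnorm H1 x)" .
  have "L (J (R1 x)) \<in> carrier H3" "L (R2 (J x)) \<in> carrier H3" "R3 (L (J x)) \<in> carrier H3"
    using c bops_mem[OF J(2)] bops_mem[OF R(3)] by simp_all
  then have "hnorm H3 (L (J (R1 x)) \<ominus>\<^bsub>H3\<^esub> R3 (L (J x)))
      \<le> (1 + b) * (a * hnorm H1 x) + b * ((1 + a) * hnorm H1 x)"
    using 1 2 P23.K.hnorm_triangle_via[of "L (J (R1 x))" "L (R2 (J x))" "R3 (L (J x))"] by linarith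
  then show ?thesis by (simp add: algebra_simps)
qed

lemma quasi_unitary_trans_bound:
  assumes hs: "hilbert_space H1" "hilbert_space H2" "hilbert_space H3"
    and ab: "0 \<le> a" "0 \<le> b"
    and q1: "quasi_unitary a H1 R1 H2 R2 J J'" and q2: "quasi_unitary b H2 R2 H3 R3 L L'"
    and x: "x \<in> carrier H1"
  shows "hnorm H3 (L (J x)) \<le> ((1 + a) * (1 + b)) * hnorm H1 x"
proof -
  have c: "J x \<in> carrier H2" by (rule bops_mem[OF quasi_unitaryD(1)[OF q1] x])
  have "hnorm H3 (L (J x)) \<le> (1 + b) * hnorm H2 (J x)" by (rule quasi_unitaryD(3)[OF q2 c])
  also have "\<dots> \<le> (1 + b) * ((1 + a) * hnorm H1 x)"
    by (rule mult_left_mono[OF quasi_unitaryD(3)[OF q1 x]]) (use ab in simp)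
  finally show ?thesis by (simp add: mult_ac)
qed

lemma quasi_unitary_trans:
  assumes hs: "hilbert_space H1" "hilbert_space H2" "hilbert_space H3"
    and ab: "0 \<le> a" "0 \<le> b" "(1 + a)\<^sup>2 \<le> 2" "(1 + b)\<^sup>2 \<le> 2"
    and R: "R1 \<in> bounded_ops H1 H1" "R2 \<in> bounded_ops H2 H2" "R3 \<in> bounded_ops H3 H3"
    and q1: "quasi_unitary a H1 R1 H2 R2 J J'" and q2: "quasi_unitary b H2 R2 H3 R3 L L'"
  shows "quasi_unitary (\<Phi> a b) H1 R1 H3 R3 (\<lambda>x. L (J x)) (\<lambda>y. J' (L' y))"
proof -
  interpret P12: hilbert_pair H1 H2 using hs by (simp add: hilbert_pair_def)
  interpret P23: hilbert_pair H2 H3 using hs by (simp add: hilbert_pair_def)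
  have J: "J \<in> bounded_ops H1 H2" "J' \<in> bounded_ops H2 H1" "L \<in> bounded_ops H2 H3" "L' \<in> bounded_ops H3 H2"
    using quasi_unitaryD(1,2)[OF q1] quasi_unitaryD(1,2)[OF q2] by simp_all
  note q1' = P12.quasi_unitary_sym[OF q1] and q2' = P23.quasi_unitary_sym[OF q2]
  have nn: "0 \<le> hnorm H1 x" if "x \<in> carrier H1" for x using that by simp
  have nn3: "0 \<le> hnorm H3 x" if "x \<in> carrier H3" for x using that by simp
  have p: "(1 + b) * a + b * (1 + a) \<le> \<Phi> a b" "(1 + a) * (1 + b) \<le> 1 + \<Phi> a b"
    using ab by (simp_all add: \<Phi>_def algebra_simps power2_eq_square power3_eq_cube)
  have p': "(1 + a) * b + a * (1 + b) \<le> \<Phi> a b" "(1 + b) * (1 + a) \<le> 1 + \<Phi> a b"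
    using p by (simp_all add: algebra_simps)
  have form: "cmod (ip H1 x (J' (L' y)) - ip H3 (L (J x)) y) \<le> \<Phi> a b * (hnorm H1 x * hnorm H3 y)"
    if x: "x \<in> carrier H1" and y: "y \<in> carrier H3" for x y
  proof -
    have c: "J x \<in> carrier H2" "L' y \<in> carrier H2" using x y bops_mem[OF J(1)] bops_mem[OF J(4)] by simp_all
    have "cmod (ip H1 x (J' (L' y)) - ip H2 (J x) (L' y)) \<le> a * (hnorm H1 x * hnorm H2 (L' y))"
      by (rule quasi_unitaryD(5)[OF q1 x c(2)])
    also have "\<dots> \<le> a * (hnorm H1 x * ((1 + b) * hnorm H3 y))"
      by (rule mult_left_mono[OF mult_left_mono[OF quasi_unitaryD(4)[OF q2 y]] ab(1)]) (use x in simp)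
    finally have 1: "cmod (ip H1 x (J' (L' y)) - ip H2 (J x) (L' y)) \<le> (a * (1 + b)) * (hnorm H1 x * hnorm H3 y)"
      by (simp add: mult_ac)
    have "cmod (ip H2 (J x) (L' y) - ip H3 (L (J x)) y) \<le> b * (hnorm H2 (J x) * hnorm H3 y)"
      by (rule quasi_unitaryD(5)[OF q2 c(1) y])
    also have "\<dots> \<le> b * (((1 + a) * hnorm H1 x) * hnorm H3 y)"
      by (rule mult_left_mono[OF mult_right_mono[OF quasi_unitaryD(3)[OF q1 x]] ab(2)]) (use y in simp)
    finally have 2: "cmod (ip H2 (J x) (L' y) - ip H3 (L (J x)) y) \<le> (b * (1 + a)) * (hnorm H1 x * hnorm H3 y)"
      by (simp add: mult_ac)
    have "cmod (ip H1 x (J' (L' y)) - ip H3 (L (J x)) y)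
      \<le> (a * (1 + b)) * (hnorm H1 x * hnorm H3 y) + (b * (1 + a)) * (hnorm H1 x * hnorm H3 y)"
      using 1 2 norm_triangle_ineq[of "ip H1 x (J' (L' y)) - ip H2 (J x) (L' y)" "ip H2 (J x) (L' y) - ip H3 (L (J x)) y"]
      by simp
    also have "\<dots> = ((1 + b) * a + b * (1 + a)) * (hnorm H1 x * hnorm H3 y)" by (simp add: algebra_simps)
    also have "\<dots> \<le> \<Phi> a b * (hnorm H1 x * hnorm H3 y)" using p x y by (intro mult_right_mono) auto
    finally show ?thesis .
  qed
  show ?thesis
    unfolding quasi_unitary_def
  proof (intro conjI ballI)
    fix x assume x: "x \<in> carrier H1"
    show "hnorm H3 (L (J x)) \<le> (1 + \<Phi> a b) * hnorm H1 x"
      using quasi_unitary_trans_bound[OF hs ab(1,2) q1 q2 x] mult_right_mono[OF p(2) nn[OF x]] by linarith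
    show "hnorm H1 (R1 x \<ominus>\<^bsub>H1\<^esub> J' (L' (L (J (R1 x))))) \<le> \<Phi> a b * hnorm H1 x"
      by (rule quasi_unitary_trans_defect[OF hs ab(1,2,4) R(1,2) q1 q2 x])
    show "hnorm H3 (L (J (R1 x)) \<ominus>\<^bsub>H3\<^esub> R3 (L (J x))) \<le> \<Phi> a b * hnorm H1 x"
      using quasi_unitary_trans_commutator[OF hs ab(1,2) R q1 q2 x] mult_right_mono[OF p(1) nn[OF x]] by linarith
  next
    fix y assume y: "y \<in> carrier H3"
    show "hnorm H1 (J' (L' y)) \<le> (1 + \<Phi> a b) * hnorm H3 y"
      using quasi_unitary_trans_bound[OF hs(3,2,1) ab(2,1) q2' q1' y] mult_right_mono[OF p'(2) nn3[OF y]] by linarith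
    show "hnorm H3 (R3 y \<ominus>\<^bsub>H3\<^esub> L (J (J' (L' (R3 y))))) \<le> \<Phi> a b * hnorm H3 y"
      using quasi_unitary_trans_defect[OF hs(3,2,1) ab(2,1,3) R(3,2) q2' q1' y] Phi_commute[of a b] by simp
    show "hnorm H1 (J' (L' (R3 y)) \<ominus>\<^bsub>H1\<^esub> R1 (J' (L' y))) \<le> \<Phi> a b * hnorm H3 y"
      using quasi_unitary_trans_commutator[OF hs(3,2,1) ab(2,1) R(3,2,1) q2' q1' y] mult_right_mono[OF p'(1) nn3[OF y]] by linarith
  next
    show "(\<lambda>x. L (J x)) \<in> bounded_ops H1 H3" by (rule bops_comp[OF hs J(1,3)])
    show "(\<lambda>y. J' (L' y)) \<in> bounded_ops H3 H1" by (rule bops_comp[OF hs(3,2,1) J(4,2)])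
  next
    fix x y assume "x \<in> carrier H1" "y \<in> carrier H3"
    then show "cmod (ip H1 x (J' (L' y)) - ip H3 (L (J x)) y) \<le> \<Phi> a b * (hnorm H1 x * hnorm H3 y)"
      by (rule form)
  qed
qed

text \<open>Replacing an operator by a unitarily equivalent one does not change the distance.\<close>

lemma quasi_unitary_unitary:
  assumes hs: "hilbert_space H" "hilbert_space H'" "hilbert_space K"
    and U: "unitary H H' U" and R: "R \<in> bounded_ops H H" "S \<in> bounded_ops K K"
    and R': "\<And>y. y \<in> carrier H' \<Longrightarrow> R' y = U (R (adj H H' U y))"
    and q: "quasi_unitary \<delta> H R K S J J'"
  shows "quasi_unitary \<delta> H' R' K S (\<lambda>y. J (adj H H' U y)) (\<lambda>z. U (J' z))"
proof -
  interpret P: hilbert_pair H H' using hs by (simp add: hilbert_pair_def)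
  interpret Q: hilbert_pair H K using hs by (simp add: hilbert_pair_def)
  let ?V = "adj H H' U"
  note u = P.unitary_props[OF U]
  have J: "J \<in> bounded_ops H K" "J' \<in> bounded_ops K H" using quasi_unitaryD(1,2)[OF q] by simp_all
  note m = bops_mem[OF u(1)] bops_mem[OF u(2)] bops_mem[OF J(1)] bops_mem[OF J(2)] bops_mem[OF R(1)] bops_mem[OF R(2)]
  have V: "ip H' y (U x) = ip H (?V y) x" if "x \<in> carrier H" "y \<in> carrier H'" for x y
    using P.adj_ip'[OF u(1) that] by simp
  show ?thesis
    unfolding quasi_unitary_def
  proof (intro conjI ballI)
    fix y assume y: "y \<in> carrier H'"
    let ?x = "?V y"
    have x: "?x \<in> carrier H" "hnorm H ?x = hnorm H' y" by (rule m(2)[OF y], rule u(8)[OF y])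
    have "U (R ?x) \<ominus>\<^bsub>H'\<^esub> U (J' (J (R ?x))) = U (R ?x \<ominus>\<^bsub>H\<^esub> J' (J (R ?x)))"
      using x m by (simp add: P.bops_diff[OF u(1)])
    then show "hnorm H' (R' y \<ominus>\<^bsub>H'\<^esub> U (J' (J (?V (R' y))))) \<le> \<delta> * hnorm H' y"
      using quasi_unitaryD(6)[OF q x(1)] x m by (simp add: R'[OF y] u(3) u(7))
    show "hnorm K (J ?x) \<le> (1 + \<delta>) * hnorm H' y" using quasi_unitaryD(3)[OF q x(1)] by (simp add: x(2))
    show "hnorm K (J (?V (R' y)) \<ominus>\<^bsub>K\<^esub> S (J ?x)) \<le> \<delta> * hnorm H' y"
      using quasi_unitaryD(8)[OF q x(1)] x(1) m by (simp add: R'[OF y] u(3) x(2))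
  next
    fix z assume z: "z \<in> carrier K"
    then show "hnorm H' (U (J' z)) \<le> (1 + \<delta>) * hnorm K z" using quasi_unitaryD(4)[OF q z] m by (simp add: u(7))
    show "hnorm K (S z \<ominus>\<^bsub>K\<^esub> J (?V (U (J' (S z))))) \<le> \<delta> * hnorm K z"
      using quasi_unitaryD(7)[OF q z] z m by (simp add: u(3))
    have "U (J' (S z)) \<ominus>\<^bsub>H'\<^esub> U (R (J' z)) = U (J' (S z) \<ominus>\<^bsub>H\<^esub> R (J' z))"
      using z m by (simp add: P.bops_diff[OF u(1)])
    then show "hnorm H' (U (J' (S z)) \<ominus>\<^bsub>H'\<^esub> R' (U (J' z))) \<le> \<delta> * hnorm K z"
      using quasi_unitaryD(9)[OF q z] z m by (simp add: R' u(3) u(7))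
  next
    fix y z assume y: "y \<in> carrier H'" and z: "z \<in> carrier K"
    then show "cmod (ip H' y (U (J' z)) - ip K (J (?V y)) z) \<le> \<delta> * (hnorm H' y * hnorm K z)"
      using quasi_unitaryD(5)[OF q m(2)[OF y] z] m by (simp add: V u(8))
  next
    show "(\<lambda>y. J (?V y)) \<in> bounded_ops H' K" by (rule bops_comp[OF hs(2,1,3) u(2) J(1)])
    show "(\<lambda>z. U (J' z)) \<in> bounded_ops K H'" by (rule bops_comp[OF hs(3,1,2) J(2) u(1)])
  qed
qed

section \<open>Symmetric operators\<close>

definition symmetric_op :: "'a hspace \<Rightarrow> ('a \<Rightarrow> 'a) \<Rightarrow> bool" where
  "symmetric_op H T \<longleftrightarrow> T \<in> bounded_ops H H \<and>
     (\<forall>x\<in>carrier H. \<forall>y\<in>carrier H. ip H (T x) y = ip H x (T y))"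

definition shift :: "'a hspace \<Rightarrow> ('a \<Rightarrow> 'a) \<Rightarrow> complex \<Rightarrow> 'a \<Rightarrow> 'a" where
  "shift H T z x = T x \<ominus>\<^bsub>H\<^esub> z \<odot>\<^bsub>H\<^esub> x"

definition bounded_below :: "'a hspace \<Rightarrow> ('a \<Rightarrow> 'a) \<Rightarrow> bool" where
  "bounded_below H T \<longleftrightarrow> (\<exists>c>0. \<forall>x\<in>carrier H. c * hnorm H x \<le> hnorm H (T x))"

context hilbert_space
begin

sublocale HH: hilbert_pair H H
  by unfold_locales

lemma hnorm_le_0: "hnorm H x \<le> 0 \<Longrightarrow> x \<in> carrier H \<Longrightarrow> x = \<zero>"
  using hnorm_pos[of x] by force

lemma symmetric_opD:
  assumes "symmetric_op H T"
  shows "T \<in> bounded_ops H H" "x \<in> carrier H \<Longrightarrow> T x \<in> carrier H"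
    "x \<in> carrier H \<Longrightarrow> y \<in> carrier H \<Longrightarrow> ip H (T x) y = ip H x (T y)"
  using assms bops_mem[of T H H x] by (auto simp: symmetric_op_def)

lemma smult_bops: "(\<lambda>x. z \<odot> x) \<in> bounded_ops H H"
proof (rule bopsI[where C = "cmod z"])
  show "z \<odot> (x \<oplus> y) = z \<odot> x \<oplus> z \<odot> y" if "x \<in> carrier H" "y \<in> carrier H" for x y
    by (rule ip_ext) (use that in \<open>simp_all add: ip_simps algebra_simps\<close>)
  show "z \<odot> (c \<odot> x) = c \<odot> (z \<odot> x)" if "x \<in> carrier H" for x c
    by (rule ip_ext) (use that in \<open>simp_all add: ip_simps\<close>)
qed (simp_all add: hnorm_smult)

lemma shift_bops: "T \<in> bounded_ops H H \<Longrightarrow> shift H T z \<in> bounded_ops H H"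
  unfolding shift_def by (rule HH.bops_minus[OF _ smult_bops])

lemma shift_mem [simp]: "T \<in> bounded_ops H H \<Longrightarrow> x \<in> carrier H \<Longrightarrow> shift H T z x \<in> carrier H"
  by (rule bops_mem[OF shift_bops])

lemma symmetric_shift:
  assumes "symmetric_op H T"
  shows "symmetric_op H (shift H T (complex_of_real t))"
  unfolding symmetric_op_def
  by (intro conjI ballI shift_bops symmetric_opD(1)[OF assms])
    (simp add: shift_def ip_simps symmetric_opD[OF assms])

lemma symmetric_square:
  assumes "symmetric_op H T"
  shows "symmetric_op H (\<lambda>x. T (T x))"
  unfolding symmetric_op_def
  by (intro conjI ballI bops_comp[OF hilbert_space_axioms hilbert_space_axioms hilbert_space_axioms
      symmetric_opD(1)[OF assms] symmetric_opD(1)[OF assms]]) (simp add: symmetric_opD[OF assms])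

lemma shift_shift:
  assumes T: "T \<in> bounded_ops H H" and x: "x \<in> carrier H"
  shows "shift H T p (shift H T q x) = (T (T x) \<ominus> (p + q) \<odot> T x) \<oplus> (p * q) \<odot> x"
proof -
  have m: "T x \<in> carrier H" "T (T x) \<in> carrier H" using bops_mem[OF T] x by simp_all
  have "T (T x \<ominus> q \<odot> x) = T (T x) \<ominus> q \<odot> T x"
    using m x by (simp add: HH.bops_diff[OF T] bops_smult[OF T])
  then show ?thesis unfolding shift_def
    by (intro ip_ext) (use m x in \<open>simp_all add: ip_simps algebra_simps\<close>)
qed

lemma bounded_below_comp:
  assumes "bounded_below H S" "bounded_below H T" "\<And>x. x \<in> carrier H \<Longrightarrow> T x \<in> carrier H"
  shows "bounded_below H (\<lambda>x. S (T x))"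
proof -
  obtain c where c: "c > 0" "\<And>x. x \<in> carrier H \<Longrightarrow> c * hnorm H x \<le> hnorm H (S x)"
    using assms(1) by (auto simp: bounded_below_def)
  obtain d where d: "d > 0" "\<And>x. x \<in> carrier H \<Longrightarrow> d * hnorm H x \<le> hnorm H (T x)"
    using assms(2) by (auto simp: bounded_below_def)
  have "(c * d) * hnorm H x \<le> hnorm H (S (T x))" if x: "x \<in> carrier H" for x
  proof -
    have "c * (d * hnorm H x) \<le> c * hnorm H (T x)" using d(2)[OF x] c(1) by simp
    then show ?thesis using c(2)[OF assms(3)[OF x]] by (simp add: mult.assoc)
  qed
  then show ?thesis unfolding bounded_below_def using c d by (intro exI[of _ "c * d"]) simp
qed

lemma bounded_below_cong:
  assumes "bounded_below H S" "\<And>x. x \<in> carrier H \<Longrightarrow> hnorm H (S x) = hnorm H (T x)"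
  shows "bounded_below H T"
  using assms by (simp add: bounded_below_def)

lemma bounded_below_of_not_spectrum:
  assumes T: "T \<in> bounded_ops H H" and z: "z \<notin> spectrum H T"
  shows "bounded_below H (shift H T z)"
proof -
  obtain S where S: "S \<in> bounded_ops H H" "\<And>x. x \<in> carrier H \<Longrightarrow> S (shift H T z x) = x"
    using z by (auto simp: spectrum_def shift_def)
  obtain C where C: "C > 0" "\<And>x. x \<in> carrier H \<Longrightarrow> hnorm H (S x) \<le> C * hnorm H x"
    using HH.bops_bound[OF S(1)] by blast
  have "(1 / C) * hnorm H x \<le> hnorm H (shift H T z x)" if x: "x \<in> carrier H" for x
    using C(2)[OF shift_mem[OF T x, of z]] C(1) unfolding S(2)[OF x] by (simp add: field_simps)
  then show ?thesis unfolding bounded_below_def using C by (intro exI[of _ "1 / C"]) simp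
qed

text \<open>Evaluating the form at \<open>y - Ty/C\<close> bounds \<open>\<parallel>Ty\<parallel>\<^sup>2\<close> by the form at \<open>y\<close>.\<close>

lemma nonneg_form_norm_bound:
  assumes T: "symmetric_op H T"
    and M: "M \<subseteq> carrier H" "\<And>x. x \<in> M \<Longrightarrow> T x \<in> M" "\<And>c x y. x \<in> M \<Longrightarrow> y \<in> M \<Longrightarrow> x \<ominus> c \<odot> y \<in> M"
    and nonneg: "\<And>x. x \<in> M \<Longrightarrow> 0 \<le> Re (ip H x (T x))"
    and C: "0 < C" "\<And>x. x \<in> M \<Longrightarrow> Re (ip H x (T x)) \<le> C * (hnorm H x)\<^sup>2"
    and y: "y \<in> M"
  shows "(hnorm H (T y))\<^sup>2 \<le> C * Re (ip H y (T y))"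
proof -
  let ?t = "complex_of_real (1 / C)"
  let ?x = "y \<ominus> ?t \<odot> T y"
  have m: "y \<in> carrier H" "T y \<in> carrier H" "T (T y) \<in> carrier H"
    using y M symmetric_opD(2)[OF T] by auto
  have x: "?x \<in> M" using M y by simp
  have Tx: "T ?x = T y \<ominus> ?t \<odot> T (T y)"
    using m by (simp add: HH.bops_diff[OF symmetric_opD(1)[OF T]] bops_smult[OF symmetric_opD(1)[OF T]])
  have s: "ip H y (T (T y)) = ip H (T y) (T y)" using symmetric_opD(3)[OF T m(1,2)] by simp
  have "ip H ?x (T ?x) = ip H y (T y) - (2 / C) * ip H (T y) (T y) + (1 / C\<^sup>2) * ip H (T y) (T (T y))"
    unfolding Tx using m s C(1) by (simp add: ip_simps field_simps power2_eq_square)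
  then have "Re (ip H ?x (T ?x)) = Re (ip H y (T y)) - (2 / C) * (hnorm H (T y))\<^sup>2
      + (1 / C\<^sup>2) * Re (ip H (T y) (T (T y)))"
    using m by (simp add: ip_self flip: of_real_power of_real_divide of_real_mult)
  moreover have "(1 / C\<^sup>2) * Re (ip H (T y) (T (T y))) \<le> (1 / C\<^sup>2) * (C * (hnorm H (T y))\<^sup>2)"
    using C(2)[OF M(2)[OF y]] by (intro mult_left_mono) auto
  ultimately have "0 \<le> Re (ip H y (T y)) - (2 / C) * (hnorm H (T y))\<^sup>2 + (1 / C\<^sup>2) * (C * (hnorm H (T y))\<^sup>2)"
    using nonneg[OF x] by linarith
  also have "\<dots> = Re (ip H y (T y)) - (hnorm H (T y))\<^sup>2 / C"
    using C(1) by (simp add: field_simps power2_eq_square)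
  finally show ?thesis using C(1) by (simp add: field_simps)
qed

lemma Re_ip_le_bound:
  assumes "\<And>x. x \<in> carrier H \<Longrightarrow> hnorm H (T x) \<le> C * hnorm H x" "x \<in> carrier H" "T x \<in> carrier H"
  shows "\<bar>Re (ip H x (T x))\<bar> \<le> C * (hnorm H x)\<^sup>2"
proof -
  have "\<bar>Re (ip H x (T x))\<bar> \<le> hnorm H x * hnorm H (T x)"
    using cauchy_schwarz[of x "T x"] abs_Re_le_cmod[of "ip H x (T x)"] assms by linarith
  also have "\<dots> \<le> hnorm H x * (C * hnorm H x)" using assms by (intro mult_left_mono) auto
  finally show ?thesis by (simp add: power2_eq_square mult_ac)
qed

text \<open>If the form of \<open>T\<close> took negative values, then its greatest lower bound \<open>m\<close> would be
  negative. Since \<open>T - m\<close> is bounded below, the preceding bound would allow to increase \<open>m\<close>.\<close>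

lemma nonneg_form_of_bounded_below:
  assumes T: "symmetric_op H T"
    and bb: "\<And>t. t < 0 \<Longrightarrow> bounded_below H (shift H T (complex_of_real t))"
    and x: "x \<in> carrier H"
  shows "0 \<le> Re (ip H x (T x))"
proof (rule ccontr)
  assume "\<not> 0 \<le> Re (ip H x (T x))"
  then have neg: "Re (ip H x (T x)) < 0" by simp
  note Tb = symmetric_opD(1)[OF T] and Tm = symmetric_opD(2)[OF T]
  have xn: "0 < hnorm H x" using hnorm_pos[OF x] neg x Tm by (cases "x = \<zero>") auto
  obtain C where C: "C > 0" "\<And>x. x \<in> carrier H \<Longrightarrow> hnorm H (T x) \<le> C * hnorm H x"
    using HH.bops_bound[OF Tb] by blast
  define A where "A = {m. \<forall>y\<in>carrier H. m * (hnorm H y)\<^sup>2 \<le> Re (ip H y (T y))}"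
  have A1: "- C \<in> A" unfolding A_def
  proof safe
    fix y assume "y \<in> carrier H"
    then show "- C * (hnorm H y)\<^sup>2 \<le> Re (ip H y (T y))" using Re_ip_le_bound[OF C(2), of y] Tm by force
  qed
  have A2: "m \<le> Re (ip H x (T x)) / (hnorm H x)\<^sup>2" if "m \<in> A" for m
    using that x xn by (simp add: A_def field_simps)
  have bdd: "bdd_above A" using A2 by (rule bdd_aboveI)
  define m where "m = Sup A"
  have mA: "m \<in> A" unfolding A_def
  proof safe
    fix y assume y: "y \<in> carrier H"
    show "m * (hnorm H y)\<^sup>2 \<le> Re (ip H y (T y))"
    proof (cases "hnorm H y = 0")
      case True
      then have "y = \<zero>" using hnorm_eq_0_iff y by blast
      then show ?thesis using Tm[OF y] by simp
    next
      case False
      then have p: "0 < (hnorm H y)\<^sup>2" by simp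
      have "m \<le> Re (ip H y (T y)) / (hnorm H y)\<^sup>2"
        unfolding m_def
      proof (rule cSup_least)
        show "A \<noteq> {}" using A1 by blast
        show "r \<le> Re (ip H y (T y)) / (hnorm H y)\<^sup>2" if "r \<in> A" for r
          using that y p by (simp add: A_def field_simps)
      qed
      then show ?thesis using p by (simp add: field_simps)
    qed
  qed
  have "m < 0" using A2[OF mA] neg xn by (smt (verit) divide_neg_pos zero_less_power)
  let ?S = "shift H T (complex_of_real m)"
  obtain c where c: "c > 0" "\<And>y. y \<in> carrier H \<Longrightarrow> c * hnorm H y \<le> hnorm H (?S y)"
    using bb[OF \<open>m < 0\<close>] by (auto simp: bounded_below_def)
  have S: "symmetric_op H ?S" by (rule symmetric_shift[OF T])
  have form: "Re (ip H y (?S y)) = Re (ip H y (T y)) - m * (hnorm H y)\<^sup>2" if "y \<in> carrier H" for y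
    using that Tm by (simp add: shift_def ip_simps ip_self flip: of_real_power)
  define D where "D = C + \<bar>m\<bar> + 1"
  have Dp: "D > 0" using C(1) by (simp add: D_def)
  have D: "Re (ip H y (?S y)) \<le> D * (hnorm H y)\<^sup>2" if y: "y \<in> carrier H" for y
  proof -
    have "Re (ip H y (?S y)) \<le> C * (hnorm H y)\<^sup>2 + \<bar>m\<bar> * (hnorm H y)\<^sup>2"
      using Re_ip_le_bound[OF C(2) y Tm[OF y]] mult_right_mono[of "-m" "\<bar>m\<bar>" "(hnorm H y)\<^sup>2"]
      unfolding form[OF y] by fastforce
    also have "\<dots> \<le> D * (hnorm H y)\<^sup>2" unfolding D_def by (simp add: algebra_simps)
    finally show ?thesis .
  qed
  \<comment> \<open>On vectors of norm 1, the form of \<open>T - m\<close> is at least \<open>\<parallel>(T - m)y\<parallel>\<^sup>2/D \<ge> c\<^sup>2/D\<close>.\<close>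
  have "m + c\<^sup>2 / D \<in> A" unfolding A_def
  proof safe
    fix y assume y: "y \<in> carrier H"
    have "(hnorm H (?S y))\<^sup>2 \<le> D * Re (ip H y (?S y))"
      by (rule nonneg_form_norm_bound[OF S, where M = "carrier H"])
        (use y mA Dp D Tb in \<open>auto simp: form A_def\<close>)
    moreover have "(c * hnorm H y)\<^sup>2 \<le> (hnorm H (?S y))\<^sup>2"
      using c(2)[OF y] c(1) y by (intro power_mono) auto
    ultimately have "c\<^sup>2 * (hnorm H y)\<^sup>2 \<le> D * (Re (ip H y (T y)) - m * (hnorm H y)\<^sup>2)"
      by (simp add: power_mult_distrib form[OF y])
    then show "(m + c\<^sup>2 / D) * (hnorm H y)\<^sup>2 \<le> Re (ip H y (T y))"
      using Dp by (simp add: field_simps)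
  qed
  then have "m + c\<^sup>2 / D \<le> m" unfolding m_def by (rule cSup_upper[OF _ bdd])
  moreover have "c\<^sup>2 / D > 0" using c(1) Dp by simp
  ultimately show False by simp
qed

text \<open>The range of a symmetric operator that is bounded below is closed, and its orthogonal
  complement is the kernel, which vanishes.\<close>

lemma symmetric_bounded_below_surj:
  assumes T: "symmetric_op H T" and bb: "bounded_below H T" and y: "y \<in> carrier H"
  shows "\<exists>x\<in>carrier H. T x = y"
proof -
  note Tb = symmetric_opD(1)[OF T] and Tm = symmetric_opD(2)[OF T]
  obtain c where c: "c > 0" "\<And>x. x \<in> carrier H \<Longrightarrow> c * hnorm H x \<le> hnorm H (T x)"
    using bb by (auto simp: bounded_below_def)
  obtain C where C: "C > 0" "\<And>x. x \<in> carrier H \<Longrightarrow> hnorm H (T x) \<le> C * hnorm H x"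
    using HH.bops_bound[OF Tb] by blast
  define M where "M = T ` carrier H"
  have "\<exists>z\<in>M. \<forall>m\<in>M. ip H m (y \<ominus> z) = 0"
  proof (rule orthogonal_projection)
    show "M \<subseteq> carrier H" "M \<noteq> {}" using Tm by (auto simp: M_def)
    show "a \<oplus> b \<in> M" if "a \<in> M" "b \<in> M" for a b
      using that bops_add[OF Tb, symmetric] by (auto simp: M_def)
    show "k \<odot> a \<in> M" if "a \<in> M" for k a
      using that bops_smult[OF Tb, symmetric] by (auto simp: M_def)
    fix s l
    assume s: "\<And>n. s n \<in> M" and l: "l \<in> carrier H" and lim: "(\<lambda>n. hnorm H (s n \<ominus> l)) \<longlonglongrightarrow> 0"
    obtain r where r: "\<And>n. r n \<in> carrier H" "\<And>n. s n = T (r n)"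
      using s unfolding M_def image_iff by metis
    have sc: "s n \<in> carrier H" for n using r Tm by simp
    have "\<exists>l\<in>carrier H. (\<lambda>n. hnorm H (r n \<ominus> l)) \<longlonglongrightarrow> 0"
    proof (rule cauchy_limit[OF r(1)])
      fix e :: real assume e: "e > 0"
      then have "\<forall>\<^sub>F n in sequentially. hnorm H (s n \<ominus> l) < c * e / 2"
        using lim c(1) by (intro order_tendstoD(2)) auto
      then obtain N where N: "\<And>n. n \<ge> N \<Longrightarrow> hnorm H (s n \<ominus> l) < c * e / 2"
        by (auto simp: eventually_sequentially)
      have "hnorm H (r m \<ominus> r n) < e" if mn: "m \<ge> N" "n \<ge> N" for m n
      proof -
        have "c * hnorm H (r m \<ominus> r n) \<le> hnorm H (s m \<ominus> s n)"
          using c(2)[of "r m \<ominus> r n"] r by (simp add: HH.bops_diff[OF Tb])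
        also have "\<dots> \<le> hnorm H (s m \<ominus> l) + hnorm H (l \<ominus> s n)"
          by (rule hnorm_triangle_via[OF sc l sc])
        also have "\<dots> < c * e"
          using N[OF mn(1)] N[OF mn(2)] hnorm_minus_commute[OF l sc, of n] by linarith
        finally show ?thesis using c(1) by simp
      qed
      then show "\<exists>N. \<forall>m\<ge>N. \<forall>n\<ge>N. hnorm H (r m \<ominus> r n) < e" by blast
    qed
    then obtain x where x: "x \<in> carrier H" "(\<lambda>n. hnorm H (r n \<ominus> x)) \<longlonglongrightarrow> 0" by blast
    have "(\<lambda>n. hnorm H (s n \<ominus> T x)) \<longlonglongrightarrow> 0"
    proof (rule Lim_null_comparison)
      show "(\<lambda>n. C * hnorm H (r n \<ominus> x)) \<longlonglongrightarrow> 0" using tendsto_mult_left[OF x(2), of C] by simp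
      show "\<forall>\<^sub>F n in sequentially. norm (hnorm H (s n \<ominus> T x)) \<le> C * hnorm H (r n \<ominus> x)"
        using C(2)[of "r _ \<ominus> x"] r x Tm by (simp add: HH.bops_diff[OF Tb])
    qed
    then have "limitin (htopology H) s (T x) sequentially" "limitin (htopology H) s l sequentially"
      using limitin_iff[OF sc] l lim x Tm by auto
    then have "T x = l" unfolding htopology_def by (rule MS.limitin_metric_unique) simp
    then show "l \<in> M" using x by (auto simp: M_def)
  qed (rule y)
  then obtain x where x: "x \<in> carrier H" "\<And>w. w \<in> carrier H \<Longrightarrow> ip H (T w) (y \<ominus> T x) = 0"
    by (auto simp: M_def)
  let ?d = "y \<ominus> T x"
  have d: "?d \<in> carrier H" using y x Tm by simp
  have "T ?d = \<zero>"
    by (rule ip_ext) (use x d Tm symmetric_opD(3)[OF T] in \<open>simp_all\<close>)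
  then have "hnorm H ?d \<le> 0" using c(2)[OF d] c(1) by (simp add: mult_le_0_iff)
  then have "?d = \<zero>" by (rule hnorm_le_0[OF _ d])
  then have "T x = y" using x(1) y Tm by simp
  then show ?thesis using x(1) by blast
qed

lemma not_spectrum_iff_bounded_below:
  assumes T: "symmetric_op H T"
  shows "complex_of_real t \<notin> spectrum H T \<longleftrightarrow> bounded_below H (shift H T (complex_of_real t))"
proof
  assume bb: "bounded_below H (shift H T (complex_of_real t))"
  let ?A = "shift H T (complex_of_real t)"
  have A: "symmetric_op H ?A" by (rule symmetric_shift[OF T])
  note Ab = symmetric_opD(1)[OF A]
  obtain c where c: "c > 0" "\<And>x. x \<in> carrier H \<Longrightarrow> c * hnorm H x \<le> hnorm H (?A x)"
    using bb by (auto simp: bounded_below_def)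
  define S where "S y = (SOME x. x \<in> carrier H \<and> ?A x = y)" for y
  have S: "S y \<in> carrier H" "?A (S y) = y" if "y \<in> carrier H" for y
    using someI_ex[of "\<lambda>x. x \<in> carrier H \<and> ?A x = y"] symmetric_bounded_below_surj[OF A bb that]
    unfolding S_def by blast+
  have inj: "x = x'" if "x \<in> carrier H" "x' \<in> carrier H" "?A x = ?A x'" for x x'
  proof -
    have "?A (x \<ominus> x') = \<zero>" using that symmetric_opD(2)[OF A] by (simp add: HH.bops_diff[OF Ab])
    then have "hnorm H (x \<ominus> x') \<le> 0"
      using c(2)[of "x \<ominus> x'"] c(1) that by (simp add: mult_le_0_iff)
    then have "x \<ominus> x' = \<zero>" by (rule hnorm_le_0) (use that in simp)
    then show ?thesis using that by simp
  qed
  have SA: "S (?A x) = x" if "x \<in> carrier H" for x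
    by (rule inj) (use S[OF symmetric_opD(2)[OF A that]] that in simp_all)
  have "S \<in> bounded_ops H H"
  proof (rule bopsI[where C = "1 / c"])
    show "S (x \<oplus> y) = S x \<oplus> S y" if "x \<in> carrier H" "y \<in> carrier H" for x y
      by (rule inj) (use that S in \<open>simp_all add: bops_add[OF Ab]\<close>)
    show "S (k \<odot> x) = k \<odot> S x" if "x \<in> carrier H" for x k
      by (rule inj) (use that S in \<open>simp_all add: bops_smult[OF Ab]\<close>)
    show "hnorm H (S x) \<le> 1 / c * hnorm H x" if "x \<in> carrier H" for x
      using c(2)[OF S(1)[OF that]] S(2)[OF that] c(1) by (simp add: field_simps)
  qed (rule S(1))
  then show "complex_of_real t \<notin> spectrum H T"
    using S SA unfolding spectrum_def shift_def by blast
qed (rule bounded_below_of_not_spectrum[OF symmetric_opD(1)[OF T]])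

text \<open>At a real point, the only way to belong to the spectrum of a symmetric operator is to have
  approximate eigenvectors.\<close>

lemma spectrum_approximate_eigenvector:
  assumes T: "symmetric_op H T" and t: "complex_of_real t \<in> spectrum H T" and e: "e > 0"
  shows "\<exists>x\<in>carrier H. hnorm H x = 1 \<and> hnorm H (shift H T (complex_of_real t) x) \<le> e"
proof -
  have "\<not> bounded_below H (shift H T (complex_of_real t))"
    using t not_spectrum_iff_bounded_below[OF T] by blast
  then obtain x where x: "x \<in> carrier H" "hnorm H (shift H T (complex_of_real t) x) < e * hnorm H x"
    using e unfolding bounded_below_def by (meson not_le)
  note Tb = symmetric_opD(1)[OF T]
  have "0 \<le> hnorm H (shift H T (complex_of_real t) x)" using x Tb by simp
  then have p: "0 < hnorm H x" using x e by (smt (verit) mult_nonneg_nonpos hnorm_nonneg)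
  let ?u = "complex_of_real (1 / hnorm H x) \<odot> x"
  have "hnorm H (shift H T (complex_of_real t) ?u) = hnorm H (shift H T (complex_of_real t) x) / hnorm H x"
    unfolding bops_smult[OF shift_bops[OF Tb] x(1)] using p x Tb by (simp add: hnorm_smult norm_divide)
  also have "\<dots> \<le> e" using x p by (simp add: field_simps)
  finally show ?thesis using x p by (intro bexI[of _ ?u]) (simp_all add: hnorm_smult norm_divide)
qed

section \<open>Operators with spectrum in the unit interval\<close>

lemma B01_symmetric: "R \<in> B01 H \<Longrightarrow> symmetric_op H R"
  using HH.adj_ip[of R] by (auto simp: B01_def symmetric_op_def)

lemma B01_real_spectrum:
  assumes "R \<in> B01 H" "z \<in> spectrum H R"
  shows "z = complex_of_real (Re z)" "0 \<le> Re z" "Re z \<le> 1"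
  using assms by (auto simp: B01_def)

lemma B01_form_nonneg:
  assumes R: "R \<in> B01 H" and x: "x \<in> carrier H"
  shows "0 \<le> Re (ip H x (R x))"
proof (rule nonneg_form_of_bounded_below[OF B01_symmetric[OF R] _ x])
  fix t :: real assume "t < 0"
  then have "complex_of_real t \<notin> spectrum H R" using B01_real_spectrum(2)[OF R] by fastforce
  then show "bounded_below H (shift H R (complex_of_real t))"
    using not_spectrum_iff_bounded_below[OF B01_symmetric[OF R]] by simp
qed

text \<open>The same argument applies to \<open>1 - R\<close>, as \<open>R\<close> has no spectrum in \<open>(1, \<infinity>)\<close>.\<close>

lemma B01_form_le:
  assumes R: "R \<in> B01 H" and x: "x \<in> carrier H"
  shows "Re (ip H x (R x)) \<le> (hnorm H x)\<^sup>2"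
proof -
  note S = B01_symmetric[OF R] and Rm = symmetric_opD(2)[OF B01_symmetric[OF R]]
  let ?T = "\<lambda>x. x \<ominus> R x"
  have T: "symmetric_op H ?T"
    unfolding symmetric_op_def
    by (intro conjI ballI HH.bops_minus[OF id_bops symmetric_opD(1)[OF S]])
      (simp add: ip_simps Rm symmetric_opD(3)[OF S])
  have "0 \<le> Re (ip H x (?T x))"
  proof (rule nonneg_form_of_bounded_below[OF T _ x])
    fix t :: real assume "t < 0"
    then have "complex_of_real (1 - t) \<notin> spectrum H R" using B01_real_spectrum(3)[OF R] by fastforce
    from iffD1[OF not_spectrum_iff_bounded_below[OF S] this]
    show "bounded_below H (shift H ?T (complex_of_real t))"
    proof (rule bounded_below_cong)
      fix y assume y: "y \<in> carrier H"
      have "shift H ?T (complex_of_real t) y = (-1) \<odot> shift H R (complex_of_real (1 - t)) y"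
        unfolding shift_def by (rule ip_ext) (use y Rm in \<open>simp_all add: ip_simps algebra_simps\<close>)
      then show "hnorm H (shift H R (complex_of_real (1 - t)) y) = hnorm H (shift H ?T (complex_of_real t) y)"
        using y symmetric_opD(1)[OF S] by (simp add: hnorm_smult)
    qed
  qed
  then show ?thesis using x Rm by (simp add: ip_simps ip_self flip: of_real_power)
qed

lemma B01_norm_sq_le_form:
  assumes R: "R \<in> B01 H" and x: "x \<in> carrier H"
  shows "(hnorm H (R x))\<^sup>2 \<le> Re (ip H x (R x))"
proof -
  note S = B01_symmetric[OF R]
  have "(hnorm H (R x))\<^sup>2 \<le> 1 * Re (ip H x (R x))"
    by (rule nonneg_form_norm_bound[OF S, where M = "carrier H"])
      (use x symmetric_opD(2)[OF S] B01_form_nonneg[OF R] B01_form_le[OF R] in auto)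
  then show ?thesis by simp
qed

lemma B01_contraction:
  assumes R: "R \<in> B01 H" and x: "x \<in> carrier H"
  shows "hnorm H (R x) \<le> hnorm H x"
  using power2_le_imp_le[OF order_trans[OF B01_norm_sq_le_form[OF R x] B01_form_le[OF R x]]] x by simp

lemma B01_kernel:
  assumes R: "R \<in> B01 H" and x: "x \<in> carrier H" "R x = \<zero>"
  shows "x = \<zero>"
proof -
  have "R \<zero> = \<zero>" using HH.bops_zero R by (simp add: B01_def)
  then show ?thesis using R x by (auto simp: B01_def inj_on_def)
qed

section \<open>Gaps in the spectrum\<close>

text \<open>Let \<open>A = R - t\<close> and let \<open>R\<close> have no spectrum at distance strictly between 0 and \<open>\<eta>\<close>
  from \<open>t\<close>. For \<open>s < 0\<close> the zeros of the polynomial \<open>z\<^sup>4 - \<eta>\<^sup>2 z\<^sup>2 - s\<close> are not real, or real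
  with absolute value in \<open>(0, \<eta>)\<close>. So \<open>A\<^sup>4 - \<eta>\<^sup>2 A\<^sup>2 - s\<close> is a product of four
  operators that are bounded below, and \<open>A\<^sup>4 - \<eta>\<^sup>2 A\<^sup>2\<close> has a non-negative form.\<close>

lemma gap_bound_on_range:
  assumes R: "R \<in> B01 H" and eta: "\<eta> > 0"
    and gap: "\<And>z. z \<in> spectrum H R \<Longrightarrow> z \<noteq> complex_of_real t \<Longrightarrow> \<eta> \<le> cmod (z - complex_of_real t)"
    and x: "x \<in> carrier H"
  defines "A \<equiv> shift H R (complex_of_real t)"
  shows "\<eta> * hnorm H (A x) \<le> hnorm H (A (A x))"
proof -
  note S = B01_symmetric[OF R]
  have A: "symmetric_op H A" unfolding A_def by (rule symmetric_shift[OF S])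
  note Ab = symmetric_opD(1)[OF A] and Am = symmetric_opD(2)[OF A]
  let ?B = "\<lambda>x. A (A x)"
  have B: "symmetric_op H ?B" by (rule symmetric_square[OF A])
  note Bb = symmetric_opD(1)[OF B] and Bm = symmetric_opD(2)[OF B]
  let ?T = "\<lambda>x. ?B (?B x) \<ominus> complex_of_real (\<eta>\<^sup>2) \<odot> ?B x"
  have BB: "symmetric_op H (\<lambda>x. ?B (?B x))" using symmetric_square[OF B] .
  have T: "symmetric_op H ?T"
    unfolding symmetric_op_def
    by (intro conjI ballI HH.bops_minus[OF symmetric_opD(1)[OF BB]]
        bops_comp[OF hilbert_space_axioms hilbert_space_axioms hilbert_space_axioms Bb smult_bops])
      (simp add: ip_simps Am symmetric_opD(3)[OF A])
  have bbA: "bounded_below H (shift H A z)" if "complex_of_real t + z \<notin> spectrum H R" for z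
  proof (rule bounded_below_cong[OF bounded_below_of_not_spectrum[OF symmetric_opD(1)[OF S] that]])
    fix y assume y: "y \<in> carrier H"
    have "shift H R (complex_of_real t + z) y = shift H A z y"
      unfolding A_def shift_def
      by (rule ip_ext) (use y symmetric_opD(2)[OF S] in \<open>simp_all add: ip_simps algebra_simps\<close>)
    then show "hnorm H (shift H R (complex_of_real t + z) y) = hnorm H (shift H A z y)" by simp
  qed
  have bbB: "bounded_below H (shift H ?B w)"
    if w: "w * w - complex_of_real (\<eta>\<^sup>2) * w = complex_of_real s" and s: "s < 0" for w s
  proof -
    define r where "r = csqrt w"
    have r2: "r * r = w" unfolding r_def by (metis power2_csqrt power2_eq_square)
    have ns: "complex_of_real t + z \<notin> spectrum H R" if z: "z = r \<or> z = - r" for z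
    proof
      assume mem: "complex_of_real t + z \<in> spectrum H R"
      then have "complex_of_real t + z = complex_of_real (Re (complex_of_real t + z))"
        by (rule B01_real_spectrum(1)[OF R])
      then have zr: "z = complex_of_real (Re z)" by (simp add: complex_eq_iff)
      define q where "q = Re z"
      have wq: "w = complex_of_real (q * q)" using r2 z zr by (auto simp: q_def)
      have "complex_of_real ((q * q) * (q * q) - \<eta>\<^sup>2 * (q * q)) = complex_of_real s"
        using w unfolding wq by simp
      then have e: "(q * q) * (q * q) - \<eta>\<^sup>2 * (q * q) = s" by (simp only: of_real_eq_iff)
      then have "q \<noteq> 0" using s by auto
      then have "z \<noteq> 0" unfolding q_def by auto
      then have "\<eta> \<le> cmod z" using gap[OF mem] by simp
      then have "\<eta> \<le> \<bar>q\<bar>" unfolding q_def by (subst (asm) zr) simp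
      then have "\<eta>\<^sup>2 \<le> q * q" using eta by (metis abs_le_square_iff abs_of_pos power2_eq_square)
      then have "0 \<le> (q * q) * (q * q - \<eta>\<^sup>2)" by simp
      then show False using e s by (simp add: algebra_simps)
    qed
    have "bounded_below H (\<lambda>x. shift H A r (shift H A (- r) x))"
      by (rule bounded_below_comp[OF bbA[OF ns[of r]] bbA[OF ns[of "- r"]]]) (use Ab in simp_all)
    then show ?thesis
    proof (rule bounded_below_cong)
      fix y assume y: "y \<in> carrier H"
      have "shift H A r (shift H A (- r) y) = shift H ?B w y"
        unfolding shift_shift[OF Ab y] unfolding shift_def
        by (rule ip_ext) (use y Am r2 in \<open>simp_all add: ip_simps algebra_simps\<close>)
      then show "hnorm H (shift H A r (shift H A (- r) y)) = hnorm H (shift H ?B w y)" by simp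
    qed
  qed
  have "0 \<le> Re (ip H x (?T x))"
  proof (rule nonneg_form_of_bounded_below[OF T _ x])
    fix s :: real assume s: "s < 0"
    \<comment> \<open>The zeros \<open>w1\<close> and \<open>w2\<close> of \<open>w\<^sup>2 - \<eta>\<^sup>2 w - s\<close> may be complex.\<close>
    define d where "d = csqrt (complex_of_real (\<eta>\<^sup>2 * \<eta>\<^sup>2 + 4 * s))"
    have d2: "d * d = complex_of_real (\<eta>\<^sup>2 * \<eta>\<^sup>2 + 4 * s)"
      unfolding d_def by (metis power2_csqrt power2_eq_square)
    define w1 where "w1 = (complex_of_real (\<eta>\<^sup>2) + d) / 2"
    define w2 where "w2 = (complex_of_real (\<eta>\<^sup>2) - d) / 2"
    have sum: "w1 + w2 = complex_of_real (\<eta>\<^sup>2)" by (simp add: w1_def w2_def field_simps)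
    have "w1 * w2 = (complex_of_real (\<eta>\<^sup>2 * \<eta>\<^sup>2) - d * d) / 4"
      by (simp add: w1_def w2_def field_simps)
    then have prod: "w1 * w2 = - complex_of_real s" unfolding d2 by simp
    have q: "w * w - complex_of_real (\<eta>\<^sup>2) * w = complex_of_real s" if "w = w1 \<or> w = w2" for w
    proof -
      have "w * w - (w1 + w2) * w = - (w1 * w2)" using that by (auto simp: algebra_simps)
      then show ?thesis unfolding sum prod by simp
    qed
    have "bounded_below H (\<lambda>x. shift H ?B w1 (shift H ?B w2 x))"
      by (rule bounded_below_comp[OF bbB[OF q s] bbB[OF q s]]) (use Bb in simp_all)
    then show "bounded_below H (shift H ?T (complex_of_real s))"
    proof (rule bounded_below_cong)
      fix y assume y: "y \<in> carrier H"
      have "shift H ?B w1 (shift H ?B w2 y) = shift H ?T (complex_of_real s) y"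
        unfolding shift_shift[OF Bb y] sum prod unfolding shift_def
        by (rule ip_ext) (use y Am in \<open>simp_all add: ip_simps algebra_simps\<close>)
      then show "hnorm H (shift H ?B w1 (shift H ?B w2 y)) = hnorm H (shift H ?T (complex_of_real s) y)" by simp
    qed
  qed
  moreover have "ip H x (?T x) = ip H (?B x) (?B x) - complex_of_real (\<eta>\<^sup>2) * ip H (A x) (A x)"
    using x Am by (simp add: ip_simps symmetric_opD(3)[OF A])
  then have "Re (ip H x (?T x)) = (hnorm H (?B x))\<^sup>2 - \<eta>\<^sup>2 * (hnorm H (A x))\<^sup>2"
    using x Am by (simp add: ip_self flip: of_real_power of_real_mult)
  ultimately have "(\<eta> * hnorm H (A x))\<^sup>2 \<le> (hnorm H (?B x))\<^sup>2" by (simp add: power_mult_distrib)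
  then show ?thesis by (rule power2_le_imp_le) (use x Am in simp)
qed

text \<open>The closure of the range of \<open>A\<close> is the orthogonal complement of the kernel, so that the
  bound extends to this complement.\<close>

lemma bound_on_kernel_complement:
  assumes A: "symmetric_op H A" and eta: "\<eta> > 0"
    and rb: "\<And>x. x \<in> carrier H \<Longrightarrow> \<eta> * hnorm H (A x) \<le> hnorm H (A (A x))"
    and y: "y \<in> carrier H" "\<And>k. k \<in> carrier H \<Longrightarrow> A k = \<zero> \<Longrightarrow> ip H k y = 0"
  shows "\<eta> * hnorm H y \<le> hnorm H (A y)"
proof -
  note Ab = symmetric_opD(1)[OF A] and Am = symmetric_opD(2)[OF A]
  obtain C where C: "C > 0" "\<And>x. x \<in> carrier H \<Longrightarrow> hnorm H (A x) \<le> C * hnorm H x"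
    using HH.bops_bound[OF Ab] by blast
  define M where "M = {w \<in> carrier H. \<forall>e>0. \<exists>x\<in>carrier H. hnorm H (A x \<ominus> w) < e}"
  have range: "A x \<in> M" if "x \<in> carrier H" for x
  proof -
    have "hnorm H (A x \<ominus> A x) < e" if "e > 0" for e using that Am[OF \<open>x \<in> carrier H\<close>] by simp
    then show ?thesis unfolding M_def using that Am by blast
  qed
  have "\<exists>z\<in>M. \<forall>m\<in>M. ip H m (y \<ominus> z) = 0"
  proof (rule orthogonal_projection)
    show "M \<subseteq> carrier H" by (auto simp: M_def)
    show "M \<noteq> {}" using range[OF M.zero_closed] by blast
    show "a \<oplus> b \<in> M" if ab: "a \<in> M" "b \<in> M" for a b
    proof -
      have c: "a \<in> carrier H" "b \<in> carrier H" using ab by (auto simp: M_def)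
      have "\<exists>x\<in>carrier H. hnorm H (A x \<ominus> (a \<oplus> b)) < e" if e: "e > 0" for e
      proof -
        obtain u where u: "u \<in> carrier H" "hnorm H (A u \<ominus> a) < e / 2"
          using ab(1) half_gt_zero[OF e] unfolding M_def by blast
        obtain v where v: "v \<in> carrier H" "hnorm H (A v \<ominus> b) < e / 2"
          using ab(2) half_gt_zero[OF e] unfolding M_def by blast
        have "A (u \<oplus> v) \<ominus> (a \<oplus> b) = (A u \<ominus> a) \<oplus> (A v \<ominus> b)"
          by (rule ip_ext) (use u v c Am in \<open>simp_all add: bops_add[OF Ab] ip_simps\<close>)
        then have "hnorm H (A (u \<oplus> v) \<ominus> (a \<oplus> b)) < e"
          using hnorm_triangle[of "A u \<ominus> a" "A v \<ominus> b"] u v c Am by simp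
        then show ?thesis using u v by blast
      qed
      then show ?thesis using c by (simp add: M_def)
    qed
    show "k \<odot> a \<in> M" if a: "a \<in> M" for k a
    proof -
      have c: "a \<in> carrier H" using a by (auto simp: M_def)
      have "\<exists>x\<in>carrier H. hnorm H (A x \<ominus> k \<odot> a) < e" if e: "e > 0" for e
      proof -
        have "e / (cmod k + 1) > 0" using e by (simp add: add_nonneg_pos)
        then obtain u where u: "u \<in> carrier H" "hnorm H (A u \<ominus> a) < e / (cmod k + 1)"
          using a unfolding M_def by blast
        have "A (k \<odot> u) \<ominus> k \<odot> a = k \<odot> (A u \<ominus> a)"
          by (rule ip_ext) (use u c Am in \<open>simp_all add: bops_smult[OF Ab] ip_simps algebra_simps\<close>)
        then have "hnorm H (A (k \<odot> u) \<ominus> k \<odot> a) \<le> (cmod k + 1) * hnorm H (A u \<ominus> a)"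
          using u c Am by (simp add: hnorm_smult mult_right_mono)
        also have "\<dots> < e"
          using u(2) pos_less_divide_eq[of "cmod k + 1"] by (simp add: add_nonneg_pos mult.commute)
        finally show ?thesis using u by (intro bexI[of _ "k \<odot> u"]) auto
      qed
      then show ?thesis using c by (simp add: M_def)
    qed
    fix s l
    assume s: "\<And>n. s n \<in> M" and l: "l \<in> carrier H" and lim: "(\<lambda>n. hnorm H (s n \<ominus> l)) \<longlonglongrightarrow> 0"
    have "\<exists>x\<in>carrier H. hnorm H (A x \<ominus> l) < e" if e: "e > 0" for e
    proof -
      have "\<forall>\<^sub>F n in sequentially. hnorm H (s n \<ominus> l) < e / 2"
        using lim e by (intro order_tendstoD(2)) auto
      then obtain n where n: "hnorm H (s n \<ominus> l) < e / 2"
        using eventually_happens' sequentially_bot by blast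
      obtain x where x: "x \<in> carrier H" "hnorm H (A x \<ominus> s n) < e / 2"
        using s[of n] half_gt_zero[OF e] unfolding M_def by blast
      have "s n \<in> carrier H" using s[of n] by (simp add: M_def)
      then have "hnorm H (A x \<ominus> l) < e" using hnorm_triangle_via[of "A x" "s n" l] n x l Am by simp
      then show ?thesis using x by blast
    qed
    then show "l \<in> M" using l by (simp add: M_def)
  qed (rule y(1))
  then obtain z where z: "z \<in> M" "\<And>m. m \<in> M \<Longrightarrow> ip H m (y \<ominus> z) = 0" by blast
  have zc: "z \<in> carrier H" using z by (simp add: M_def)
  let ?d = "y \<ominus> z"
  have d: "?d \<in> carrier H" using y zc by simp
  have Ad: "A ?d = \<zero>"
  proof (rule ip_ext)
    fix w assume w: "w \<in> carrier H"
    show "ip H w (A ?d) = ip H w \<zero>"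
      using z(2)[OF range[OF w]] symmetric_opD(3)[OF A w d] w by simp
  qed (use d Am in auto)
  have "ip H ?d ?d = 0"
    using ip_diff_right[OF d y(1) zc] y(2)[OF d Ad] ip_cnj[OF zc d] z(2)[OF z(1)] by simp
  then have "y = z" using d ip_self[OF d] hnorm_eq_0_iff[OF d] y zc by simp
  then have yM: "y \<in> M" using z by simp
  show ?thesis
  proof (rule field_le_epsilon)
    fix e :: real assume e: "e > 0"
    define e' where "e' = e / (\<eta> + C)"
    have e': "e' > 0" "(\<eta> + C) * e' = e" using e eta C by (simp_all add: e'_def)
    obtain x where x: "x \<in> carrier H" "hnorm H (A x \<ominus> y) < e'" using yM e' unfolding M_def by blast
    have 1: "hnorm H y \<le> e' + hnorm H (A x)"
      using hnorm_le_diff_add[of y "A x"] hnorm_minus_commute[of y "A x"] x y Am by simp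
    have "hnorm H (A (A x)) \<le> hnorm H (A (A x \<ominus> y)) + hnorm H (A y)"
      using hnorm_le_diff_add[of "A (A x)" "A y"] x y Am by (simp add: HH.bops_diff[OF Ab])
    also have "\<dots> \<le> C * hnorm H (A x \<ominus> y) + hnorm H (A y)" using C(2)[of "A x \<ominus> y"] x y Am by simp
    also have "\<dots> \<le> C * e' + hnorm H (A y)" using x C(1) by simp
    finally have 2: "\<eta> * hnorm H (A x) \<le> C * e' + hnorm H (A y)" using rb[OF x(1)] by linarith
    have "\<eta> * hnorm H y \<le> \<eta> * (e' + hnorm H (A x))" using 1 eta by simp
    also have "\<dots> \<le> \<eta> * e' + (C * e' + hnorm H (A y))" using 2 by (simp add: distrib_left)
    also have "\<dots> = hnorm H (A y) + e" using e'(2) by (simp add: algebra_simps)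
    finally show "\<eta> * hnorm H y \<le> hnorm H (A y) + e" .
  qed
qed

end

section \<open>Orthonormal families\<close>

primrec lin_comb :: "'a hspace \<Rightarrow> (nat \<Rightarrow> complex) \<Rightarrow> (nat \<Rightarrow> 'a) \<Rightarrow> nat \<Rightarrow> 'a" where
  "lin_comb H c f 0 = \<zero>\<^bsub>H\<^esub>"
| "lin_comb H c f (Suc n) = lin_comb H c f n \<oplus>\<^bsub>H\<^esub> c n \<odot>\<^bsub>H\<^esub> f n"

definition orthonormal :: "'a hspace \<Rightarrow> (nat \<Rightarrow> 'a) \<Rightarrow> nat \<Rightarrow> bool" where
  "orthonormal H u n \<longleftrightarrow> (\<forall>i<n. u i \<in> carrier H) \<and>
     (\<forall>i<n. \<forall>j<n. ip H (u i) (u j) = (if i = j then 1 else 0))"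

definition orth_proj :: "'a hspace \<Rightarrow> (nat \<Rightarrow> 'a) \<Rightarrow> nat \<Rightarrow> 'a \<Rightarrow> 'a" where
  "orth_proj H u n x = lin_comb H (\<lambda>k. ip H (u k) x) u n"

definition lin_subspace :: "'a hspace \<Rightarrow> 'a set \<Rightarrow> bool" where
  "lin_subspace H E \<longleftrightarrow> E \<subseteq> carrier H \<and> \<zero>\<^bsub>H\<^esub> \<in> E \<and> (\<forall>x\<in>E. \<forall>y\<in>E. x \<oplus>\<^bsub>H\<^esub> y \<in> E) \<and>
     (\<forall>c. \<forall>x\<in>E. c \<odot>\<^bsub>H\<^esub> x \<in> E)"

lemma lin_comb_cong:
  "(\<And>i. i < n \<Longrightarrow> c i = d i) \<Longrightarrow> (\<And>i. i < n \<Longrightarrow> f i = g i) \<Longrightarrow> lin_comb H c f n = lin_comb H d g n"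
  by (induction n) simp_all

context hilbert_space
begin

lemma lin_comb_mem: "(\<And>i. i < n \<Longrightarrow> f i \<in> carrier H) \<Longrightarrow> lin_comb H c f n \<in> carrier H"
  by (induction n) simp_all

lemma ip_lin_comb_right: "(\<And>i. i < n \<Longrightarrow> f i \<in> carrier H) \<Longrightarrow> z \<in> carrier H \<Longrightarrow>
    ip H z (lin_comb H c f n) = (\<Sum>i<n. c i * ip H z (f i))"
  by (induction n) (simp_all add: lin_comb_mem ip_simps)

lemma ip_lin_comb_left: "(\<And>i. i < n \<Longrightarrow> f i \<in> carrier H) \<Longrightarrow> z \<in> carrier H \<Longrightarrow>
    ip H (lin_comb H c f n) z = (\<Sum>i<n. cnj (c i) * ip H (f i) z)"
  by (induction n) (simp_all add: lin_comb_mem ip_simps)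

lemma lin_comb_in_subspace:
  "lin_subspace H E \<Longrightarrow> (\<And>i. i < n \<Longrightarrow> f i \<in> E) \<Longrightarrow> lin_comb H c f n \<in> E"
  by (induction n) (simp_all add: lin_subspace_def)

lemma orthonormalD:
  assumes "orthonormal H u n"
  shows "i < n \<Longrightarrow> u i \<in> carrier H"
    "i < n \<Longrightarrow> j < n \<Longrightarrow> ip H (u i) (u j) = (if i = j then 1 else 0)"
    "i < n \<Longrightarrow> hnorm H (u i) = 1"
  using assms by (simp_all add: orthonormal_def hnorm_def)

lemma orthonormal_ip_lin_comb:
  assumes "orthonormal H u n" "i < n"
  shows "ip H (u i) (lin_comb H c u n) = c i"
proof -
  have "ip H (u i) (lin_comb H c u n) = (\<Sum>j<n. c j * ip H (u i) (u j))"
    by (rule ip_lin_comb_right) (use assms orthonormalD in auto)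
  also have "\<dots> = (\<Sum>j<n. if i = j then c j else 0)"
    by (rule sum.cong) (use assms orthonormalD(2)[OF assms(1)] in auto)
  also have "\<dots> = c i" using assms(2) by simp
  finally show ?thesis .
qed

lemma orthonormal_hnorm_lin_comb:
  assumes "orthonormal H u n"
  shows "(hnorm H (lin_comb H c u n))\<^sup>2 = (\<Sum>i<n. (cmod (c i))\<^sup>2)"
proof -
  have m: "lin_comb H c u n \<in> carrier H" by (rule lin_comb_mem) (use assms orthonormalD in auto)
  have "ip H (lin_comb H c u n) (lin_comb H c u n) = (\<Sum>i<n. cnj (c i) * ip H (u i) (lin_comb H c u n))"
    by (rule ip_lin_comb_left[OF _ m]) (use assms orthonormalD in auto)
  also have "\<dots> = (\<Sum>i<n. complex_of_real ((cmod (c i))\<^sup>2))"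
    by (rule sum.cong) (simp_all add: orthonormal_ip_lin_comb[OF assms] complex_norm_square mult.commute del: of_real_power)
  finally have "complex_of_real ((hnorm H (lin_comb H c u n))\<^sup>2) = complex_of_real (\<Sum>i<n. (cmod (c i))\<^sup>2)"
    unfolding ip_self[OF m] of_real_sum .
  then show ?thesis by (simp only: of_real_eq_iff)
qed

lemma orth_proj_mem: "orthonormal H u n \<Longrightarrow> orth_proj H u n x \<in> carrier H"
  unfolding orth_proj_def by (rule lin_comb_mem) (rule orthonormalD)

lemma orth_proj_orthogonal:
  assumes "orthonormal H u n" "x \<in> carrier H" "i < n"
  shows "ip H (u i) (x \<ominus> orth_proj H u n x) = 0"
  using assms orth_proj_mem[OF assms(1)] orthonormal_ip_lin_comb[OF assms(1,3), of "\<lambda>k. ip H (u k) x"]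
    orthonormalD(1)[OF assms(1,3)] by (simp add: ip_diff_right orth_proj_def)

lemma orth_proj_pythagoras:
  assumes u: "orthonormal H u n" and x: "x \<in> carrier H"
  shows "(hnorm H x)\<^sup>2 = (hnorm H (x \<ominus> orth_proj H u n x))\<^sup>2 + (\<Sum>i<n. (cmod (ip H (u i) x))\<^sup>2)"
proof -
  let ?p = "orth_proj H u n x" and ?y = "x \<ominus> orth_proj H u n x"
  have p: "?p \<in> carrier H" by (rule orth_proj_mem[OF u])
  have y: "?y \<in> carrier H" using p x by simp
  have "x = ?y \<oplus> ?p" by (rule ip_ext) (use x p in \<open>simp_all add: ip_simps\<close>)
  then have "(hnorm H x)\<^sup>2 = (hnorm H ?y)\<^sup>2 + (hnorm H ?p)\<^sup>2 + 2 * Re (ip H ?y ?p)"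
    using hnorm_sq_add[OF y p] by simp
  moreover have "ip H ?p ?y = (\<Sum>i<n. cnj (ip H (u i) x) * ip H (u i) ?y)"
    unfolding orth_proj_def[of H u n x] by (rule ip_lin_comb_left) (use orthonormalD[OF u] y in \<open>auto simp: orth_proj_def\<close>)
  then have "ip H ?p ?y = 0" using orth_proj_orthogonal[OF u x] by simp
  then have "ip H ?y ?p = 0" using ip_cnj[OF p y] by simp
  moreover have "(hnorm H ?p)\<^sup>2 = (\<Sum>i<n. (cmod (ip H (u i) x))\<^sup>2)"
    unfolding orth_proj_def by (rule orthonormal_hnorm_lin_comb[OF u])
  ultimately show ?thesis by simp
qed

lemma bessel: "orthonormal H u n \<Longrightarrow> x \<in> carrier H \<Longrightarrow> (\<Sum>i<n. (cmod (ip H (u i) x))\<^sup>2) \<le> (hnorm H x)\<^sup>2"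
  using orth_proj_pythagoras[of u n x] by simp

lemma orthonormal_extend:
  assumes u: "orthonormal H u n" and y: "y \<in> carrier H" "y \<noteq> \<zero>" "\<And>i. i < n \<Longrightarrow> ip H (u i) y = 0"
  shows "orthonormal H (u(n := complex_of_real (1 / hnorm H y) \<odot> y)) (Suc n)"
proof -
  let ?e = "complex_of_real (1 / hnorm H y) \<odot> y"
  have p: "hnorm H y > 0" using hnorm_pos y by blast
  have e: "?e \<in> carrier H" "hnorm H ?e = 1" using y p by (simp_all add: hnorm_smult norm_divide)
  then have ee: "ip H ?e ?e = 1" using ip_self[OF e(1)] by simp
  have ue: "ip H (u i) ?e = 0" if "i < n" for i
    using ip_smult_right[OF orthonormalD(1)[OF u that] y(1)] y(3)[OF that] by simp
  have eu: "ip H ?e (u i) = 0" if "i < n" for i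
    using ip_cnj[OF orthonormalD(1)[OF u that] e(1)] ue[OF that] by simp
  show ?thesis
    unfolding orthonormal_def
  proof (intro conjI allI impI)
    show "(u(n := ?e)) i \<in> carrier H" if "i < Suc n" for i
      using that e orthonormalD(1)[OF u] by (cases "i = n") auto
    show "ip H ((u(n := ?e)) i) ((u(n := ?e)) j) = (if i = j then 1 else 0)"
      if "i < Suc n" "j < Suc n" for i j
    proof -
      consider "i = n" "j = n" | "i < n" "j = n" | "i = n" "j < n" | "i < n" "j < n"
        using \<open>i < Suc n\<close> \<open>j < Suc n\<close> by linarith
      then show ?thesis
        by cases (simp_all only: fun_upd_apply, use ee ue eu orthonormalD(2)[OF u] in auto)
    qed
  qed
qed

lemma lin_subspace_diff:
  assumes "lin_subspace H E" "x \<in> E" "y \<in> E" shows "x \<ominus> y \<in> E"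
proof -
  have "x \<in> carrier H" "y \<in> carrier H" using assms by (auto simp: lin_subspace_def)
  then show ?thesis using assms unfolding minus_as_add[OF \<open>x \<in> carrier H\<close> \<open>y \<in> carrier H\<close>]
    by (auto simp: lin_subspace_def)
qed

text \<open>As long as an orthonormal family does not expand every vector of \<open>E\<close>, the normalized residual of
  such a vector extends it. This reduces statements on dimensions to orthonormal families.\<close>

lemma orthonormal_family_or_basis:
  assumes E: "lin_subspace H E"
  shows "(\<exists>u. orthonormal H u n \<and> (\<forall>i<n. u i \<in> E)) \<or>
    (\<exists>m<n. \<exists>u. orthonormal H u m \<and> (\<forall>i<m. u i \<in> E) \<and> (\<forall>x\<in>E. x = orth_proj H u m x))"
proof (induction n)
  case 0
  then show ?case by (auto simp: orthonormal_def)
next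
  case (Suc n)
  show ?case
  proof (cases "\<exists>m<n. \<exists>u. orthonormal H u m \<and> (\<forall>i<m. u i \<in> E) \<and> (\<forall>x\<in>E. x = orth_proj H u m x)")
    case True
    then show ?thesis using less_SucI by blast
  next
    case False
    then obtain u where u: "orthonormal H u n" "\<forall>i<n. u i \<in> E" using Suc by blast
    show ?thesis
    proof (cases "\<forall>x\<in>E. x = orth_proj H u n x")
      case True
      then show ?thesis using u lessI by blast
    next
      case False
      then obtain x where x: "x \<in> E" "x \<noteq> orth_proj H u n x" by blast
      let ?y = "x \<ominus> orth_proj H u n x"
      have xc: "x \<in> carrier H" using x E by (auto simp: lin_subspace_def)
      have p: "orth_proj H u n x \<in> E" unfolding orth_proj_def by (rule lin_comb_in_subspace[OF E]) (use u in blast)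
      have y: "?y \<in> E" by (rule lin_subspace_diff[OF E x(1) p])
      have yc: "?y \<in> carrier H" "?y \<noteq> \<zero>" using xc x orth_proj_mem[OF u(1)] by simp_all
      have o: "orthonormal H (u(n := complex_of_real (1 / hnorm H ?y) \<odot> ?y)) (Suc n)"
        by (rule orthonormal_extend[OF u(1) yc orth_proj_orthogonal[OF u(1) xc]])
      have "\<forall>i<Suc n. (u(n := complex_of_real (1 / hnorm H ?y) \<odot> ?y)) i \<in> E"
        using u(2) y E by (auto simp: lin_subspace_def less_Suc_eq)
      then show ?thesis using o by blast
    qed
  qed
qed

section \<open>Dimensions\<close>

lemma lin_subspace_vectorspace:
  assumes E: "lin_subspace H E"
  shows "vectorspace (class_ring :: complex ring) (H\<lparr>carrier := E\<rparr>)"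
proof (rule subspace_is_vs)
  have vs: "vectorspace (class_ring :: complex ring) H" by unfold_locales
  have "LinearCombinations.submodule (class_ring :: complex ring) E H"
    unfolding LinearCombinations.submodule_def
    using E module_axioms by (auto simp: lin_subspace_def)
  then show "VectorSpace.subspace (class_ring :: complex ring) E H"
    using vs unfolding VectorSpace.subspace_def by simp
qed

lemma ip_finsum_subspace:
  assumes E: "lin_subspace H E" and A: "finite A" "A \<subseteq> E" and z: "z \<in> carrier H"
  shows "ip H z (LinearCombinations.module.lincomb (H\<lparr>carrier := E\<rparr>) a A) = (\<Sum>w\<in>A. a w * ip H z w)"
proof -
  let ?V = "H\<lparr>carrier := E\<rparr>"
  interpret V: vectorspace "class_ring :: complex ring" ?V by (rule lin_subspace_vectorspace[OF E])
  show ?thesis using A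
  proof (induction A rule: finite_induct)
    case empty
    show ?case using z by (simp add: V.lincomb_def)
  next
    case (insert w A)
    have w: "w \<in> E" "A \<subseteq> E" using insert by auto
    have Ec: "E \<subseteq> carrier H" using E by (simp add: lin_subspace_def)
    have m: "V.lincomb a A \<in> E"
      using V.lincomb_closed[of A a] w by simp
    have "V.lincomb a (insert w A) = a w \<odot> w \<oplus> V.lincomb a A"
      using V.lincomb_insert[of A a w] insert(1,2) w by simp
    then show ?case
      using insert w m Ec z by (simp add: ip_simps subset_iff)
  qed
qed

lemma orthonormal_lin_indpt:
  assumes E: "lin_subspace H E" and u: "orthonormal H u m" "\<forall>i<m. u i \<in> E"
  shows "\<not> LinearCombinations.module.lin_dep (class_ring :: complex ring) (H\<lparr>carrier := E\<rparr>) (u ` {..<m})"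
    "card (u ` {..<m}) = m"
proof -
  let ?V = "H\<lparr>carrier := E\<rparr>"
  interpret V: vectorspace "class_ring :: complex ring" ?V by (rule lin_subspace_vectorspace[OF E])
  have inj: "inj_on u {..<m}"
  proof (rule inj_onI)
    fix i j assume ij: "i \<in> {..<m}" "j \<in> {..<m}" "u i = u j"
    then have "ip H (u i) (u j) = 1" using orthonormalD(2)[OF u(1), of i i] by simp
    then show "i = j" using orthonormalD(2)[OF u(1), of i j] ij by (auto split: if_splits)
  qed
  then show "card (u ` {..<m}) = m" by (simp add: card_image)
  show "\<not> V.lin_dep (u ` {..<m})"
  proof
    assume "V.lin_dep (u ` {..<m})"
    then obtain A a v where A: "finite A" "A \<subseteq> u ` {..<m}" "V.lincomb a A = \<zero>" "v \<in> A" "a v \<noteq> 0"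
      unfolding V.lin_dep_def by auto
    then obtain i where i: "i < m" "v = u i" by auto
    have vc: "v \<in> carrier H" using i orthonormalD(1)[OF u(1)] by simp
    have "A \<subseteq> E" using A u by auto
    then have "0 = (\<Sum>w\<in>A. a w * ip H v w)"
      using ip_finsum_subspace[OF E A(1) _ vc, of a] A(3) vc by simp
    also have "\<dots> = (\<Sum>w\<in>A. if w = v then a v else 0)"
    proof (rule sum.cong[OF refl])
      fix w assume "w \<in> A"
      then obtain j where j: "j < m" "w = u j" using A by auto
      have "w = v \<longleftrightarrow> i = j" using inj i j by (auto simp: inj_on_def)
      then show "a w * ip H v w = (if w = v then a v else 0)"
        using orthonormalD(2)[OF u(1) i(1) j(1)] i j by simp
    qed
    also have "\<dots> = a v" using A by simp
    finally show False using A by simp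
  qed
qed

lemma dim_orthonormal_basis:
  assumes E: "lin_subspace H E" and u: "orthonormal H u m" "\<forall>i<m. u i \<in> E"
    and span: "\<forall>x\<in>E. x = orth_proj H u m x"
  shows "vectorspace.fin_dim (class_ring :: complex ring) (H\<lparr>carrier := E\<rparr>)"
    "vectorspace.dim (class_ring :: complex ring) (H\<lparr>carrier := E\<rparr>) = m"
proof -
  let ?V = "H\<lparr>carrier := E\<rparr>" and ?S = "u ` {..<m}"
  interpret V: vectorspace "class_ring :: complex ring" ?V by (rule lin_subspace_vectorspace[OF E])
  have S: "?S \<subseteq> carrier ?V" using u by auto
  have "LinearCombinations.submodule class_ring (V.span ?S) ?V" by (rule V.span_is_submodule[OF S])
  then have sub: "\<zero> \<in> V.span ?S" "\<And>x y. x \<in> V.span ?S \<Longrightarrow> y \<in> V.span ?S \<Longrightarrow> x \<oplus> y \<in> V.span ?S"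
      "\<And>c x. x \<in> V.span ?S \<Longrightarrow> c \<odot> x \<in> V.span ?S"
    unfolding LinearCombinations.submodule_def by auto
  have gen: "?S \<subseteq> V.span ?S" by (rule V.in_own_span[OF S])
  have lcs: "n \<le> m \<Longrightarrow> lin_comb H c u n \<in> V.span ?S" for c n
  proof (induction n)
    case (Suc n)
    then have "u n \<in> V.span ?S" using gen by auto
    then show ?case using Suc sub by simp
  qed (use sub in simp)
  have "V.span ?S = carrier ?V"
  proof
    show "V.span ?S \<subseteq> carrier ?V" by (rule V.span_is_subset2[OF S])
    show "carrier ?V \<subseteq> V.span ?S"
    proof
      fix x assume "x \<in> carrier ?V"
      then have "x = lin_comb H (\<lambda>k. ip H (u k) x) u m" using span by (simp add: orth_proj_def)
      then show "x \<in> V.span ?S" using lcs[of m "\<lambda>k. ip H (u k) x"] by simp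
    qed
  qed
  then have b: "V.basis ?S"
    unfolding V.basis_def using orthonormal_lin_indpt(1)[OF E u] S by simp
  then show "V.fin_dim" unfolding V.fin_dim_def V.basis_def by (intro exI[of _ ?S]) simp
  show "V.dim = m" using V.dim_basis[OF _ b] orthonormal_lin_indpt(2)[OF E u] by simp
qed

lemma orthonormal_le_dim:
  assumes E: "lin_subspace H E" and u: "orthonormal H u m" "\<forall>i<m. u i \<in> E"
    and fd: "vectorspace.fin_dim (class_ring :: complex ring) (H\<lparr>carrier := E\<rparr>)"
  shows "m \<le> vectorspace.dim (class_ring :: complex ring) (H\<lparr>carrier := E\<rparr>)"
proof -
  interpret V: vectorspace "class_ring :: complex ring" "H\<lparr>carrier := E\<rparr>"
    by (rule lin_subspace_vectorspace[OF E])
  have "u ` {..<m} \<subseteq> carrier (H\<lparr>carrier := E\<rparr>)" using u by auto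
  then show ?thesis
    using V.li_le_dim(2)[OF fd _ orthonormal_lin_indpt(1)[OF E u]] orthonormal_lin_indpt(2)[OF E u] by simp
qed

lemma fin_dim_orthonormal_basis:
  assumes E: "lin_subspace H E"
    and fd: "vectorspace.fin_dim (class_ring :: complex ring) (H\<lparr>carrier := E\<rparr>)"
    and m: "vectorspace.dim (class_ring :: complex ring) (H\<lparr>carrier := E\<rparr>) = m"
  shows "\<exists>u. orthonormal H u m \<and> (\<forall>i<m. u i \<in> E) \<and> (\<forall>x\<in>E. x = orth_proj H u m x)"
proof -
  have "\<not> (\<exists>u. orthonormal H u (Suc m) \<and> (\<forall>i<Suc m. u i \<in> E))"
    using orthonormal_le_dim[OF E _ _ fd, of _ "Suc m"] m by auto
  then obtain m' u where u: "orthonormal H u m'" "\<forall>i<m'. u i \<in> E" "\<forall>x\<in>E. x = orth_proj H u m' x"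
    using orthonormal_family_or_basis[OF E, of "Suc m"] by blast
  moreover have "m' = m" using dim_orthonormal_basis(2)[OF E u] m by simp
  ultimately show ?thesis by blast
qed

lemma not_fin_dim_orthonormal:
  assumes E: "lin_subspace H E"
    and fd: "\<not> vectorspace.fin_dim (class_ring :: complex ring) (H\<lparr>carrier := E\<rparr>)"
  shows "\<exists>u. orthonormal H u n \<and> (\<forall>i<n. u i \<in> E)"
  using orthonormal_family_or_basis[OF E, of n] dim_orthonormal_basis(1)[OF E] fd by blast

lemma lin_subspace_carrier: "lin_subspace H (carrier H)"
  by (simp add: lin_subspace_def)

lemma orthogonal_vector_exists:
  assumes inf: "\<not> vectorspace.fin_dim (class_ring :: complex ring) H" and u: "orthonormal H u n"
  shows "\<exists>y\<in>carrier H. y \<noteq> \<zero> \<and> (\<forall>i<n. ip H (u i) y = 0)"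
proof -
  have Hc: "H\<lparr>carrier := carrier H\<rparr> = H" by simp
  have "\<not> (\<forall>x\<in>carrier H. x = orth_proj H u n x)"
  proof
    assume h: "\<forall>x\<in>carrier H. x = orth_proj H u n x"
    have "\<forall>i<n. u i \<in> carrier H" using orthonormalD(1)[OF u] by simp
    from dim_orthonormal_basis(1)[OF lin_subspace_carrier u this h] show False
      using inf unfolding Hc by simp
  qed
  then obtain x where x: "x \<in> carrier H" "x \<noteq> orth_proj H u n x" by blast
  show ?thesis
    by (rule bexI[of _ "x \<ominus> orth_proj H u n x"])
      (use x orth_proj_mem[OF u, of x] orth_proj_orthogonal[OF u x(1)] in simp_all)
qed

lemma lin_subspace_eigenspace:
  assumes T: "T \<in> bounded_ops H H"
  shows "lin_subspace H {x \<in> carrier H. T x = z \<odot> x}"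
proof -
  have "z \<odot> (x \<oplus> y) = z \<odot> x \<oplus> z \<odot> y" if "x \<in> carrier H" "y \<in> carrier H" for x y
    by (rule ip_ext) (use that in \<open>simp_all add: ip_simps algebra_simps\<close>)
  moreover have "c \<odot> (z \<odot> x) = z \<odot> (c \<odot> x)" if "x \<in> carrier H" for x c
    by (rule ip_ext) (use that in \<open>simp_all add: ip_simps\<close>)
  ultimately show ?thesis
    using HH.bops_zero[OF T] by (auto simp: lin_subspace_def bops_add[OF T] bops_smult[OF T])
qed

end

section \<open>Orthonormal bases\<close>

definition onb :: "'a hspace \<Rightarrow> (nat \<Rightarrow> 'a) \<Rightarrow> bool" where
  "onb H e \<longleftrightarrow> (\<forall>n. e n \<in> carrier H) \<and> (\<forall>i j. ip H (e i) (e j) = (if i = j then 1 else 0)) \<and>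
     (\<forall>x\<in>carrier H. (\<forall>n. ip H (e n) x = 0) \<longrightarrow> x = \<zero>\<^bsub>H\<^esub>)"

text \<open>Dependent choice of a sequence whose \<open>n\<close>th condition involves its first \<open>n + 1\<close> members only.\<close>

lemma recursive_choice:
  assumes step: "\<And>n u. (\<And>k. k < n \<Longrightarrow> Q k u) \<Longrightarrow> \<exists>x. Q n (u(n := x))"
    and local: "\<And>n u v. (\<And>k. k \<le> n \<Longrightarrow> u k = v k) \<Longrightarrow> Q n u \<Longrightarrow> Q n v"
  shows "\<exists>u::nat \<Rightarrow> 'b. \<forall>n. Q n u"
proof -
  have "\<exists>U::nat \<Rightarrow> nat \<Rightarrow> 'b. \<forall>n. (\<forall>k<n. Q k (U n)) \<and> (\<forall>k<n. U (Suc n) k = U n k)"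
  proof (rule dependent_nat_choice)
    show "\<exists>u::nat \<Rightarrow> 'b. \<forall>k<0. Q k u" by simp
    fix u :: "nat \<Rightarrow> 'b" and n assume u: "\<forall>k<n. Q k u"
    then obtain x where x: "Q n (u(n := x))" using step[of n u] by blast
    have "Q k (u(n := x))" if "k < Suc n" for k
    proof (cases "k = n")
      case False
      then have "k < n" using that by simp
      then show ?thesis using u local[of k u "u(n := x)"] by auto
    qed (use x in simp)
    then show "\<exists>v. (\<forall>k<Suc n. Q k v) \<and> (\<forall>k<n. v k = u k)" by (intro exI[of _ "u(n := x)"]) auto
  qed
  then obtain U :: "nat \<Rightarrow> nat \<Rightarrow> 'b"
    where U0: "\<forall>n. (\<forall>k<n. Q k (U n)) \<and> (\<forall>k<n. U (Suc n) k = U n k)" ..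
  have U: "Q k (U n)" "U (Suc n) k = U n k" if "k < n" for n k
    using U0 that by simp_all
  have stable: "U (n + d) k = U n k" if "k < n" for n d k
    by (induction d) (use that U(2) in auto)
  have "Q n (\<lambda>k. U (Suc k) k)" for n
  proof (rule local)
    show "Q n (U (Suc n))" by (rule U(1)) simp
    show "U (Suc n) k = U (Suc k) k" if "k \<le> n" for k
      using stable[of k "Suc k" "n - k"] that by simp
  qed
  then show ?thesis by blast
qed

context hilbert_space
begin

lemma onbD:
  assumes "onb H e"
  shows "e n \<in> carrier H" "ip H (e i) (e j) = (if i = j then 1 else 0)" "orthonormal H e n"
    "x \<in> carrier H \<Longrightarrow> (\<And>n. ip H (e n) x = 0) \<Longrightarrow> x = \<zero>"
  using assms by (auto simp: onb_def orthonormal_def)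

lemma onb_ext:
  assumes e: "onb H e" and "x \<in> carrier H" "y \<in> carrier H" "\<And>n. ip H (e n) x = ip H (e n) y"
  shows "x = y"
proof -
  have "x \<ominus> y = \<zero>" by (rule onbD(4)[OF e]) (use assms onbD(1)[OF e] in \<open>simp_all add: ip_simps\<close>)
  then show ?thesis using assms by simp
qed

text \<open>In step \<open>n\<close> of the Gram--Schmidt process the residual of the \<open>n\<close>th vector of a dense
  sequence is normalized; if it vanishes, any vector orthogonal to the previous ones is taken.\<close>

lemma onb_exists:
  assumes sep: "separable_space (htopology H)"
    and inf: "\<not> vectorspace.fin_dim (class_ring :: complex ring) H"
  shows "\<exists>e. onb H e"
proof -
  obtain C where C: "countable C" "C \<subseteq> carrier H" "htopology H closure_of C = carrier H"
    using sep unfolding separable_space_def htopology_def MS.topspace_mtopology by blast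
  have dense: "\<exists>c\<in>C. hnorm H (x \<ominus> c) < r" if x: "x \<in> carrier H" and r: "r > 0" for x r
  proof -
    have "x \<in> htopology H closure_of C" using C x by simp
    then obtain c where "c \<in> C" "c \<in> MS.mball x r"
      unfolding htopology_def MS.metric_closure_of using r by blast
    then show ?thesis unfolding MS.in_mball by (auto simp: hdist_def)
  qed
  have "C \<noteq> {}" using dense[of \<zero> 1] by auto
  define d where "d = from_nat_into C"
  have dC: "d n \<in> C" for n unfolding d_def by (rule from_nat_into[OF \<open>C \<noteq> {}\<close>])
  have dc: "d n \<in> carrier H" for n using dC C by blast
  have dsurj: "\<exists>n. d n = c" if "c \<in> C" for c
    unfolding d_def using from_nat_into_surj[OF C(1) that] by blast
  define Q where "Q n u \<longleftrightarrow> orthonormal H u (Suc n) \<and> d n = orth_proj H u (Suc n) (d n)" for n u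
  have "\<exists>u. \<forall>n. Q n u"
  proof (rule recursive_choice)
    fix n u v assume eq: "\<And>k. k \<le> n \<Longrightarrow> u k = v k" and q: "Q n u"
    have "lin_comb H (\<lambda>k. ip H (u k) (d n)) u (Suc n) = lin_comb H (\<lambda>k. ip H (v k) (d n)) v (Suc n)"
      by (rule lin_comb_cong) (use eq in auto)
    then show "Q n v" using q eq unfolding Q_def orthonormal_def orth_proj_def by (simp add: less_Suc_eq_le)
  next
    fix n u assume q: "\<And>k. k < n \<Longrightarrow> Q k u"
    have u: "orthonormal H u n"
    proof (cases n)
      case (Suc m)
      then have "Q m u" using q by simp
      then show ?thesis unfolding Q_def Suc by blast
    qed (simp add: orthonormal_def)
    let ?r = "d n \<ominus> orth_proj H u n (d n)"
    have r: "?r \<in> carrier H" using dc orth_proj_mem[OF u] by simp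
    have "\<exists>y\<in>carrier H. y \<noteq> \<zero> \<and> (\<forall>i<n. ip H (u i) y = 0) \<and> (?r = \<zero> \<or> y = ?r)"
    proof (cases "?r = \<zero>")
      case True
      then show ?thesis using orthogonal_vector_exists[OF inf u] by blast
    next
      case False
      then show ?thesis using r orth_proj_orthogonal[OF u dc] by blast
    qed
    then obtain y where y: "y \<in> carrier H" "y \<noteq> \<zero>" "\<And>i. i < n \<Longrightarrow> ip H (u i) y = 0" "?r = \<zero> \<or> y = ?r"
      by blast
    let ?e = "complex_of_real (1 / hnorm H y) \<odot> y"
    let ?v = "u(n := ?e)"
    have v: "orthonormal H ?v (Suc n)" by (rule orthonormal_extend[OF u y(1,2,3)])
    have ec: "?e \<in> carrier H" using y by simp
    have p: "orth_proj H ?v (Suc n) (d n) = orth_proj H u n (d n) \<oplus> ip H ?e (d n) \<odot> ?e"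
    proof -
      have "lin_comb H (\<lambda>k. ip H (?v k) (d n)) ?v n = lin_comb H (\<lambda>k. ip H (u k) (d n)) u n"
        by (rule lin_comb_cong) auto
      then show ?thesis unfolding orth_proj_def by simp
    qed
    have "d n = orth_proj H u n (d n) \<oplus> ip H ?e (d n) \<odot> ?e"
    proof -
      have ed: "ip H ?e (d n) \<odot> ?e = ?r"
      proof (cases "?r = \<zero>")
        case True
        then have dn: "d n = orth_proj H u n (d n)" using dc orth_proj_mem[OF u] by simp
        have "ip H ?e (d n) = (\<Sum>i<n. ip H (u i) (d n) * ip H ?e (u i))"
          by (subst dn, unfold orth_proj_def, rule ip_lin_comb_right[OF _ ec]) (rule orthonormalD(1)[OF u])
        also have "\<dots> = 0"
        proof (rule sum.neutral, safe)
          fix i assume i: "i < n"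
          have "ip H ?e (u i) = 0" using orthonormalD(2)[OF v, of n i] i by simp
          then show "ip H (u i) (d n) * ip H ?e (u i) = 0" by simp
        qed
        finally show ?thesis using True ec by simp
      next
        case False
        then have yr: "y = ?r" using y by blast
        have pos: "hnorm H y > 0" using hnorm_pos y by blast
        have "ip H y (orth_proj H u n (d n)) = (\<Sum>i<n. ip H (u i) (d n) * ip H y (u i))"
          unfolding orth_proj_def by (rule ip_lin_comb_right[OF _ y(1)]) (rule orthonormalD(1)[OF u])
        also have "\<dots> = 0"
        proof (rule sum.neutral, safe)
          fix i assume i: "i < n"
          have "ip H y (u i) = 0" using y(3)[OF i] ip_cnj[OF orthonormalD(1)[OF u i] y(1)] by simp
          then show "ip H (u i) (d n) * ip H y (u i) = 0" by simp
        qed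
        finally have "ip H y (d n) = ip H y y"
          using ip_diff_right[OF y(1) dc orth_proj_mem[OF u], of n "d n"] unfolding yr[symmetric] by simp
        then have "ip H ?e (d n) = complex_of_real (hnorm H y)"
          using ip_smult_left[OF y(1) dc, of "complex_of_real (1 / hnorm H y)" n] ip_self[OF y(1)] pos
          by (simp add: power2_eq_square)
        then have "ip H ?e (d n) \<odot> ?e = y"
          by (intro ip_ext) (use y pos in \<open>simp_all add: ip_simps\<close>)
        then show ?thesis using yr by simp
      qed
      show ?thesis unfolding ed
        by (rule ip_ext) (use dc orth_proj_mem[OF u] in \<open>simp_all add: ip_simps\<close>)
    qed
    then have "Q n ?v" unfolding Q_def p using v by simp
    then show "\<exists>x. Q n (u(n := x))" by blast
  qed
  then obtain e where e: "\<And>n. Q n e" by blast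
  have o: "orthonormal H e (Suc n)" for n using e by (simp add: Q_def)
  have ec: "e n \<in> carrier H" for n using orthonormalD(1)[OF o[of n]] by simp
  have eo: "ip H (e i) (e j) = (if i = j then 1 else 0)" for i j
    using orthonormalD(2)[OF o[of "max i j"], of i j] by simp
  have "x = \<zero>" if x: "x \<in> carrier H" and z: "\<And>n. ip H (e n) x = 0" for x
  proof (rule ccontr)
    assume "x \<noteq> \<zero>"
    then have pos: "hnorm H x > 0" using hnorm_pos x by blast
    obtain c where c: "c \<in> C" "hnorm H (x \<ominus> c) < hnorm H x" using dense[OF x pos] by blast
    obtain n where n: "d n = c" using dsurj[OF c(1)] by blast
    have "ip H (d n) x = (\<Sum>i<Suc n. cnj (ip H (e i) (d n)) * ip H (e i) x)"
    proof -
      have "d n = orth_proj H e (Suc n) (d n)" using e[of n] by (simp add: Q_def)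
      then have "ip H (d n) x = ip H (lin_comb H (\<lambda>k. ip H (e k) (d n)) e (Suc n)) x" by (simp only: orth_proj_def)
      also have "\<dots> = (\<Sum>i<Suc n. cnj (ip H (e i) (d n)) * ip H (e i) x)"
        by (rule ip_lin_comb_left[OF ec x])
      finally show ?thesis .
    qed
    then have "ip H c x = 0" using z n by simp
    then have "ip H (x \<ominus> c) x = complex_of_real ((hnorm H x)\<^sup>2)"
      using ip_diff_left[OF x _ x, of c] c C ip_self[OF x] by auto
    then have "(hnorm H x)\<^sup>2 = cmod (ip H (x \<ominus> c) x)" by (simp del: of_real_power)
    also have "\<dots> \<le> hnorm H (x \<ominus> c) * hnorm H x" by (rule cauchy_schwarz) (use x c C in auto)
    also have "\<dots> < hnorm H x * hnorm H x" using c pos by simp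
    finally show False by (simp add: power2_eq_square)
  qed
  then show ?thesis using ec eo unfolding onb_def by blast
qed

lemma onb_ip_lin_comb:
  assumes e: "onb H e"
  shows "ip H (e k) (lin_comb H b e l) = (if k < l then b k else 0)"
proof -
  have "ip H (e k) (lin_comb H b e l) = (\<Sum>i<l. b i * ip H (e k) (e i))"
    by (rule ip_lin_comb_right) (rule onbD(1)[OF e])+
  also have "\<dots> = (\<Sum>i<l. if i = k then b k else 0)"
    by (rule sum.cong) (auto simp: onbD(2)[OF e])
  finally show ?thesis by simp
qed

text \<open>The Riesz--Fischer theorem: square-summable coefficients belong to a vector.\<close>

lemma riesz_fischer:
  assumes e: "onb H e" and c: "summable (\<lambda>k. (cmod (c k))\<^sup>2)"
  shows "\<exists>x\<in>carrier H. (\<forall>k. ip H (e k) x = c k) \<and> (hnorm H x)\<^sup>2 = (\<Sum>k. (cmod (c k))\<^sup>2) \<and>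
    (\<lambda>n. hnorm H (lin_comb H c e n \<ominus> x)) \<longlonglongrightarrow> 0"
proof -
  let ?s = "lin_comb H c e" and ?f = "\<lambda>k. (cmod (c k))\<^sup>2"
  have sc: "?s n \<in> carrier H" for n by (rule lin_comb_mem) (rule onbD(1)[OF e])
  have dist: "(hnorm H (?s m \<ominus> ?s n))\<^sup>2 = sum ?f {n..<m}" if nm: "n \<le> m" for m n
  proof -
    let ?c = "\<lambda>k. if k < n then 0 else c k"
    have "?s m \<ominus> ?s n = lin_comb H ?c e m"
    proof (rule onb_ext[OF e])
      show "lin_comb H ?c e m \<in> carrier H" by (rule lin_comb_mem) (rule onbD(1)[OF e])
      show "?s m \<ominus> ?s n \<in> carrier H" using sc by simp
      fix k
      show "ip H (e k) (?s m \<ominus> ?s n) = ip H (e k) (lin_comb H ?c e m)"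
        unfolding ip_diff_right[OF onbD(1)[OF e] sc sc] onb_ip_lin_comb[OF e] using nm by simp
    qed
    then have "(hnorm H (?s m \<ominus> ?s n))\<^sup>2 = (\<Sum>i<m. (cmod (?c i))\<^sup>2)"
      using orthonormal_hnorm_lin_comb[OF onbD(3)[OF e], of ?c m] by simp
    also have "\<dots> = sum ?f {n..<m}"
      by (rule sum.mono_neutral_cong_right) auto
    finally show ?thesis .
  qed
  have "\<exists>l\<in>carrier H. (\<lambda>n. hnorm H (?s n \<ominus> l)) \<longlonglongrightarrow> 0"
  proof (rule cauchy_limit[OF sc])
    fix r :: real assume r: "r > 0"
    then obtain N where N: "\<And>m n. m \<ge> N \<Longrightarrow> norm (sum ?f {m..<n}) < r\<^sup>2"
      using c unfolding summable_Cauchy by (meson zero_less_power)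
    have *: "hnorm H (?s m \<ominus> ?s n) < r" if mn: "n \<ge> N" "n \<le> m" for m n
    proof -
      have "(hnorm H (?s m \<ominus> ?s n))\<^sup>2 < r\<^sup>2" using N[OF mn(1), of m] dist[OF mn(2)] by simp
      then show ?thesis using r by (simp add: power_less_imp_less_base)
    qed
    have "hnorm H (?s m \<ominus> ?s n) < r" if "m \<ge> N" "n \<ge> N" for m n
      using *[of n m] *[of m n] hnorm_minus_commute[OF sc sc, of m n] that by (cases "n \<le> m") auto
    then show "\<exists>N. \<forall>m\<ge>N. \<forall>n\<ge>N. hnorm H (?s m \<ominus> ?s n) < r" by blast
  qed
  then obtain x where x: "x \<in> carrier H" "(\<lambda>n. hnorm H (?s n \<ominus> x)) \<longlonglongrightarrow> 0" by blast
  have "ip H (e k) x = c k" for k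
  proof -
    have "(\<lambda>n. ip H (e k) (?s n)) \<longlonglongrightarrow> ip H (e k) x"
      by (rule tendsto_ip[OF sc x(1) onbD(1)[OF e] x(2)])
    moreover have "\<forall>\<^sub>F n in sequentially. ip H (e k) (?s n) = c k"
      using eventually_gt_at_top[of k]
      by eventually_elim (rule orthonormal_ip_lin_comb[OF onbD(3)[OF e]])
    then have "(\<lambda>n. ip H (e k) (?s n)) \<longlonglongrightarrow> c k" by (rule tendsto_eventually)
    ultimately show ?thesis by (rule LIMSEQ_unique)
  qed
  moreover have "(hnorm H x)\<^sup>2 = (\<Sum>k. ?f k)"
  proof (rule LIMSEQ_unique)
    show "(\<lambda>n. (hnorm H (?s n))\<^sup>2) \<longlonglongrightarrow> (hnorm H x)\<^sup>2"
      by (intro tendsto_power tendsto_hnorm[OF sc x])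
    show "(\<lambda>n. (hnorm H (?s n))\<^sup>2) \<longlonglongrightarrow> (\<Sum>k. ?f k)"
      unfolding orthonormal_hnorm_lin_comb[OF onbD(3)[OF e]] by (rule summable_LIMSEQ[OF c])
  qed
  ultimately show ?thesis using x by blast
qed

lemma onb_summable:
  assumes e: "onb H e" and x: "x \<in> carrier H"
  shows "summable (\<lambda>k. (cmod (ip H (e k) x))\<^sup>2)"
proof (rule summableI_nonneg_bounded)
  show "(\<Sum>i<n. (cmod (ip H (e i) x))\<^sup>2) \<le> (hnorm H x)\<^sup>2" for n
    by (rule bessel[OF onbD(3)[OF e] x])
qed simp

text \<open>By the theorem of Riesz and Fischer the Fourier series of \<open>x\<close> converges to a vector with
  the coordinates of \<open>x\<close>, which is \<open>x\<close> by completeness of the basis.\<close>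

lemma onb_expansion:
  assumes e: "onb H e" and x: "x \<in> carrier H"
  shows "(\<lambda>n. hnorm H (orth_proj H e n x \<ominus> x)) \<longlonglongrightarrow> 0"
    "(hnorm H x)\<^sup>2 = (\<Sum>k. (cmod (ip H (e k) x))\<^sup>2)"
proof -
  obtain y where y: "y \<in> carrier H" "\<And>k. ip H (e k) y = ip H (e k) x"
      "(hnorm H y)\<^sup>2 = (\<Sum>k. (cmod (ip H (e k) x))\<^sup>2)"
      "(\<lambda>n. hnorm H (lin_comb H (\<lambda>k. ip H (e k) x) e n \<ominus> y)) \<longlonglongrightarrow> 0"
    using riesz_fischer[OF e onb_summable[OF e x]] by blast
  have "y = x" by (rule onb_ext[OF e y(1) x y(2)])
  then show "(\<lambda>n. hnorm H (orth_proj H e n x \<ominus> x)) \<longlonglongrightarrow> 0"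
    "(hnorm H x)\<^sup>2 = (\<Sum>k. (cmod (ip H (e k) x))\<^sup>2)"
    using y by (simp_all add: orth_proj_def)
qed

lemma onb_ip_expansion:
  assumes e: "onb H e" and x: "x \<in> carrier H" and y: "y \<in> carrier H"
  shows "(\<lambda>n. \<Sum>k<n. ip H (e k) x * ip H y (e k)) \<longlonglongrightarrow> ip H y x"
proof -
  have "(\<lambda>n. ip H y (orth_proj H e n x)) \<longlonglongrightarrow> ip H y x"
    by (rule tendsto_ip[OF orth_proj_mem[OF onbD(3)[OF e]] x y onb_expansion(1)[OF e x]])
  moreover have "ip H y (orth_proj H e n x) = (\<Sum>k<n. ip H (e k) x * ip H y (e k))" for n
    unfolding orth_proj_def by (rule ip_lin_comb_right[OF onbD(1)[OF e] y])
  ultimately show ?thesis by simp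
qed

end

section \<open>Almost orthonormal families of approximate eigenvectors\<close>

text \<open>Exact orthogonality would be lost under the identification operators. Bounds on the Gram
  matrix are preserved, and they still allow to count dimensions.\<close>

definition almost_eig :: "'a hspace \<Rightarrow> ('a \<Rightarrow> 'a) \<Rightarrow> nat \<Rightarrow> complex \<Rightarrow> bool" where
  "almost_eig H R n z \<longleftrightarrow> (\<forall>e>0. \<exists>f. (\<forall>i<n. f i \<in> carrier H) \<and> (\<forall>i<n. hnorm H (shift H R z (f i)) \<le> e) \<and>
     (\<forall>i<n. \<forall>j<n. cmod (ip H (f i) (f j) - (if i = j then 1 else 0)) \<le> e))"

lemma almost_eigD:
  assumes "almost_eig H R n z" "e > 0"
  shows "\<exists>f. (\<forall>i<n. f i \<in> carrier H) \<and> (\<forall>i<n. hnorm H (shift H R z (f i)) \<le> e) \<and>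
    (\<forall>i<n. \<forall>j<n. cmod (ip H (f i) (f j) - (if i = j then 1 else 0)) \<le> e)"
  using assms by (simp add: almost_eig_def)

lemma almost_eigI:
  assumes "\<And>e. e > 0 \<Longrightarrow> \<exists>f. (\<forall>i<n. f i \<in> carrier H) \<and> (\<forall>i<n. hnorm H (shift H R z (f i)) \<le> e) \<and>
    (\<forall>i<n. \<forall>j<n. cmod (ip H (f i) (f j) - (if i = j then 1 else 0)) \<le> e)"
  shows "almost_eig H R n z"
  using assms by (simp add: almost_eig_def)

lemma almost_eig_mono:
  assumes "almost_eig H R n z" "m \<le> n"
  shows "almost_eig H R m z"
proof (rule almost_eigI)
  fix e :: real assume e: "e > 0"
  obtain f where f: "\<And>i. i < n \<Longrightarrow> f i \<in> carrier H" "\<And>i. i < n \<Longrightarrow> hnorm H (shift H R z (f i)) \<le> e"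
    "\<And>i j. i < n \<Longrightarrow> j < n \<Longrightarrow> cmod (ip H (f i) (f j) - (if i = j then 1 else 0)) \<le> e"
    using almost_eigD[OF assms(1) e] by blast
  show "\<exists>f. (\<forall>i<m. f i \<in> carrier H) \<and> (\<forall>i<m. hnorm H (shift H R z (f i)) \<le> e) \<and>
    (\<forall>i<m. \<forall>j<m. cmod (ip H (f i) (f j) - (if i = j then 1 else 0)) \<le> e)"
    by (rule exI[of _ f]) (use f assms(2) in simp)
qed

lemma (in hilbert_space) almost_unit_norm:
  assumes "x \<in> carrier H" "cmod (ip H x x - 1) \<le> t"
  shows "(hnorm H x)\<^sup>2 \<le> 1 + t" "1 - t \<le> (hnorm H x)\<^sup>2"
proof -
  have "\<bar>(hnorm H x)\<^sup>2 - 1\<bar> \<le> t"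
    using assms abs_Re_le_cmod[of "ip H x x - 1"] by (simp add: hnorm_sq)
  then show "(hnorm H x)\<^sup>2 \<le> 1 + t" "1 - t \<le> (hnorm H x)\<^sup>2" by linarith+
qed

text \<open>For \<open>z \<noteq> 0\<close>, an approximate eigenvector is close to \<open>z\<^sup>-\<^sup>1Rx\<close>, where \<open>J'J\<close> is close to the
  identity; so \<open>J\<close> almost preserves the Gram matrix.\<close>

lemma (in hilbert_pair) almost_eig_transfer:
  assumes R: "R \<in> bounded_ops H H" and S: "S \<in> bounded_ops K K"
    and q: "\<And>\<delta>. \<delta> > 0 \<Longrightarrow> \<exists>J J'. quasi_unitary \<delta> H R K S J J'"
    and z: "z \<noteq> 0" and a: "almost_eig H R n z"
  shows "almost_eig K S n z"
proof (rule almost_eigI)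
  fix e :: real assume e: "e > 0"
  \<comment> \<open>The errors of the entries of the Gram matrix will add up to \<open>c * t\<close>.\<close>
  define c where "c = 9 + 14 / cmod z"
  have c: "c > 0" unfolding c_def by (simp add: add_pos_nonneg)
  define t where "t = min 1 (min (e / 4) (e / c))"
  have t: "t > 0" "t \<le> 1" "4 * t \<le> e" "t \<le> e / c" using e c by (auto simp: t_def)
  have ct: "c * t \<le> e" using t(4) c by (simp add: field_simps)
  obtain f where f: "\<And>i. i < n \<Longrightarrow> f i \<in> carrier H" "\<And>i. i < n \<Longrightarrow> hnorm H (shift H R z (f i)) \<le> t"
    "\<And>i j. i < n \<Longrightarrow> j < n \<Longrightarrow> cmod (ip H (f i) (f j) - (if i = j then 1 else 0)) \<le> t"
    using almost_eigD[OF a t(1)] by blast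
  obtain J J' where Q: "quasi_unitary t H R K S J J'" using q[OF t(1)] by blast
  note J = quasi_unitaryD(1,2)[OF Q]
  note m = bops_mem[OF J(1)] bops_mem[OF J(2)] bops_mem[OF R] bops_mem[OF S]
  have fn: "hnorm H (f i) \<le> 2" if i: "i < n" for i
  proof -
    have "(hnorm H (f i))\<^sup>2 \<le> 1 + t" using H.almost_unit_norm(1)[OF f(1)[OF i]] f(3)[OF i i] by simp
    also have "\<dots> \<le> 2\<^sup>2" using t by simp
    finally show ?thesis by (rule power2_le_imp_le) simp
  qed
  have Jn: "hnorm K (J x) \<le> 2 * hnorm H x" if "x \<in> carrier H" for x
    using quasi_unitaryD(3)[OF Q that] mult_right_mono[of "1 + t" 2 "hnorm H x"] t that by simp
  have J'n: "hnorm H (J' x) \<le> 2 * hnorm K x" if "x \<in> carrier K" for x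
    using quasi_unitaryD(4)[OF Q that] mult_right_mono[of "1 + t" 2 "hnorm K x"] t that by simp
  have s: "hnorm K (shift K S z (J (f i))) \<le> e" if i: "i < n" for i
  proof -
    let ?x = "f i"
    have x: "?x \<in> carrier H" by (rule f(1)[OF i])
    let ?r = "shift H R z ?x" and ?d = "J (R ?x) \<ominus>\<^bsub>K\<^esub> S (J ?x)"
    have r: "?r \<in> carrier H" using R x by simp
    have "J ?r = J (R ?x) \<ominus>\<^bsub>K\<^esub> z \<odot>\<^bsub>K\<^esub> J ?x"
      unfolding shift_def using x m by (simp add: bops_diff[OF J(1)] bops_smult[OF J(1)])
    then have "shift K S z (J ?x) = J ?r \<ominus>\<^bsub>K\<^esub> ?d"
      unfolding shift_def by (intro K.ip_ext) (use x m in \<open>simp_all add: K.ip_simps\<close>)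
    then have "hnorm K (shift K S z (J ?x)) \<le> hnorm K (J ?r) + hnorm K ?d"
      using K.hnorm_diff_triangle[of "J ?r" ?d] x m r by simp
    moreover have "hnorm K (J ?r) \<le> 2 * t" using Jn[OF r] f(2)[OF i] by linarith
    moreover have "hnorm K ?d \<le> t * 2"
      using quasi_unitaryD(8)[OF Q x] mult_left_mono[OF fn[OF i], of t] t by linarith
    ultimately show ?thesis using t by linarith
  qed
  have d: "hnorm H (J' (J (f i)) \<ominus>\<^bsub>H\<^esub> f i) \<le> 7 * t / cmod z" if i: "i < n" for i
  proof -
    let ?x = "f i"
    have x: "?x \<in> carrier H" by (rule f(1)[OF i])
    let ?r = "shift H R z ?x" and ?D = "R ?x \<ominus>\<^bsub>H\<^esub> J' (J (R ?x))"
    have r: "?r \<in> carrier H" using R x by simp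
    have mm: "J ?x \<in> carrier K" "J' (J ?x) \<in> carrier H" "J' (J (R ?x)) \<in> carrier H" "J' (J ?r) \<in> carrier H"
      using x m r by simp_all
    have Jr: "J ?r = J (R ?x) \<ominus>\<^bsub>K\<^esub> z \<odot>\<^bsub>K\<^esub> J ?x"
      unfolding shift_def using x m by (simp add: bops_diff[OF J(1)] bops_smult[OF J(1)])
    interpret KH: hilbert_pair K H by unfold_locales
    have J'Jr: "J' (J ?r) = J' (J (R ?x)) \<ominus>\<^bsub>H\<^esub> z \<odot>\<^bsub>H\<^esub> J' (J ?x)"
      unfolding Jr using x m by (simp add: KH.bops_diff[OF J(2)] bops_smult[OF J(2)])
    have "z \<odot>\<^bsub>H\<^esub> (J' (J ?x) \<ominus>\<^bsub>H\<^esub> ?x) = (?r \<ominus>\<^bsub>H\<^esub> J' (J ?r)) \<ominus>\<^bsub>H\<^esub> ?D"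
      unfolding J'Jr unfolding shift_def
      by (rule H.ip_ext) (use x m mm in \<open>simp_all add: H.ip_simps algebra_simps\<close>)
    then have "cmod z * hnorm H (J' (J ?x) \<ominus>\<^bsub>H\<^esub> ?x) = hnorm H ((?r \<ominus>\<^bsub>H\<^esub> J' (J ?r)) \<ominus>\<^bsub>H\<^esub> ?D)"
      using H.hnorm_smult[of "J' (J ?x) \<ominus>\<^bsub>H\<^esub> ?x" z] mm x by simp
    also have "\<dots> \<le> hnorm H (?r \<ominus>\<^bsub>H\<^esub> J' (J ?r)) + hnorm H ?D"
      by (rule H.hnorm_diff_triangle) (use r mm m x in simp_all)
    also have "hnorm H (?r \<ominus>\<^bsub>H\<^esub> J' (J ?r)) \<le> hnorm H ?r + hnorm H (J' (J ?r))"
      by (rule H.hnorm_diff_triangle[OF r mm(4)])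
    also have "hnorm H (J' (J ?r)) \<le> 4 * hnorm H ?r"
      using J'n[OF m(1)[OF r]] Jn[OF r] by linarith
    also have "hnorm H ?D \<le> t * 2"
      using quasi_unitaryD(6)[OF Q x] mult_left_mono[OF fn[OF i], of t] t by linarith
    finally have "cmod z * hnorm H (J' (J ?x) \<ominus>\<^bsub>H\<^esub> ?x) \<le> 7 * t" using f(2)[OF i] by linarith
    then show ?thesis using z by (simp add: field_simps)
  qed
  have g: "cmod (ip K (J (f i)) (J (f j)) - (if i = j then 1 else 0)) \<le> e" if i: "i < n" and j: "j < n" for i j
  proof -
    let ?x = "f i" and ?y = "f j"
    have x: "?x \<in> carrier H" "?y \<in> carrier H" by (rule f(1)[OF i], rule f(1)[OF j])
    have mm: "J ?y \<in> carrier K" "J' (J ?y) \<in> carrier H" using x m by simp_all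
    have 1: "cmod (ip H ?x (J' (J ?y)) - ip K (J ?x) (J ?y)) \<le> 8 * t"
    proof -
      have Jy: "hnorm K (J ?y) \<le> 4" using Jn[OF x(2)] fn[OF j] by linarith
      have "hnorm H ?x * hnorm K (J ?y) \<le> 2 * 4"
        by (rule mult_mono[OF fn[OF i] Jy]) (use mm in simp_all)
      then have "t * (hnorm H ?x * hnorm K (J ?y)) \<le> t * 8" using t by simp
      then show ?thesis using quasi_unitaryD(5)[OF Q x(1) mm(1)] by linarith
    qed
    have 2: "cmod (ip H ?x (J' (J ?y)) - ip H ?x ?y) \<le> 14 * t / cmod z"
    proof -
      have "cmod (ip H ?x (J' (J ?y)) - ip H ?x ?y) \<le> hnorm H ?x * hnorm H (J' (J ?y) \<ominus>\<^bsub>H\<^esub> ?y)"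
        using H.cauchy_schwarz[of ?x "J' (J ?y) \<ominus>\<^bsub>H\<^esub> ?y"] x mm by (simp add: H.ip_diff_right)
      also have "\<dots> \<le> 2 * (7 * t / cmod z)"
        by (rule mult_mono[OF fn[OF i] d[OF j]]) (use x mm in simp_all)
      finally show ?thesis by simp
    qed
    let ?k = "if i = j then 1 else 0 :: complex"
    have "ip K (J ?x) (J ?y) - ?k = (ip H ?x ?y - ?k)
        + ((ip H ?x (J' (J ?y)) - ip H ?x ?y) - (ip H ?x (J' (J ?y)) - ip K (J ?x) (J ?y)))"
      by simp
    moreover have "cmod (p + (q - r)) \<le> cmod p + (cmod q + cmod r)" for p q r
      using norm_triangle_ineq[of p "q - r"] norm_triangle_ineq4[of q r] by linarith
    ultimately have "cmod (ip K (J ?x) (J ?y) - ?k) \<le> cmod (ip H ?x ?y - ?k)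
        + (cmod (ip H ?x (J' (J ?y)) - ip H ?x ?y) + cmod (ip H ?x (J' (J ?y)) - ip K (J ?x) (J ?y)))"
      by (simp only:)
    also have "\<dots> \<le> t + (14 * t / cmod z + 8 * t)" using 1 2 f(3)[OF i j] by linarith
    also have "\<dots> = c * t" by (simp add: c_def algebra_simps)
    finally show ?thesis using ct by linarith
  qed
  show "\<exists>f. (\<forall>i<n. f i \<in> carrier K) \<and> (\<forall>i<n. hnorm K (shift K S z (f i)) \<le> e) \<and>
    (\<forall>i<n. \<forall>j<n. cmod (ip K (f i) (f j) - (if i = j then 1 else 0)) \<le> e)"
    by (rule exI[of _ "\<lambda>i. J (f i)"]) (use m f(1) s g in simp)
qed

context hilbert_space
begin

text \<open>Put \<open>c\<^sub>i = \<langle>f\<^sub>i, u\<rangle>\<close> and let \<open>v\<close> be the sum of the \<open>c\<^sub>if\<^sub>i\<close>. Then the left-hand side is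
  \<open>\<langle>v, u\<rangle> \<le> \<parallel>v\<parallel> \<parallel>u\<parallel>\<close>, and the bounds on the Gram matrix control \<open>\<parallel>v\<parallel>\<^sup>2\<close> by the left-hand side.\<close>

lemma almost_bessel:
  assumes f: "\<And>i. i < n \<Longrightarrow> f i \<in> carrier H"
    and g: "\<And>i j. i < n \<Longrightarrow> j < n \<Longrightarrow> cmod (ip H (f i) (f j) - (if i = j then 1 else 0)) \<le> e"
    and u: "u \<in> carrier H" and e: "0 \<le> e"
  shows "(\<Sum>i<n. (cmod (ip H (f i) u))\<^sup>2) \<le> (1 + real n * e) * (hnorm H u)\<^sup>2"
proof -
  define c where "c i = ip H (f i) u" for i
  define s where "s = (\<Sum>i<n. (cmod (c i))\<^sup>2)"
  have s0: "0 \<le> s" unfolding s_def by (intro sum_nonneg) simp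
  let ?v = "lin_comb H c f n"
  have v: "?v \<in> carrier H" by (rule lin_comb_mem[OF f])
  have "ip H ?v u = (\<Sum>i<n. cnj (c i) * c i)" by (simp add: ip_lin_comb_left[OF f u] c_def)
  also have "\<dots> = complex_of_real s"
    unfolding s_def of_real_sum by (intro sum.cong refl) (simp only: complex_norm_square mult.commute)
  finally have vu: "s \<le> hnorm H ?v * hnorm H u" using cauchy_schwarz[OF v u] s0 by simp
  have "ip H ?v ?v = (\<Sum>i<n. cnj (c i) * ip H (f i) ?v)" by (rule ip_lin_comb_left[OF f v])
  also have "\<dots> = (\<Sum>i<n. cnj (c i) * (\<Sum>j<n. c j * ip H (f i) (f j)))"
    by (intro sum.cong refl) (simp add: ip_lin_comb_right[OF f f])
  also have "\<dots> = (\<Sum>i<n. \<Sum>j<n. cnj (c i) * c j * ip H (f i) (f j))"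
    by (simp add: sum_distrib_left mult.assoc)
  also have "\<dots> = (\<Sum>i<n. \<Sum>j<n. cnj (c i) * c j * (ip H (f i) (f j) - (if i = j then 1 else 0)))
      + (\<Sum>i<n. \<Sum>j<n. cnj (c i) * c j * (if i = j then 1 else 0))"
    by (simp add: sum.distrib[symmetric] algebra_simps)
  also have "(\<Sum>i<n. \<Sum>j<n. cnj (c i) * c j * (if i = j then 1 else 0)) = complex_of_real s"
  proof -
    have "(\<Sum>j<n. cnj (c i) * c j * (if i = j then 1 else 0)) = cnj (c i) * c i" if "i < n" for i
    proof -
      have "(\<Sum>j<n. cnj (c i) * c j * (if i = j then 1 else 0)) = (\<Sum>j<n. if i = j then cnj (c i) * c j else 0)"
        by (intro sum.cong refl) simp
      then show ?thesis using that by simp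
    qed
    then have "(\<Sum>i<n. \<Sum>j<n. cnj (c i) * c j * (if i = j then 1 else 0)) = (\<Sum>i<n. cnj (c i) * c i)"
      by simp
    also have "\<dots> = complex_of_real s"
      unfolding s_def of_real_sum by (intro sum.cong refl) (simp only: complex_norm_square mult.commute)
    finally show ?thesis .
  qed
  finally have vv: "complex_of_real ((hnorm H ?v)\<^sup>2) = (\<Sum>i<n. \<Sum>j<n. cnj (c i) * c j *
      (ip H (f i) (f j) - (if i = j then 1 else 0))) + complex_of_real s"
    unfolding ip_self[OF v] .
  define E where "E = (\<Sum>i<n. \<Sum>j<n. cnj (c i) * c j * (ip H (f i) (f j) - (if i = j then 1 else 0)))"
  have "cmod E \<le> (\<Sum>i<n. \<Sum>j<n. cmod (c i) * cmod (c j) * e)"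
    unfolding E_def
  proof (rule order_trans[OF norm_sum sum_mono])
    fix i assume i: "i \<in> {..<n}"
    show "cmod (\<Sum>j<n. cnj (c i) * c j * (ip H (f i) (f j) - (if i = j then 1 else 0)))
        \<le> (\<Sum>j<n. cmod (c i) * cmod (c j) * e)"
    proof (rule order_trans[OF norm_sum sum_mono])
      fix j assume j: "j \<in> {..<n}"
      show "cmod (cnj (c i) * c j * (ip H (f i) (f j) - (if i = j then 1 else 0))) \<le> cmod (c i) * cmod (c j) * e"
        unfolding norm_mult complex_mod_cnj using g[of i j] i j by (intro mult_left_mono) auto
    qed
  qed
  also have "\<dots> = e * (\<Sum>i<n. cmod (c i))\<^sup>2"
    by (simp add: power2_eq_square sum_product sum_distrib_left mult_ac)
  also have "\<dots> \<le> e * (real n * s)"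
  proof (rule mult_left_mono[OF _ e])
    have "(\<Sum>i<n. cmod (c i) * 1)\<^sup>2 \<le> (\<Sum>i<n. (cmod (c i))\<^sup>2) * (\<Sum>i<n. 1\<^sup>2)"
      by (rule Cauchy_Schwarz_ineq_sum)
    then show "(\<Sum>i<n. cmod (c i))\<^sup>2 \<le> real n * s" by (simp add: s_def mult.commute)
  qed
  finally have E: "cmod E \<le> e * (real n * s)" .
  have "(hnorm H ?v)\<^sup>2 = Re E + s"
    using arg_cong[OF vv, of Re] unfolding E_def[symmetric] by simp
  then have "(hnorm H ?v)\<^sup>2 \<le> (1 + real n * e) * s"
    using E abs_Re_le_cmod[of E] by (simp add: algebra_simps)
  moreover have "s\<^sup>2 \<le> (hnorm H ?v)\<^sup>2 * (hnorm H u)\<^sup>2"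
    using power_mono[OF vu s0, of 2] by (simp add: power_mult_distrib)
  moreover have "(hnorm H ?v)\<^sup>2 * (hnorm H u)\<^sup>2 \<le> ((1 + real n * e) * s) * (hnorm H u)\<^sup>2"
    using calculation(1) by (intro mult_right_mono) auto
  ultimately have "s * s \<le> ((1 + real n * e) * (hnorm H u)\<^sup>2) * s"
    by (simp add: power2_eq_square mult_ac)
  moreover have "0 \<le> (1 + real n * e) * (hnorm H u)\<^sup>2" using e by simp
  ultimately have "s \<le> (1 + real n * e) * (hnorm H u)\<^sup>2"
    using s0 by (cases "s = 0") (auto dest: mult_right_le_imp_le)
  then show ?thesis by (simp add: s_def c_def)
qed

text \<open>Compare the sum of all \<open>|\<langle>u\<^sub>k, f\<^sub>i\<rangle>|\<^sup>2\<close> computed in two ways: it is nearly the number of the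
  \<open>f\<^sub>i\<close>, since these are nearly in the span of the \<open>u\<^sub>k\<close>, and nearly at most the number of the
  \<open>u\<^sub>k\<close>, by the inequality of Bessel.\<close>

lemma not_almost_eig_Suc:
  assumes R: "R \<in> bounded_ops H H" and u: "orthonormal H u m"
    and ker: "\<And>i. i < m \<Longrightarrow> shift H R z (u i) = \<zero>"
    and eta: "\<eta> > 0" "\<And>y. y \<in> carrier H \<Longrightarrow> (\<And>i. i < m \<Longrightarrow> ip H (u i) y = 0) \<Longrightarrow>
      \<eta> * hnorm H y \<le> hnorm H (shift H R z y)"
  shows "\<not> almost_eig H R (Suc m) z"
proof
  assume a: "almost_eig H R (Suc m) z"
  let ?n = "Suc m"
  define N where "N = real ?n"
  have N: "N \<ge> 1" by (simp add: N_def)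
  \<comment> \<open>The two counts will give \<open>N (1 - 2e) \<le> (N - 1) (1 + Ne)\<close>, which is false for this \<open>e\<close>.\<close>
  define e where "e = min 1 (min (\<eta>\<^sup>2) (1 / (N\<^sup>2 + 2 * N + 1)))"
  have den: "N\<^sup>2 + 2 * N + 1 > 0" using N by (intro add_nonneg_pos) auto
  have e: "e > 0" "e \<le> 1" "e \<le> \<eta>\<^sup>2" "e \<le> 1 / (N\<^sup>2 + 2 * N + 1)" using eta den by (auto simp: e_def)
  obtain f where f: "\<And>i. i < ?n \<Longrightarrow> f i \<in> carrier H" "\<And>i. i < ?n \<Longrightarrow> hnorm H (shift H R z (f i)) \<le> e"
    "\<And>i j. i < ?n \<Longrightarrow> j < ?n \<Longrightarrow> cmod (ip H (f i) (f j) - (if i = j then 1 else 0)) \<le> e"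
    using almost_eigD[OF a e(1)] by blast
  let ?w = "\<lambda>i k. (cmod (ip H (u k) (f i)))\<^sup>2"
  have low: "1 - 2 * e \<le> (\<Sum>k<m. ?w i k)" if i: "i < ?n" for i
  proof -
    have x: "f i \<in> carrier H" by (rule f(1)[OF i])
    let ?p = "orth_proj H u m (f i)" and ?A = "shift H R z"
    have p: "?p \<in> carrier H" by (rule orth_proj_mem[OF u])
    have Ap: "?A ?p = \<zero>"
    proof -
      have "k \<le> m \<Longrightarrow> ?A (lin_comb H c u k) = \<zero>" for k c
      proof (induction k)
        case 0
        show ?case using HH.bops_zero[OF shift_bops[OF R]] by simp
      next
        case (Suc k)
        have "lin_comb H c u k \<in> carrier H" "u k \<in> carrier H"
          using Suc orthonormalD(1)[OF u] by (auto intro!: lin_comb_mem)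
        then show ?case using Suc ker[of k]
          by (simp add: bops_add[OF shift_bops[OF R]] bops_smult[OF shift_bops[OF R]])
      qed
      then show ?thesis by (simp add: orth_proj_def)
    qed
    let ?y = "f i \<ominus> ?p"
    have y: "?y \<in> carrier H" using x p by simp
    have "?A ?y = ?A (f i)"
      unfolding HH.bops_diff[OF shift_bops[OF R] x p] Ap using x R by simp
    then have "\<eta> * hnorm H ?y \<le> e" using eta(2)[OF y orth_proj_orthogonal[OF u x]] f(2)[OF i] by simp
    then have "(\<eta> * hnorm H ?y)\<^sup>2 \<le> e\<^sup>2" using eta(1) y by (intro power_mono) auto
    then have "\<eta>\<^sup>2 * (hnorm H ?y)\<^sup>2 \<le> e * e"
      unfolding power_mult_distrib by (simp only: power2_eq_square[of e])
    also have "\<dots> \<le> \<eta>\<^sup>2 * e" using e by (intro mult_right_mono) auto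
    finally have "(hnorm H ?y)\<^sup>2 \<le> e" using eta(1) by simp
    moreover have "1 - e \<le> (hnorm H (f i))\<^sup>2" using almost_unit_norm(2)[OF x] f(3)[OF i i] by simp
    ultimately show ?thesis using orth_proj_pythagoras[OF u x] by linarith
  qed
  have "N * (1 - 2 * e) \<le> (\<Sum>i<?n. \<Sum>k<m. ?w i k)"
    using sum_mono[of "{..<?n}" "\<lambda>i. 1 - 2 * e"] low unfolding N_def by (simp del: sum.lessThan_Suc)
  also have "\<dots> = (\<Sum>k<m. \<Sum>i<?n. ?w i k)" by (rule sum.swap)
  also have "\<dots> \<le> (\<Sum>k<m. 1 + N * e)"
  proof (rule sum_mono)
    fix k assume "k \<in> {..<m}"
    then have k: "u k \<in> carrier H" "hnorm H (u k) = 1" using orthonormalD[OF u] by auto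
    have "(\<Sum>i<?n. ?w i k) = (\<Sum>i<?n. (cmod (ip H (f i) (u k)))\<^sup>2)"
      by (intro sum.cong refl) (use ip_cnj[OF k(1) f(1)] in simp)
    also have "\<dots> \<le> (1 + real ?n * e) * (hnorm H (u k))\<^sup>2"
      by (rule almost_bessel[OF f(1,3) k(1)]) (use e in simp_all)
    finally show "(\<Sum>i<?n. ?w i k) \<le> 1 + N * e" using k by (simp add: N_def)
  qed
  also have "\<dots> = (N - 1) * (1 + N * e)" by (simp add: N_def)
  finally have "1 \<le> (N\<^sup>2 + N) * e" by (simp add: algebra_simps power2_eq_square)
  also have "\<dots> \<le> (N\<^sup>2 + N) * (1 / (N\<^sup>2 + 2 * N + 1))" using e N by (intro mult_left_mono) auto
  also have "\<dots> < 1" using den N by (simp add: field_simps)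
  finally show False by simp
qed

lemma almost_eig_of_kernel:
  assumes "orthonormal H u n" "\<And>i. i < n \<Longrightarrow> shift H R z (u i) = \<zero>"
  shows "almost_eig H R n z"
proof (rule almost_eigI)
  fix e :: real assume "e > 0"
  then show "\<exists>f. (\<forall>i<n. f i \<in> carrier H) \<and> (\<forall>i<n. hnorm H (shift H R z (f i)) \<le> e) \<and>
    (\<forall>i<n. \<forall>j<n. cmod (ip H (f i) (f j) - (if i = j then 1 else 0)) \<le> e)"
    by (intro exI[of _ u]) (use orthonormalD[OF assms(1)] assms(2) in simp)
qed

lemma spectrum_iff_almost_eig:
  assumes R: "R \<in> B01 H"
  shows "z \<in> spectrum H R \<longleftrightarrow> almost_eig H R 1 z"
proof
  assume z: "z \<in> spectrum H R"
  have zr: "z = complex_of_real (Re z)" by (rule B01_real_spectrum(1)[OF R z])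
  show "almost_eig H R 1 z"
  proof (rule almost_eigI)
    fix e :: real assume e: "e > 0"
    obtain x where x: "x \<in> carrier H" "hnorm H x = 1" "hnorm H (shift H R z x) \<le> e"
      using spectrum_approximate_eigenvector[OF B01_symmetric[OF R] _ e, of "Re z"] z zr by metis
    then have "ip H x x = 1" using ip_self[OF x(1)] by simp
    then show "\<exists>f. (\<forall>i<1::nat. f i \<in> carrier H) \<and> (\<forall>i<1. hnorm H (shift H R z (f i)) \<le> e) \<and>
      (\<forall>i<1. \<forall>j<1. cmod (ip H (f i) (f j) - (if i = j then 1 else 0)) \<le> e)"
      by (intro exI[of _ "\<lambda>_. x"]) (use x e in simp)
  qed
next
  assume a: "almost_eig H R 1 z"
  show "z \<in> spectrum H R"
  proof (rule ccontr)
    assume "z \<notin> spectrum H R"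
    then obtain c where c: "c > 0" "\<And>x. x \<in> carrier H \<Longrightarrow> c * hnorm H x \<le> hnorm H (shift H R z x)"
      using bounded_below_of_not_spectrum[OF symmetric_opD(1)[OF B01_symmetric[OF R]]]
      unfolding bounded_below_def by blast
    have e: "min (1/2) (c / 2) > 0" using c by simp
    obtain f :: "nat \<Rightarrow> 'a" where F: "\<forall>i<1. f i \<in> carrier H" "\<forall>i<1. hnorm H (shift H R z (f i)) \<le> min (1/2) (c / 2)"
      "\<forall>i<1. \<forall>j<1. cmod (ip H (f i) (f j) - (if i = j then 1 else 0)) \<le> min (1/2) (c / 2)"
      using almost_eigD[OF a e] by blast
    then have f: "f 0 \<in> carrier H" "hnorm H (shift H R z (f 0)) \<le> min (1/2) (c / 2)"
      "cmod (ip H (f 0) (f 0) - 1) \<le> min (1/2) (c / 2)"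
      by simp_all
    have "c * hnorm H (f 0) \<le> c / 2" using c(2)[OF f(1)] f(2) by linarith
    then have "hnorm H (f 0) \<le> 1 / 2" using c(1) by (simp add: field_simps)
    then have "(hnorm H (f 0))\<^sup>2 \<le> (1 / 2)\<^sup>2" using f(1) by (intro power_mono) auto
    moreover have "1 - 1 / 2 \<le> (hnorm H (f 0))\<^sup>2" using almost_unit_norm(2)[OF f(1)] f(3) by force
    ultimately show False by (simp add: power2_eq_square)
  qed
qed

lemma gap_of_isolated:
  assumes R: "R \<in> B01 H" and z: "z isolated_in spectrum H R"
  obtains \<eta> where "\<eta> > 0"
    "\<And>y. y \<in> carrier H \<Longrightarrow> (\<And>k. k \<in> carrier H \<Longrightarrow> shift H R z k = \<zero> \<Longrightarrow> ip H k y = 0) \<Longrightarrow>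
      \<eta> * hnorm H y \<le> hnorm H (shift H R z y)"
proof -
  have zs: "z \<in> spectrum H R" using z by (simp add: isolated_in_def)
  have zr: "z = complex_of_real (Re z)" by (rule B01_real_spectrum(1)[OF R zs])
  obtain d where d: "d > 0" "\<And>y. y \<in> spectrum H R \<Longrightarrow> dist z y < d \<Longrightarrow> y = z"
    using isolated_inE_dist[OF z] by blast
  have gap: "d \<le> cmod (w - complex_of_real (Re z))"
    if "w \<in> spectrum H R" "w \<noteq> complex_of_real (Re z)" for w
    using d(2)[OF that(1)] that(2) zr by (metis dist_norm dist_commute not_le)
  have S: "symmetric_op H (shift H R (complex_of_real (Re z)))"
    by (rule symmetric_shift[OF B01_symmetric[OF R]])
  note b = bound_on_kernel_complement[OF S d(1) gap_bound_on_range[OF R d(1) gap]]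
  show thesis
    by (rule that[OF d(1)], subst (1) zr, rule b) (simp_all flip: zr)
qed

lemma is_eigenvalue_iff:
  "is_eigenvalue H R z \<longleftrightarrow> (\<exists>x\<in>carrier H. R x = z \<odot> x \<and> x \<noteq> \<zero>)"
  by (auto simp: is_eigenvalue_def eigspace_def)

lemma shift_eq_zero_iff:
  "R \<in> bounded_ops H H \<Longrightarrow> x \<in> carrier H \<Longrightarrow> shift H R z x = \<zero> \<longleftrightarrow> R x = z \<odot> x"
  using bops_mem[of R H H x] by (simp add: shift_def)

text \<open>If the kernel of \<open>R - z\<close> were trivial, then the bound on its orthogonal complement would hold
  everywhere, and \<open>z\<close> would not be in the spectrum.\<close>

lemma isolated_is_eigenvalue:
  assumes R: "R \<in> B01 H" and z: "z isolated_in spectrum H R"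
  shows "is_eigenvalue H R z"
proof (rule ccontr)
  assume ne: "\<not> is_eigenvalue H R z"
  note Rb = symmetric_opD(1)[OF B01_symmetric[OF R]]
  have zs: "z \<in> spectrum H R" using z by (simp add: isolated_in_def)
  have ker: "k = \<zero>" if "k \<in> carrier H" "shift H R z k = \<zero>" for k
    using ne that shift_eq_zero_iff[OF Rb that(1)] by (auto simp: is_eigenvalue_iff)
  obtain \<eta> where eta: "\<eta> > 0" "\<And>y. y \<in> carrier H \<Longrightarrow> (\<And>k. k \<in> carrier H \<Longrightarrow> shift H R z k = \<zero> \<Longrightarrow> ip H k y = 0) \<Longrightarrow>
      \<eta> * hnorm H y \<le> hnorm H (shift H R z y)"
    using gap_of_isolated[OF R z] by blast
  have "bounded_below H (shift H R z)"
    unfolding bounded_below_def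
  proof (intro exI[of _ \<eta>] conjI ballI eta)
    fix y k assume y: "y \<in> carrier H" and "k \<in> carrier H" "shift H R z k = \<zero>"
    then show "ip H k y = 0" using ker[of k] by simp
  qed
  then have "complex_of_real (Re z) \<notin> spectrum H R"
    using not_spectrum_iff_bounded_below[OF B01_symmetric[OF R], of "Re z"] B01_real_spectrum(1)[OF R zs] by simp
  then show False using zs B01_real_spectrum(1)[OF R zs] by simp
qed

text \<open>At an accumulation point of the spectrum, approximate eigenvectors for distinct nearby
  spectral values are almost orthogonal.\<close>

lemma almost_eig_of_islimpt:
  assumes R: "R \<in> B01 H" and z: "z islimpt spectrum H R"
  shows "almost_eig H R n z"
proof (rule almost_eigI)
  fix e :: real assume e: "e > 0"
  note S = B01_symmetric[OF R] and Rb = symmetric_opD(1)[OF B01_symmetric[OF R]]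
  have "infinite (spectrum H R \<inter> ball z (e / 2))"
    using z e unfolding islimpt_eq_infinite_ball by simp
  then obtain w :: "nat \<Rightarrow> complex" where w: "inj w" "range w \<subseteq> spectrum H R \<inter> ball z (e / 2)"
    using infinite_countable_subset by blast
  have ws: "w i \<in> spectrum H R" and wz: "cmod (w i - z) \<le> e / 2" for i
    using w(2) by (auto simp: dist_norm norm_minus_commute subset_iff image_iff intro!: less_imp_le)
  have wr: "w i = complex_of_real (Re (w i))" for i by (rule B01_real_spectrum(1)[OF R ws])
  \<comment> \<open>The element 1 makes the set nonempty, so that its minimum is meaningful for \<open>n \<le> 1\<close>.\<close>
  define G where "G = insert 1 ((\<lambda>(i, j). cmod (w i - w j)) ` ({..<n} \<times> {..<n} - Id))"
  have fG: "finite G" by (simp add: G_def)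
  define g where "g = Min G"
  have g0: "g > 0" unfolding g_def using fG w(1) by (subst Min_gr_iff) (auto simp: G_def inj_def)
  have gle: "g \<le> cmod (w i - w j)" if "i < n" "j < n" "i \<noteq> j" for i j
    unfolding g_def using fG that by (intro Min_le) (auto simp: G_def image_iff intro!: bexI[of _ "(i, j)"])
  define t where "t = min (e / 2) (e * g / 2)"
  have t: "t > 0" "t \<le> e / 2" "2 * t \<le> e * g" using e g0 by (auto simp: t_def)
  have "\<exists>x\<in>carrier H. hnorm H x = 1 \<and> hnorm H (shift H R (w i) x) \<le> t" for i
    using spectrum_approximate_eigenvector[OF S _ t(1), of "Re (w i)"] ws[of i] wr[of i] by metis
  then obtain x where x: "\<And>i. x i \<in> carrier H" "\<And>i. hnorm H (x i) = 1"
      "\<And>i. hnorm H (shift H R (w i) (x i)) \<le> t" by metis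
  note Rm = bops_mem[OF Rb]
  have 1: "hnorm H (shift H R z (x i)) \<le> e" for i
  proof -
    have "shift H R z (x i) = shift H R (w i) (x i) \<oplus> (w i - z) \<odot> x i"
      unfolding shift_def by (rule ip_ext) (use x(1) Rm in \<open>simp_all add: ip_simps algebra_simps\<close>)
    then have "hnorm H (shift H R z (x i)) \<le> hnorm H (shift H R (w i) (x i)) + hnorm H ((w i - z) \<odot> x i)"
      using hnorm_triangle[of "shift H R (w i) (x i)" "(w i - z) \<odot> x i"] x(1) Rb by simp
    also have "\<dots> \<le> t + e / 2" using x wz[of i] by (intro add_mono) (simp_all add: hnorm_smult)
    finally show ?thesis using t by linarith
  qed
  have 2: "cmod (ip H (x i) (x j) - (if i = j then 1 else 0)) \<le> e" if ij: "i < n" "j < n" for i j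
  proof (cases "i = j")
    case True
    then show ?thesis using ip_self[OF x(1)[of j]] x(2)[of j] e by simp
  next
    case False
    let ?r = "\<lambda>i. shift H R (w i) (x i)"
    have r: "?r k \<in> carrier H" for k using Rb x(1) by simp
    have wc: "cnj (w i) = w i" by (subst (1 2) wr) simp
    have "ip H (?r i) (x j) = ip H (R (x i)) (x j) - w i * ip H (x i) (x j)"
      using x(1) Rm wc by (simp add: shift_def ip_simps)
    moreover have "ip H (x i) (?r j) = ip H (R (x i)) (x j) - w j * ip H (x i) (x j)"
      using x(1) Rm by (simp add: shift_def ip_simps symmetric_opD(3)[OF S])
    ultimately have "(w j - w i) * ip H (x i) (x j) = ip H (?r i) (x j) - ip H (x i) (?r j)"
      by (simp add: algebra_simps)
    then have "cmod (w j - w i) * cmod (ip H (x i) (x j)) = cmod (ip H (?r i) (x j) - ip H (x i) (?r j))"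
      by (metis norm_mult)
    also have "\<dots> \<le> cmod (ip H (?r i) (x j)) + cmod (ip H (x i) (?r j))" by (rule norm_triangle_ineq4)
    also have "\<dots> \<le> t + t"
      using cauchy_schwarz[OF r x(1), of i j] cauchy_schwarz[OF x(1) r, of i j] x(2)[of i] x(2)[of j] x(3)[of i] x(3)[of j]
      by simp
    also have "\<dots> \<le> e * cmod (w j - w i)"
      using t(3) mult_left_mono[OF gle[OF ij(2,1) not_sym[OF False]], of e] e by linarith
    finally have "cmod (w j - w i) * cmod (ip H (x i) (x j)) \<le> cmod (w j - w i) * e" by (simp add: mult.commute)
    moreover have "cmod (w j - w i) > 0" using gle[OF ij(2,1)] False g0 by linarith
    ultimately show ?thesis using False by simp
  qed
  show "\<exists>f. (\<forall>i<n. f i \<in> carrier H) \<and> (\<forall>i<n. hnorm H (shift H R z (f i)) \<le> e) \<and>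
    (\<forall>i<n. \<forall>j<n. cmod (ip H (f i) (f j) - (if i = j then 1 else 0)) \<le> e)"
    by (rule exI[of _ x]) (use x 1 2 in simp)
qed

lemma almost_eig_of_not_disc:
  assumes R: "R \<in> B01 H" and z: "z \<in> spectrum H R" "z \<notin> disc_spectrum H R"
  shows "almost_eig H R n z"
proof (cases "z isolated_in spectrum H R")
  case True
  note Rb = symmetric_opD(1)[OF B01_symmetric[OF R]]
  have "\<not> finite_mult H R z"
    using z True isolated_is_eigenvalue[OF R True] by (simp add: disc_spectrum_def)
  then have "\<not> vectorspace.fin_dim (class_ring :: complex ring) (H\<lparr>carrier := {x \<in> carrier H. R x = z \<odot> x}\<rparr>)"
    by (simp add: finite_mult_def eigspace_def)
  then obtain u where u: "orthonormal H u n" "\<forall>i<n. u i \<in> {x \<in> carrier H. R x = z \<odot> x}"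
    using not_fin_dim_orthonormal[OF lin_subspace_eigenspace[OF Rb]] by blast
  show ?thesis by (rule almost_eig_of_kernel[OF u(1)]) (use u(2) shift_eq_zero_iff[OF Rb] in simp)
next
  case False
  then have "z islimpt spectrum H R" using z isolated_in_islimpt_iff by blast
  then show ?thesis by (rule almost_eig_of_islimpt[OF R])
qed

lemma disc_spectrum_almost_eig:
  assumes R: "R \<in> B01 H" and z: "z \<in> disc_spectrum H R"
  shows "almost_eig H R (mult_eig H R z) z" "\<not> almost_eig H R (Suc (mult_eig H R z)) z"
proof -
  note Rb = symmetric_opD(1)[OF B01_symmetric[OF R]]
  let ?E = "{x \<in> carrier H. R x = z \<odot> x}" and ?m = "mult_eig H R z"
  have E: "lin_subspace H ?E" by (rule lin_subspace_eigenspace[OF Rb])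
  obtain u where u: "orthonormal H u ?m" "\<forall>i<?m. u i \<in> ?E" "\<forall>x\<in>?E. x = orth_proj H u ?m x"
    using fin_dim_orthonormal_basis[OF E] z
    by (auto simp: disc_spectrum_def finite_mult_def mult_eig_def eigspace_def)
  have ker: "shift H R z (u i) = \<zero>" if "i < ?m" for i
    using u(2) that shift_eq_zero_iff[OF Rb, of "u i" z] by simp
  show "almost_eig H R ?m z" by (rule almost_eig_of_kernel[OF u(1) ker])
  have zi: "z isolated_in spectrum H R" using z by (simp add: disc_spectrum_def)
  obtain \<eta> where eta: "\<eta> > 0" "\<And>y. y \<in> carrier H \<Longrightarrow> (\<And>k. k \<in> carrier H \<Longrightarrow> shift H R z k = \<zero> \<Longrightarrow> ip H k y = 0) \<Longrightarrow>
      \<eta> * hnorm H y \<le> hnorm H (shift H R z y)"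
    using gap_of_isolated[OF R zi] by blast
  show "\<not> almost_eig H R (Suc ?m) z"
  proof (rule not_almost_eig_Suc[OF Rb u(1) ker eta(1)])
    fix y assume y: "y \<in> carrier H" "\<And>i. i < ?m \<Longrightarrow> ip H (u i) y = 0"
    show "\<eta> * hnorm H y \<le> hnorm H (shift H R z y)"
    proof (rule eta(2)[OF y(1)])
      fix k assume k: "k \<in> carrier H" "shift H R z k = \<zero>"
      then have "k \<in> ?E" using shift_eq_zero_iff[OF Rb] by simp
      then have kp: "k = lin_comb H (\<lambda>i. ip H (u i) k) u ?m" using u(3) by (simp add: orth_proj_def)
      have "ip H (lin_comb H (\<lambda>i. ip H (u i) k) u ?m) y = (\<Sum>i<?m. cnj (ip H (u i) k) * ip H (u i) y)"
        by (rule ip_lin_comb_left[OF orthonormalD(1)[OF u(1)] y(1)])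
      then show "ip H k y = 0" unfolding kp[symmetric] using y(2) by simp
    qed
  qed
qed

lemma zero_not_disc:
  assumes R: "R \<in> B01 H"
  shows "\<not> is_eigenvalue H R 0" "0 \<notin> disc_spectrum H R"
proof -
  show 1: "\<not> is_eigenvalue H R 0" using B01_kernel[OF R] by (auto simp: is_eigenvalue_iff)
  then show "0 \<notin> disc_spectrum H R" by (simp add: disc_spectrum_def)
qed

lemma disc_spectrum_iff:
  assumes R: "R \<in> B01 H"
  shows "z \<in> disc_spectrum H R \<longleftrightarrow> almost_eig H R 1 z \<and> \<not> (\<forall>n. almost_eig H R n z)"
proof -
  have "z \<in> disc_spectrum H R \<Longrightarrow> z \<in> spectrum H R" by (simp add: disc_spectrum_def isolated_in_def)
  then show ?thesis
    using disc_spectrum_almost_eig(2)[OF R, of z] almost_eig_of_not_disc[OF R, of z]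
      spectrum_iff_almost_eig[OF R, of z] by blast
qed

lemma spectrum_islimpt:
  assumes R: "R \<in> B01 H" and z: "z islimpt spectrum H R"
  shows "z \<in> spectrum H R"
  using almost_eig_of_islimpt[OF R z] spectrum_iff_almost_eig[OF R] by blast

end

text \<open>Approximate eigenvectors for 0 need not be close to the range of \<open>R\<close>, so \<open>J\<close> may not transport
  them. But 0 is not an eigenvalue, hence not isolated in the spectrum, and it is
  approximated by nonzero spectral values, which the two operators share.\<close>

lemma (in hilbert_pair) spectrum_zero_transfer:
  assumes R: "R \<in> B01 H" and S: "S \<in> B01 K"
    and eq: "\<And>z. z \<noteq> 0 \<Longrightarrow> z \<in> spectrum H R \<longleftrightarrow> z \<in> spectrum K S"
    and z: "0 \<in> spectrum H R"
  shows "0 \<in> spectrum K S"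
proof -
  have "\<not> 0 isolated_in spectrum H R" using H.isolated_is_eigenvalue[OF R] H.zero_not_disc(1)[OF R] by blast
  then have "0 islimpt spectrum H R" using z isolated_in_islimpt_iff by blast
  then have "0 islimpt (spectrum H R - {0})" by (simp add: islimpt_def) blast
  moreover have "spectrum H R - {0} \<subseteq> spectrum K S" using eq by auto
  ultimately have "0 islimpt spectrum K S" by (rule islimpt_subset)
  then show ?thesis by (rule K.spectrum_islimpt[OF S])
qed

theorem (in hilbert_pair) spectra_of_distance_zero:
  assumes R: "R \<in> B01 H" and S: "S \<in> B01 K"
    and q: "\<And>\<delta>. \<delta> > 0 \<Longrightarrow> \<exists>J J'. quasi_unitary \<delta> H R K S J J'"
  shows "ess_spectrum H R = ess_spectrum K S" "disc_spectrum H R = disc_spectrum K S"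
    "z \<in> disc_spectrum H R \<Longrightarrow> mult_eig H R z = mult_eig K S z"
proof -
  interpret KH: hilbert_pair K H by unfold_locales
  note Rb = H.symmetric_opD(1)[OF H.B01_symmetric[OF R]] and Sb = K.symmetric_opD(1)[OF K.B01_symmetric[OF S]]
  have q': "\<exists>J J'. quasi_unitary \<delta> K S H R J J'" if d: "\<delta> > 0" for \<delta>
    using q[OF d] quasi_unitary_sym by blast
  have ae: "almost_eig H R n z \<longleftrightarrow> almost_eig K S n z" if z: "z \<noteq> 0" for n z
    using almost_eig_transfer[OF Rb Sb q z] KH.almost_eig_transfer[OF Sb Rb q' z] by blast
  have sp: "z \<in> spectrum H R \<longleftrightarrow> z \<in> spectrum K S" for z
  proof (cases "z = 0")
    case True
    have eq: "\<And>z. z \<noteq> 0 \<Longrightarrow> z \<in> spectrum H R \<longleftrightarrow> z \<in> spectrum K S"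
      using ae H.spectrum_iff_almost_eig[OF R] K.spectrum_iff_almost_eig[OF S] by blast
    then show ?thesis
      using spectrum_zero_transfer[OF R S eq] KH.spectrum_zero_transfer[OF S R] unfolding True by blast
  next
    case False
    then show ?thesis using ae H.spectrum_iff_almost_eig[OF R] K.spectrum_iff_almost_eig[OF S] by blast
  qed
  show d: "disc_spectrum H R = disc_spectrum K S"
  proof (rule Set.set_eqI)
    fix z
    show "z \<in> disc_spectrum H R \<longleftrightarrow> z \<in> disc_spectrum K S"
    proof (cases "z = 0")
      case True
      then show ?thesis using H.zero_not_disc(2)[OF R] K.zero_not_disc(2)[OF S] by simp
    next
      case False
      then show ?thesis using H.disc_spectrum_iff[OF R] K.disc_spectrum_iff[OF S] ae by simp
    qed
  qed
  then show "ess_spectrum H R = ess_spectrum K S" using sp by (auto simp: ess_spectrum_def)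
  show "mult_eig H R z = mult_eig K S z" if z: "z \<in> disc_spectrum H R"
  proof -
    have z0: "z \<noteq> 0" using z H.zero_not_disc(2)[OF R] by auto
    have zK: "z \<in> disc_spectrum K S" using z d by simp
    note a = H.disc_spectrum_almost_eig[OF R z] and b = K.disc_spectrum_almost_eig[OF S zK]
    show ?thesis
    proof (rule antisym)
      show "mult_eig H R z \<le> mult_eig K S z"
        using a(1) b(2) ae[OF z0] almost_eig_mono by (metis not_less_eq_eq)
      show "mult_eig K S z \<le> mult_eig H R z"
        using b(1) a(2) ae[OF z0] almost_eig_mono by (metis not_less_eq_eq)
    qed
  qed
qed

section \<open>Diagonal maps between orthonormal bases\<close>

text \<open>The operator with \<open>e\<^sub>k \<mapsto> a\<^sub>kf\<^sub>k\<close>: for \<open>a = 1\<close> it is unitary, and for equal bases it is a diagonal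
  operator.\<close>

definition diag_map :: "'a hspace \<Rightarrow> (nat \<Rightarrow> 'a) \<Rightarrow> 'a hspace \<Rightarrow> (nat \<Rightarrow> 'a) \<Rightarrow> (nat \<Rightarrow> complex) \<Rightarrow> 'a \<Rightarrow> 'a" where
  "diag_map H e K f a x = (THE y. y \<in> carrier K \<and> (\<forall>k. ip K (f k) y = a k * ip H (e k) x))"

context hilbert_pair
begin

lemma diag_map_props:
  assumes e: "onb H e" and f: "onb K f" and a: "\<And>k. cmod (a k) \<le> C" and x: "x \<in> carrier H"
  shows "diag_map H e K f a x \<in> carrier K" "ip K (f k) (diag_map H e K f a x) = a k * ip H (e k) x"
    "hnorm K (diag_map H e K f a x) \<le> C * hnorm H x"
proof -
  have C: "0 \<le> C" using a[of 0] norm_ge_zero[of "a 0"] by linarith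
  let ?g = "\<lambda>k. (cmod (ip H (e k) x))\<^sup>2" and ?h = "\<lambda>k. (cmod (a k * ip H (e k) x))\<^sup>2"
  have le: "?h k \<le> C\<^sup>2 * ?g k" for k
    unfolding norm_mult power_mult_distrib using a[of k] by (intro mult_right_mono power_mono) auto
  have sg: "summable (\<lambda>k. C\<^sup>2 * ?g k)" by (rule summable_mult[OF H.onb_summable[OF e x]])
  have sh: "summable ?h" by (rule summable_comparison_test'[OF sg, of 0]) (use le in simp)
  obtain y where y: "y \<in> carrier K" "\<And>k. ip K (f k) y = a k * ip H (e k) x" "(hnorm K y)\<^sup>2 = (\<Sum>k. ?h k)"
    using K.riesz_fischer[OF f sh] by blast
  have D: "diag_map H e K f a x = y"
    unfolding diag_map_def
  proof (rule the_equality)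
    show "y \<in> carrier K \<and> (\<forall>k. ip K (f k) y = a k * ip H (e k) x)" using y by blast
    show "w = y" if "w \<in> carrier K \<and> (\<forall>k. ip K (f k) w = a k * ip H (e k) x)" for w
      by (rule K.onb_ext[OF f]) (use that y in simp_all)
  qed
  show "diag_map H e K f a x \<in> carrier K" "ip K (f k) (diag_map H e K f a x) = a k * ip H (e k) x"
    using y by (simp_all add: D)
  have "(hnorm K y)\<^sup>2 \<le> (\<Sum>k. C\<^sup>2 * ?g k)" unfolding y(3) by (rule suminf_le[OF le sh sg])
  also have "\<dots> = (C * hnorm H x)\<^sup>2"
    unfolding suminf_mult[OF H.onb_summable[OF e x]] H.onb_expansion(2)[OF e x, symmetric] power_mult_distrib ..
  finally show "hnorm K (diag_map H e K f a x) \<le> C * hnorm H x"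
    unfolding D by (rule power2_le_imp_le) (use C x in simp)
qed

lemma diag_map_bops:
  assumes e: "onb H e" and f: "onb K f" and a: "\<And>k. cmod (a k) \<le> C"
  shows "diag_map H e K f a \<in> bounded_ops H K"
proof (rule bopsI[where C = C])
  note d = diag_map_props[OF e f a]
  note fc = K.onbD(1)[OF f] and ec = H.onbD(1)[OF e]
  show "diag_map H e K f a (x \<oplus>\<^bsub>H\<^esub> y) = diag_map H e K f a x \<oplus>\<^bsub>K\<^esub> diag_map H e K f a y"
    if "x \<in> carrier H" "y \<in> carrier H" for x y
    by (rule K.onb_ext[OF f]) (use that d fc ec in \<open>simp_all add: K.ip_simps H.ip_simps algebra_simps\<close>)
  show "diag_map H e K f a (c \<odot>\<^bsub>H\<^esub> x) = c \<odot>\<^bsub>K\<^esub> diag_map H e K f a x" if "x \<in> carrier H" for x c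
    by (rule K.onb_ext[OF f]) (use that d fc ec in \<open>simp_all add: K.ip_simps H.ip_simps algebra_simps\<close>)
qed (use diag_map_props[OF e f a] in simp_all)

lemma diag_map_adjoint:
  assumes e: "onb H e" and f: "onb K f" and a: "\<And>k. cmod (a k) \<le> C"
    and x: "x \<in> carrier H" and y: "y \<in> carrier K"
  shows "ip K (diag_map H e K f a x) y = ip H x (diag_map K f H e (\<lambda>k. cnj (a k)) y)"
proof -
  interpret KH: hilbert_pair K H by unfold_locales
  let ?u = "diag_map H e K f a x" and ?v = "diag_map K f H e (\<lambda>k. cnj (a k)) y"
  have a': "\<And>k. cmod (cnj (a k)) \<le> C" using a by simp
  note u = diag_map_props[OF e f a x] and v = KH.diag_map_props[OF f e a' y]
  have "(\<lambda>n. \<Sum>k<n. ip K (f k) y * ip K ?u (f k)) \<longlonglongrightarrow> ip K ?u y"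
    by (rule K.onb_ip_expansion[OF f y u(1)])
  moreover have "(\<lambda>n. \<Sum>k<n. ip H (e k) ?v * ip H x (e k)) \<longlonglongrightarrow> ip H x ?v"
    by (rule H.onb_ip_expansion[OF e v(1) x])
  moreover have "ip K (f k) y * ip K ?u (f k) = ip H (e k) ?v * ip H x (e k)" for k
    unfolding u(2) v(2) K.ip_cnj[OF K.onbD(1)[OF f] u(1)] H.ip_cnj[OF H.onbD(1)[OF e] x] by simp
  ultimately show ?thesis using LIMSEQ_unique by simp
qed

end

section \<open>Eigenbases\<close>

definition eigenbasis :: "'a hspace \<Rightarrow> ('a \<Rightarrow> 'a) \<Rightarrow> (nat \<Rightarrow> 'a) \<Rightarrow> (nat \<Rightarrow> real) \<Rightarrow> bool" where
  "eigenbasis H R e \<mu> \<longleftrightarrow> onb H e \<and> symmetric_op H R \<and> \<mu> \<in> Sigma_seq \<and>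
     (\<forall>k. R (e k) = complex_of_real (\<mu> k) \<odot>\<^bsub>H\<^esub> e k)"

lemma Sigma_seqD:
  assumes "\<mu> \<in> Sigma_seq"
  shows "\<mu> \<longlonglongrightarrow> 0" "0 < \<mu> k" "\<mu> k \<le> 1" "decseq \<mu>"
proof -
  show "\<mu> \<longlonglongrightarrow> 0" "\<mu> k \<le> 1" using assms by (auto simp: Sigma_seq_def)
  show "decseq \<mu>" using assms by (intro decseq_SucI) (simp add: Sigma_seq_def)
  have "0 < \<mu> (Suc k)" "\<mu> (Suc k) \<le> \<mu> k" using assms by (simp_all add: Sigma_seq_def)
  then show "0 < \<mu> k" by linarith
qed

lemma Sigma_seq_finite_above:
  assumes "\<mu> \<in> Sigma_seq" "0 < t"
  shows "finite {k. t \<le> \<mu> k}"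
proof -
  have "\<forall>\<^sub>F k in sequentially. \<mu> k < t" by (rule order_tendstoD(2)[OF Sigma_seqD(1)[OF assms(1)] assms(2)])
  then obtain N where "\<And>k. k \<ge> N \<Longrightarrow> \<mu> k < t" by (auto simp: eventually_sequentially)
  then have "{k. t \<le> \<mu> k} \<subseteq> {..<N}" by (auto simp: not_le[symmetric])
  then show ?thesis by (rule finite_subset) simp
qed

context hilbert_space
begin

lemma eigenbasisD:
  assumes "eigenbasis H R e \<mu>"
  shows "onb H e" "symmetric_op H R" "\<mu> \<in> Sigma_seq" "R (e k) = complex_of_real (\<mu> k) \<odot> e k"
    "e k \<in> carrier H" "R \<in> bounded_ops H H"
  using assms onbD(1) by (auto simp: eigenbasis_def symmetric_op_def)

lemma eigenbasis_coord:
  assumes E: "eigenbasis H R e \<mu>" and x: "x \<in> carrier H"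
  shows "ip H (e k) (R x) = complex_of_real (\<mu> k) * ip H (e k) x"
  using symmetric_opD(3)[OF eigenbasisD(2)[OF E] eigenbasisD(5)[OF E, of k] x] eigenbasisD(4)[OF E, of k]
    eigenbasisD(5)[OF E, of k] x by (simp add: ip_simps)

text \<open>Away from the closure of the set of eigenvalues, the diagonal operator with the entries
  \<open>1/(\<mu>\<^sub>k - z)\<close> is bounded and inverts \<open>R - z\<close>.\<close>

lemma eigenbasis_spectrum:
  assumes E: "eigenbasis H R e \<mu>"
  shows "spectrum H R \<subseteq> insert 0 (range (\<lambda>k. complex_of_real (\<mu> k)))"
proof
  fix z assume z: "z \<in> spectrum H R"
  note e = eigenbasisD(1)[OF E] and Rb = eigenbasisD(6)[OF E]
  let ?X = "insert 0 (range (\<lambda>k. complex_of_real (\<mu> k)))"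
  show "z \<in> ?X"
  proof (rule ccontr)
    assume nz: "z \<notin> ?X"
    have "(\<lambda>k. complex_of_real (\<mu> k)) \<longlonglongrightarrow> complex_of_real 0"
      by (intro tendsto_of_real Sigma_seqD(1)[OF eigenbasisD(3)[OF E]])
    then have "compact ?X" using compact_sequence_with_limit by fastforce
    then have "open (- ?X)" using compact_imp_closed by blast
    then obtain c where c: "c > 0" "ball z c \<subseteq> - ?X" using nz open_contains_ball by blast
    have mz: "c \<le> cmod (complex_of_real (\<mu> k) - z)" for k
    proof -
      have "complex_of_real (\<mu> k) \<notin> ball z c" using c(2) by blast
      then show ?thesis by (simp add: dist_norm norm_minus_commute)
    qed
    define a where "a k = 1 / (complex_of_real (\<mu> k) - z)" for k
    have a: "cmod (a k) \<le> 1 / c" for k using mz[of k] c(1) by (simp add: a_def norm_divide frac_le)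
    have az: "a k * (complex_of_real (\<mu> k) - z) = 1" for k using mz[of k] c(1) by (auto simp: a_def)
    let ?S = "diag_map H e H e a"
    have S: "?S \<in> bounded_ops H H" by (rule HH.diag_map_bops[OF e e a])
    note Sp = HH.diag_map_props[OF e e a] and Rm = bops_mem[OF Rb] and ec = onbD(1)[OF e]
    have "?S (R x \<ominus> z \<odot> x) = x" if x: "x \<in> carrier H" for x
    proof (rule onb_ext[OF e])
      have m: "R x \<ominus> z \<odot> x \<in> carrier H" using x Rm by simp
      show "?S (R x \<ominus> z \<odot> x) \<in> carrier H" by (rule Sp(1)[OF m])
      fix k
      have "ip H (e k) (?S (R x \<ominus> z \<odot> x)) = a k * ((complex_of_real (\<mu> k) - z) * ip H (e k) x)"
        unfolding Sp(2)[OF m] using x Rm ec by (simp add: ip_simps eigenbasis_coord[OF E x] algebra_simps)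
      also have "\<dots> = ip H (e k) x" using az[of k] by (simp add: mult.assoc[symmetric])
      finally show "ip H (e k) (?S (R x \<ominus> z \<odot> x)) = ip H (e k) x" .
    qed (rule x)
    moreover have "R (?S x) \<ominus> z \<odot> ?S x = x" if x: "x \<in> carrier H" for x
    proof (rule onb_ext[OF e])
      have m: "?S x \<in> carrier H" by (rule Sp(1)[OF x])
      show "R (?S x) \<ominus> z \<odot> ?S x \<in> carrier H" using m Rm by simp
      fix k
      have "ip H (e k) (R (?S x) \<ominus> z \<odot> ?S x) = (a k * (complex_of_real (\<mu> k) - z)) * ip H (e k) x"
        using m Rm ec by (simp add: ip_simps eigenbasis_coord[OF E m] Sp(2)[OF x] algebra_simps)
      then show "ip H (e k) (R (?S x) \<ominus> z \<odot> ?S x) = ip H (e k) x" using az[of k] by simp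
    qed (rule x)
    ultimately show False using z S unfolding spectrum_def by blast
  qed
qed

lemma eigenbasis_is_eigenvalue:
  assumes E: "eigenbasis H R e \<mu>"
  shows "is_eigenvalue H R z \<longleftrightarrow> (\<exists>k. z = complex_of_real (\<mu> k))"
proof
  assume "is_eigenvalue H R z"
  then obtain x where x: "x \<in> carrier H" "R x = z \<odot> x" "x \<noteq> \<zero>" by (auto simp: is_eigenvalue_iff)
  obtain k where k: "ip H (e k) x \<noteq> 0" using onbD(4)[OF eigenbasisD(1)[OF E] x(1)] x(3) by blast
  have "complex_of_real (\<mu> k) * ip H (e k) x = z * ip H (e k) x"
    using eigenbasis_coord[OF E x(1), of k] x eigenbasisD(5)[OF E] by (auto simp: ip_simps)
  then show "\<exists>k. z = complex_of_real (\<mu> k)" using k by auto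
next
  assume "\<exists>k. z = complex_of_real (\<mu> k)"
  then obtain k where k: "z = complex_of_real (\<mu> k)" by blast
  have "ip H (e k) (e k) = 1" using onbD(2)[OF eigenbasisD(1)[OF E]] by simp
  then have "e k \<noteq> \<zero>" using eigenbasisD(5)[OF E, of k] by auto
  then show "is_eigenvalue H R z" unfolding is_eigenvalue_iff using eigenbasisD(4,5)[OF E, of k] k by blast
qed

lemma eigenbasis_multiplicity:
  assumes E: "eigenbasis H R e \<mu>"
  shows "finite {j. complex_of_real (\<mu> j) = complex_of_real (\<mu> k)}"
    "finite_mult H R (complex_of_real (\<mu> k))"
    "mult_eig H R (complex_of_real (\<mu> k)) = card {j. complex_of_real (\<mu> j) = complex_of_real (\<mu> k)}"
proof -
  let ?z = "complex_of_real (\<mu> k)"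
  let ?N = "{j. complex_of_real (\<mu> j) = ?z}" and ?E = "{x \<in> carrier H. R x = ?z \<odot> x}"
  note e = eigenbasisD(1)[OF E] and Rb = eigenbasisD(6)[OF E] and ec = eigenbasisD(5)[OF E]
  have "?N \<subseteq> {j. \<mu> k \<le> \<mu> j}" by auto
  then show fin: "finite ?N"
    by (rule finite_subset) (rule Sigma_seq_finite_above[OF eigenbasisD(3)[OF E] Sigma_seqD(2)[OF eigenbasisD(3)[OF E]]])
  then obtain h where h: "bij_betw h {0..<card ?N} ?N" using ex_bij_betw_nat_finite by blast
  let ?m = "card ?N"
  define u where "u i = e (h i)" for i
  have hN: "h i \<in> ?N" if "i < ?m" for i using bij_betwE[OF h] that by simp
  have u: "orthonormal H u ?m"
    unfolding orthonormal_def
  proof (intro conjI allI impI)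
    show "u i \<in> carrier H" for i using ec by (simp add: u_def)
    show "ip H (u i) (u j) = (if i = j then 1 else 0)" if "i < ?m" "j < ?m" for i j
    proof -
      have "h i = h j \<longleftrightarrow> i = j" using bij_betw_imp_inj_on[OF h] that by (auto simp: inj_on_def)
      then show ?thesis by (simp add: u_def onbD(2)[OF e])
    qed
  qed
  have uE: "\<forall>i<?m. u i \<in> ?E"
  proof (intro allI impI)
    fix i assume "i < ?m"
    then have "complex_of_real (\<mu> (h i)) = ?z" using hN by simp
    then show "u i \<in> ?E" using ec eigenbasisD(4)[OF E, of "h i"] by (simp add: u_def)
  qed
  have span: "\<forall>x\<in>?E. x = orth_proj H u ?m x"
  proof
    fix x assume "x \<in> ?E"
    then have x: "x \<in> carrier H" "R x = ?z \<odot> x" by auto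
    show "x = orth_proj H u ?m x"
    proof (rule onb_ext[OF e x(1) orth_proj_mem[OF u]])
      fix j
      have "ip H (e j) (orth_proj H u ?m x) = (\<Sum>i<?m. ip H (u i) x * ip H (e j) (u i))"
        unfolding orth_proj_def by (rule ip_lin_comb_right[OF orthonormalD(1)[OF u] ec])
      also have "\<dots> = (\<Sum>i\<in>{0..<?m}. (\<lambda>l. ip H (e l) x * ip H (e j) (e l)) (h i))"
        by (simp add: u_def atLeast0LessThan)
      also have "\<dots> = (\<Sum>l\<in>?N. ip H (e l) x * ip H (e j) (e l))"
        by (rule sum.reindex_bij_betw[OF h])
      also have "\<dots> = (\<Sum>l\<in>?N. if l = j then ip H (e j) x else 0)"
        by (rule sum.cong) (auto simp: onbD(2)[OF e])
      also have "\<dots> = (if j \<in> ?N then ip H (e j) x else 0)" using fin by simp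
      also have "\<dots> = ip H (e j) x"
      proof (cases "j \<in> ?N")
        case False
        have "complex_of_real (\<mu> j) * ip H (e j) x = ?z * ip H (e j) x"
          using eigenbasis_coord[OF E x(1), of j] x ec by (auto simp: ip_simps)
        then have "ip H (e j) x = 0" using False by auto
        then show ?thesis by simp
      qed simp
      finally show "ip H (e j) x = ip H (e j) (orth_proj H u ?m x)" by simp
    qed
  qed
  note d = dim_orthonormal_basis[OF lin_subspace_eigenspace[OF Rb] u uE span]
  show "finite_mult H R ?z" "mult_eig H R ?z = ?m"
    using d by (simp_all add: finite_mult_def mult_eig_def eigspace_def)
qed

lemma eigenbasis_disc_spectrum:
  assumes E: "eigenbasis H R e \<mu>"
  shows "z \<in> disc_spectrum H R \<longleftrightarrow> is_eigenvalue H R z"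
proof
  assume ev: "is_eigenvalue H R z"
  then obtain k where k: "z = complex_of_real (\<mu> k)" using eigenbasis_is_eigenvalue[OF E] by blast
  obtain x where x: "x \<in> carrier H" "R x = z \<odot> x" "x \<noteq> \<zero>" using ev by (auto simp: is_eigenvalue_iff)
  have zs: "z \<in> spectrum H R"
  proof (rule ccontr)
    assume "z \<notin> spectrum H R"
    then obtain S where S: "S \<in> bounded_ops H H" "\<forall>x\<in>carrier H. S (R x \<ominus> z \<odot> x) = x"
      unfolding spectrum_def by blast
    then have "S \<zero> = x" using x by force
    then show False using HH.bops_zero[OF S(1)] x by simp
  qed
  have mp: "0 < \<mu> k" by (rule Sigma_seqD(2)[OF eigenbasisD(3)[OF E]])
  have "\<not> z islimpt spectrum H R"
  proof
    assume "z islimpt spectrum H R"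
    then have inf: "infinite (spectrum H R \<inter> ball z (\<mu> k / 2))"
      using mp unfolding islimpt_eq_infinite_ball by simp
    have "spectrum H R \<inter> ball z (\<mu> k / 2) \<subseteq> (\<lambda>j. complex_of_real (\<mu> j)) ` {j. \<mu> k / 2 \<le> \<mu> j}"
    proof
      fix w assume w: "w \<in> spectrum H R \<inter> ball z (\<mu> k / 2)"
      then have dw: "cmod (z - w) < \<mu> k / 2" by (simp add: dist_norm)
      have "w \<noteq> 0" using dw mp k by auto
      then obtain j where j: "w = complex_of_real (\<mu> j)" using eigenbasis_spectrum[OF E] w by auto
      have "cmod (z - w) = \<bar>\<mu> k - \<mu> j\<bar>" unfolding k j by (metis norm_of_real of_real_diff)
      then have "\<mu> k / 2 \<le> \<mu> j" using dw by linarith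
      then show "w \<in> (\<lambda>j. complex_of_real (\<mu> j)) ` {j. \<mu> k / 2 \<le> \<mu> j}" using j by blast
    qed
    moreover have "finite {j. \<mu> k / 2 \<le> \<mu> j}"
      by (rule Sigma_seq_finite_above[OF eigenbasisD(3)[OF E]]) (use mp in simp)
    ultimately show False using inf finite_subset by blast
  qed
  then show "z \<in> disc_spectrum H R"
    using zs ev eigenbasis_multiplicity(2)[OF E, of k] k by (simp add: disc_spectrum_def isolated_in_islimpt_iff)
qed (simp add: disc_spectrum_def)

end

text \<open>At the first index where the sequences differ, the larger of the two values is attained more
  often by the sequence that takes it there: the other one cannot attain it later.\<close>

lemma decseq_determined_by_fibres:
  fixes \<mu> \<nu> :: "nat \<Rightarrow> real"
  assumes dec: "decseq \<mu>" "decseq \<nu>"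
    and fin: "\<And>t. t \<in> range \<mu> \<union> range \<nu> \<Longrightarrow> finite {k. \<mu> k = t} \<and> finite {k. \<nu> k = t}"
    and card: "\<And>t. t \<in> range \<mu> \<union> range \<nu> \<Longrightarrow> card {k. \<mu> k = t} = card {k. \<nu> k = t}"
  shows "\<mu> = \<nu>"
proof -
  have key: "\<not> \<alpha> n < \<beta> n"
    if ab: "decseq \<alpha>" "decseq \<beta>" "\<And>j. j < n \<Longrightarrow> \<alpha> j = \<beta> j" "finite {k. \<beta> k = \<beta> n}"
      "card {k. \<alpha> k = \<beta> n} = card {k. \<beta> k = \<beta> n}" for \<alpha> \<beta> :: "nat \<Rightarrow> real" and n
  proof
    assume less: "\<alpha> n < \<beta> n"
    have "k < n" if "\<alpha> k = \<beta> n" for k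
      using decseqD[OF ab(1), of n k] less that by (cases "k < n") auto
    then have "\<beta> k = \<beta> n" if "\<alpha> k = \<beta> n" for k using ab(3)[of k] that by simp
    then have "{k. \<alpha> k = \<beta> n} \<subseteq> {k. \<beta> k = \<beta> n}" by blast
    moreover have "n \<notin> {k. \<alpha> k = \<beta> n}" "n \<in> {k. \<beta> k = \<beta> n}" using less by simp_all
    ultimately have "{k. \<alpha> k = \<beta> n} \<subset> {k. \<beta> k = \<beta> n}" by blast
    then have "card {k. \<alpha> k = \<beta> n} < card {k. \<beta> k = \<beta> n}" by (rule psubset_card_mono[OF ab(4)])
    then show False using ab(5) by simp
  qed
  have "\<mu> n = \<nu> n" for n
  proof (induction n rule: less_induct)
    case (less n)
    have "\<not> \<mu> n < \<nu> n" by (rule key[OF dec less]) (use fin card in auto)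
    moreover have "\<not> \<nu> n < \<mu> n" by (rule key[OF dec(2,1) less[symmetric]]) (use fin card in auto)
    ultimately show ?case by simp
  qed
  then show ?thesis by blast
qed

text \<open>The property that characterizes \<^const>\<open>eig_seq\<close>.\<close>

definition eig_enum :: "'a hspace \<Rightarrow> ('a \<Rightarrow> 'a) \<Rightarrow> (nat \<Rightarrow> real) \<Rightarrow> bool" where
  "eig_enum H R \<mu> \<longleftrightarrow> decseq \<mu> \<and>
     (\<forall>k. is_eigenvalue H R (complex_of_real (\<mu> k))) \<and>
     (\<forall>z. is_eigenvalue H R z \<longrightarrow>
        finite {k. complex_of_real (\<mu> k) = z} \<and>
        card {k. complex_of_real (\<mu> k) = z} = mult_eig H R z)"

lemma eig_seq_def': "eig_seq (H, R) = (THE \<mu>. eig_enum H R \<mu>)"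
  by (simp add: eig_seq_def eig_enum_def)

lemma eig_enum_unique:
  assumes "eig_enum H R \<mu>" "eig_enum H R \<nu>"
  shows "\<mu> = \<nu>"
proof (rule decseq_determined_by_fibres)
  show "decseq \<mu>" "decseq \<nu>" using assms by (simp_all add: eig_enum_def)
  fix t assume "t \<in> range \<mu> \<union> range \<nu>"
  then have ev: "is_eigenvalue H R (complex_of_real t)" using assms by (auto simp: eig_enum_def)
  have "finite {k. \<rho> k = t} \<and> card {k. \<rho> k = t} = mult_eig H R (complex_of_real t)"
    if r: "eig_enum H R \<rho>" for \<rho>
  proof -
    have "finite {k. complex_of_real (\<rho> k) = complex_of_real t} \<and>
        card {k. complex_of_real (\<rho> k) = complex_of_real t} = mult_eig H R (complex_of_real t)"
      using r ev by (simp only: eig_enum_def)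
    then show ?thesis by (simp only: of_real_eq_iff)
  qed
  from this[OF assms(1)] this[OF assms(2)]
  show "finite {k. \<mu> k = t} \<and> finite {k. \<nu> k = t}" "card {k. \<mu> k = t} = card {k. \<nu> k = t}" by simp_all
qed

lemma (in hilbert_space) eigenbasis_eig_seq:
  assumes E: "eigenbasis H R e \<mu>"
  shows "eig_seq (H, R) = \<mu>"
proof -
  have "eig_enum H R \<mu>"
    unfolding eig_enum_def
    using Sigma_seqD(4)[OF eigenbasisD(3)[OF E]] eigenbasis_is_eigenvalue[OF E] eigenbasis_multiplicity[OF E] by auto
  then show ?thesis unfolding eig_seq_def' using eig_enum_unique by blast
qed

context hilbert_pair
begin

lemma eigenbasis_unitarily_equivalent:
  assumes E: "eigenbasis H R e \<mu>" and F: "eigenbasis K S f \<mu>"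
  shows "unitarily_equivalent (H, R) (K, S)"
proof -
  interpret KH: hilbert_pair K H by unfold_locales
  note e = H.eigenbasisD(1)[OF E] and f = K.eigenbasisD(1)[OF F]
  let ?one = "\<lambda>k::nat. 1 :: complex"
  have b: "\<And>k. cmod (?one k) \<le> 1" by simp
  let ?U = "diag_map H e K f ?one" and ?V = "diag_map K f H e ?one"
  have U: "?U \<in> bounded_ops H K" by (rule diag_map_bops[OF e f b])
  note Up = diag_map_props[OF e f b] and Vp = KH.diag_map_props[OF f e b]
  have adj: "adj H K ?U y = ?V y" if y: "y \<in> carrier K" for y
    by (rule adj_eqI[OF U y Vp(1)[OF y]]) (use diag_map_adjoint[OF e f b _ y] in simp)
  have VU: "?V (?U x) = x" if "x \<in> carrier H" for x
    by (rule H.onb_ext[OF e]) (use that Up Vp in simp_all)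
  have UV: "?U (?V y) = y" if "y \<in> carrier K" for y
    by (rule K.onb_ext[OF f]) (use that Up Vp in simp_all)
  have "unitary H K ?U"
    unfolding unitary_def using U VU UV adj Up(1) by simp
  moreover have "S y = ?U (R (adj H K ?U y))" if y: "y \<in> carrier K" for y
  proof (rule K.onb_ext[OF f])
    have m: "?V y \<in> carrier H" "R (?V y) \<in> carrier H"
      using Vp(1)[OF y] bops_mem[OF H.eigenbasisD(6)[OF E]] by simp_all
    show "S y \<in> carrier K" by (rule bops_mem[OF K.eigenbasisD(6)[OF F] y])
    show "?U (R (adj H K ?U y)) \<in> carrier K" unfolding adj[OF y] by (rule Up(1)[OF m(2)])
    show "ip K (f k) (S y) = ip K (f k) (?U (R (adj H K ?U y)))" for k
      unfolding adj[OF y] Up(2)[OF m(2)] H.eigenbasis_coord[OF E m(1)] Vp(2)[OF y] K.eigenbasis_coord[OF F y] by simp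
  qed
  ultimately show ?thesis unfolding unitarily_equivalent_def by auto
qed

lemma unitarily_equivalent_eigenbasis:
  assumes ue: "unitarily_equivalent (H, R) (K, S)" and E: "eigenbasis H R e \<mu>" and S: "symmetric_op K S"
  shows "\<exists>f. eigenbasis K S f \<mu>"
proof -
  obtain U where U: "unitary H K U" "\<And>y. y \<in> carrier K \<Longrightarrow> S y = U (R (adj H K U y))"
    using ue unfolding unitarily_equivalent_def by auto
  note u = unitary_props[OF U(1)]
  note e = H.eigenbasisD(1)[OF E] and ec = H.eigenbasisD(5)[OF E]
  have "onb K (\<lambda>k. U (e k))"
    unfolding onb_def
  proof (intro conjI allI ballI impI)
    show "U (e n) \<in> carrier K" for n by (rule bops_mem[OF u(1) ec])
    show "ip K (U (e i)) (U (e j)) = (if i = j then 1 else 0)" for i j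
      unfolding u(5)[OF ec ec] by (rule H.onbD(2)[OF e])
    fix y assume y: "y \<in> carrier K" "\<forall>n. ip K (U (e n)) y = 0"
    have "adj H K U y = \<zero>\<^bsub>H\<^esub>"
      by (rule H.onbD(4)[OF e bops_mem[OF u(2) y(1)]]) (use adj_ip[OF u(1) ec y(1)] y(2) in simp)
    then show "y = \<zero>\<^bsub>K\<^esub>" using u(4)[OF y(1)] bops_zero[OF u(1)] by simp
  qed
  moreover have "S (U (e k)) = complex_of_real (\<mu> k) \<odot>\<^bsub>K\<^esub> U (e k)" for k
    using U(2)[OF bops_mem[OF u(1) ec]] u(3)[OF ec] H.eigenbasisD(4)[OF E] bops_smult[OF u(1) ec] by simp
  ultimately show ?thesis
    using S H.eigenbasisD(3)[OF E] unfolding eigenbasis_def by (intro exI[of _ "\<lambda>k. U (e k)"]) simp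
qed

end

section \<open>The spectral theorem for compact operators\<close>

context hilbert_space
begin

lemma compact_op_subsequence:
  assumes T: "compact_op H T" and x: "\<And>n. x n \<in> carrier H" "\<And>n. hnorm H (x n) \<le> 1"
  shows "\<exists>w\<in>carrier H. \<exists>r::nat \<Rightarrow> nat. strict_mono r \<and> (\<lambda>n. hnorm H (T (x (r n)) \<ominus> w)) \<longlonglongrightarrow> 0"
proof -
  have Tb: "T \<in> bounded_ops H H" using T by (simp add: compact_op_def)
  let ?B = "T ` {x \<in> carrier H. hnorm H x \<le> 1}"
  let ?C = "htopology H closure_of ?B"
  have comp: "compactin MS.mtopology ?C" using T by (simp add: compact_op_def htopology_def)
  have B: "?B \<subseteq> topspace (htopology H)" using bops_mem[OF Tb] by (auto simp: htopology_def)
  have "range (\<lambda>n. T (x n)) \<subseteq> ?C" using x closure_of_subset[OF B] by auto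
  then obtain w r where w: "strict_mono r" "limitin MS.mtopology ((\<lambda>n. T (x n)) \<circ> r) w sequentially"
    using comp unfolding MS.compactin_sequentially by blast
  have wc: "w \<in> carrier H" using w(2) MS.limitin_mspace by blast
  have "(\<lambda>n. hnorm H (((\<lambda>n. T (x n)) \<circ> r) n \<ominus> w)) \<longlonglongrightarrow> 0"
    using limitin_iff[of "(\<lambda>n. T (x n)) \<circ> r" w] w(2) wc x(1) bops_mem[OF Tb] by (simp add: htopology_def)
  then show ?thesis using w(1) wc by (auto simp: o_def)
qed

text \<open>The supremum \<open>s\<close> of the form of \<open>R\<close> on the unit sphere of an invariant subspace is an
  eigenvalue: \<open>s - R\<close> maps a maximizing sequence to a null sequence, and by compactness
  a subsequence converges.\<close>

lemma maximal_eigenvector: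
  assumes R: "R \<in> K01 H" and u: "\<And>k. k < n \<Longrightarrow> u k \<in> carrier H"
      "\<And>k. k < n \<Longrightarrow> R (u k) = complex_of_real (m k) \<odot> u k"
    and y0: "y0 \<in> carrier H" "y0 \<noteq> \<zero>" "\<And>k. k < n \<Longrightarrow> ip H (u k) y0 = 0"
  shows "\<exists>x\<in>carrier H. \<exists>s>0. hnorm H x = 1 \<and> (\<forall>k<n. ip H (u k) x = 0) \<and> R x = complex_of_real s \<odot> x \<and>
    (\<forall>y\<in>carrier H. (\<forall>k<n. ip H (u k) y = 0) \<longrightarrow> Re (ip H y (R y)) \<le> s * (hnorm H y)\<^sup>2)"
proof -
  have RB: "R \<in> B01 H" and Rc: "compact_op H R" using R by (simp_all add: K01_def)
  note S = B01_symmetric[OF RB]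
  note Rb = symmetric_opD(1)[OF S] and Rm = symmetric_opD(2)[OF S]
  define M where "M = {x \<in> carrier H. \<forall>k<n. ip H (u k) x = 0}"
  have Mc: "x \<in> carrier H" if "x \<in> M" for x using that by (simp add: M_def)
  have RM: "R x \<in> M" if x: "x \<in> M" for x
  proof -
    have "ip H (u k) (R x) = 0" if k: "k < n" for k
      using symmetric_opD(3)[OF S u(1)[OF k] Mc[OF x]] u(2)[OF k] u(1)[OF k] x k
      by (simp add: ip_smult_left M_def)
    then show ?thesis using Rm Mc[OF x] by (simp add: M_def)
  qed
  define A where "A = {Re (ip H y (R y)) | y. y \<in> M \<and> hnorm H y = 1}"
  have unit: "complex_of_real (1 / hnorm H y) \<odot> y \<in> M"
      "hnorm H (complex_of_real (1 / hnorm H y) \<odot> y) = 1"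
      "Re (ip H (complex_of_real (1 / hnorm H y) \<odot> y) (R (complex_of_real (1 / hnorm H y) \<odot> y)))
        = Re (ip H y (R y)) / (hnorm H y)\<^sup>2"
    if y: "y \<in> M" "y \<noteq> \<zero>" for y
  proof -
    have p: "hnorm H y > 0" using hnorm_pos Mc y by blast
    show "complex_of_real (1 / hnorm H y) \<odot> y \<in> M"
      using y u(1) by (simp add: M_def ip_smult_right)
    show "hnorm H (complex_of_real (1 / hnorm H y) \<odot> y) = 1"
      using p Mc[OF y(1)] by (simp add: hnorm_smult norm_divide)
    have e: "ip H (complex_of_real (1 / hnorm H y) \<odot> y) (R (complex_of_real (1 / hnorm H y) \<odot> y))
        = complex_of_real (1 / (hnorm H y)\<^sup>2) * ip H y (R y)"
      unfolding bops_smult[OF Rb Mc[OF y(1)]] using Mc[OF y(1)] Rm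
      by (simp add: ip_simps power2_eq_square)
    show "Re (ip H (complex_of_real (1 / hnorm H y) \<odot> y) (R (complex_of_real (1 / hnorm H y) \<odot> y)))
        = Re (ip H y (R y)) / (hnorm H y)\<^sup>2" unfolding e by (simp del: of_real_power of_real_divide)
  qed
  have y0M: "y0 \<in> M" using y0 by (simp add: M_def)
  have ne: "A \<noteq> {}" using unit(1,2)[OF y0M y0(2)] by (auto simp: A_def)
  have bdd: "bdd_above A"
    by (rule bdd_aboveI[of _ 1]) (use B01_form_le[OF RB] Mc in \<open>force simp: A_def\<close>)
  define s where "s = Sup A"
  have le1: "Re (ip H y (R y)) \<le> s" if "y \<in> M" "hnorm H y = 1" for y
    unfolding s_def by (rule cSup_upper[OF _ bdd]) (use that in \<open>auto simp: A_def\<close>)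
  have le: "Re (ip H y (R y)) \<le> s * (hnorm H y)\<^sup>2" if y: "y \<in> M" for y
  proof (cases "y = \<zero>")
    case True
    then show ?thesis using Rm by simp
  next
    case False
    have "(hnorm H y)\<^sup>2 > 0" using hnorm_pos[OF Mc[OF y] False] by simp
    moreover have "Re (ip H y (R y)) / (hnorm H y)\<^sup>2 \<le> s"
      using le1[OF unit(1,2)[OF y False]] unfolding unit(3)[OF y False] .
    ultimately show ?thesis by (simp add: field_simps)
  qed
  have s0: "s > 0"
  proof -
    have "R y0 \<noteq> \<zero>" using B01_kernel[OF RB y0(1)] y0(2) by blast
    then have "0 < (hnorm H (R y0))\<^sup>2" using hnorm_pos[OF Rm[OF y0(1)]] by simp
    then have "0 < s * (hnorm H y0)\<^sup>2" using B01_norm_sq_le_form[OF RB y0(1)] le[OF y0M] by linarith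
    then show ?thesis by (simp add: zero_less_mult_iff)
  qed
  let ?N = "\<lambda>x. complex_of_real s \<odot> x \<ominus> R x"
  have Nsym: "symmetric_op H ?N"
    unfolding symmetric_op_def
    by (intro conjI ballI HH.bops_minus[OF smult_bops Rb]) (simp add: ip_simps Rm symmetric_opD(3)[OF S])
  note Nb = symmetric_opD(1)[OF Nsym] and Nm = symmetric_opD(2)[OF Nsym]
  have Nform: "Re (ip H y (?N y)) = s * (hnorm H y)\<^sup>2 - Re (ip H y (R y))" if "y \<in> carrier H" for y
    using that Rm by (simp add: ip_simps ip_self flip: of_real_power of_real_mult)
  have Nbound: "(hnorm H (?N y))\<^sup>2 \<le> s * Re (ip H y (?N y))" if y: "y \<in> M" for y
  proof (rule nonneg_form_norm_bound[OF Nsym, where M = M])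
    show "M \<subseteq> carrier H" using Mc by blast
    show "?N x \<in> M" if "x \<in> M" for x
      using RM[OF that] that u(1) by (simp add: M_def ip_simps)
    show "x \<ominus> c \<odot> y \<in> M" if "x \<in> M" "y \<in> M" for c x y
      using that u(1) by (simp add: M_def ip_simps)
    show "0 \<le> Re (ip H x (?N x))" if "x \<in> M" for x
      unfolding Nform[OF Mc[OF that]] using le[OF that] by simp
    show "Re (ip H x (?N x)) \<le> s * (hnorm H x)\<^sup>2" if "x \<in> M" for x
      unfolding Nform[OF Mc[OF that]] using B01_form_nonneg[OF RB Mc[OF that]] by simp
  qed (use s0 y in auto)
  have "\<exists>y\<in>M. hnorm H y = 1 \<and> s - 1 / real (Suc j) < Re (ip H y (R y))" for j
    using less_cSupD[OF ne, of "s - 1 / real (Suc j)"] unfolding s_def A_def by auto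
  then obtain y where y: "\<And>j. y j \<in> M" "\<And>j. hnorm H (y j) = 1"
      "\<And>j. s - 1 / real (Suc j) < Re (ip H (y j) (R (y j)))" by metis
  have yc: "y j \<in> carrier H" for j using y Mc by blast
  have Ny0: "(\<lambda>j. hnorm H (?N (y j))) \<longlonglongrightarrow> 0"
  proof -
    have b: "(hnorm H (?N (y j)))\<^sup>2 \<le> s * (1 / real (Suc j))" for j
    proof -
      have "(hnorm H (?N (y j)))\<^sup>2 \<le> s * (s - Re (ip H (y j) (R (y j))))"
        using Nbound[OF y(1)[of j]] Nform[OF yc[of j]] y(2)[of j] by simp
      also have "\<dots> \<le> s * (1 / real (Suc j))" using y(3)[of j] s0 by (intro mult_left_mono) auto
      finally show ?thesis .
    qed
    have l: "(\<lambda>j. s * (1 / real (Suc j))) \<longlonglongrightarrow> 0"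
      using tendsto_mult_left[OF LIMSEQ_Suc[OF lim_1_over_n], of s] by simp
    have "(\<lambda>j. (hnorm H (?N (y j)))\<^sup>2) \<longlonglongrightarrow> 0"
    proof (rule Lim_null_comparison[OF _ l], rule always_eventually, rule allI)
      show "norm ((hnorm H (?N (y j)))\<^sup>2) \<le> s * (1 / real (Suc j))" for j
        using b[of j] by (simp only: real_norm_def abs_power2)
    qed
    then have "(\<lambda>j. sqrt ((hnorm H (?N (y j)))\<^sup>2)) \<longlonglongrightarrow> sqrt 0" by (rule tendsto_real_sqrt)
    then show ?thesis using Nm yc by simp
  qed
  have y1: "hnorm H (y j) \<le> 1" for j using y(2)[of j] by simp
  obtain w r where w: "w \<in> carrier H" "strict_mono (r::nat \<Rightarrow> nat)" "(\<lambda>j. hnorm H (R (y (r j)) \<ominus> w)) \<longlonglongrightarrow> 0"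
    using compact_op_subsequence[of R y, OF Rc yc y1] by blast
  let ?x = "complex_of_real (1 / s) \<odot> w"
  have xc: "?x \<in> carrier H" using w by simp
  have yx: "(\<lambda>j. hnorm H (y (r j) \<ominus> ?x)) \<longlonglongrightarrow> 0"
  proof (rule Lim_null_comparison)
    show "(\<lambda>j. (1 / s) * (hnorm H (?N (y (r j))) + hnorm H (R (y (r j)) \<ominus> w))) \<longlonglongrightarrow> 0"
      using tendsto_mult_left[OF tendsto_add[OF LIMSEQ_subseq_LIMSEQ[OF Ny0 w(2)] w(3)], of "1 / s"]
      by (simp add: o_def)
    show "\<forall>\<^sub>F j in sequentially. norm (hnorm H (y (r j) \<ominus> ?x))
        \<le> (1 / s) * (hnorm H (?N (y (r j))) + hnorm H (R (y (r j)) \<ominus> w))"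
    proof (rule always_eventually, rule allI)
      fix j
      let ?y = "y (r j)"
      have e: "?y \<ominus> ?x = complex_of_real (1 / s) \<odot> (?N ?y \<oplus> (R ?y \<ominus> w))"
        by (rule ip_ext) (use yc Rm w s0 in \<open>simp_all add: ip_simps field_simps\<close>)
      have "hnorm H (?y \<ominus> ?x) = (1 / s) * hnorm H (?N ?y \<oplus> (R ?y \<ominus> w))"
        unfolding e using yc Rm w s0 by (simp add: hnorm_smult norm_divide)
      also have "\<dots> \<le> (1 / s) * (hnorm H (?N ?y) + hnorm H (R ?y \<ominus> w))"
        using s0 yc Rm w by (intro mult_left_mono hnorm_triangle) auto
      finally show "norm (hnorm H (?y \<ominus> ?x)) \<le> (1 / s) * (hnorm H (?N ?y) + hnorm H (R ?y \<ominus> w))"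
        using yc xc by simp
    qed
  qed
  have x1: "hnorm H ?x = 1"
    using tendsto_hnorm[OF yc xc yx] y(2) by (simp add: LIMSEQ_const_iff)
  have xM: "ip H (u k) ?x = 0" if k: "k < n" for k
  proof -
    have "(\<lambda>j. ip H (u k) (y (r j))) \<longlonglongrightarrow> ip H (u k) ?x" by (rule tendsto_ip[OF yc xc u(1)[OF k] yx])
    moreover have "ip H (u k) (y (r j)) = 0" for j using y(1) k by (simp add: M_def)
    ultimately show ?thesis by (simp add: LIMSEQ_const_iff)
  qed
  obtain C where C: "C > 0" "\<And>x. x \<in> carrier H \<Longrightarrow> hnorm H (?N x) \<le> C * hnorm H x"
    using HH.bops_bound[OF Nb] by blast
  have "hnorm H (?N ?x) \<le> 0"
  proof (rule LIMSEQ_le_const)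
    show "(\<lambda>j. C * hnorm H (y (r j) \<ominus> ?x) + hnorm H (?N (y (r j)))) \<longlonglongrightarrow> 0"
      using tendsto_add[OF tendsto_mult_left[OF yx, of C] LIMSEQ_subseq_LIMSEQ[OF Ny0 w(2)]] by (simp add: o_def)
    have "hnorm H (?N ?x) \<le> C * hnorm H (y (r j) \<ominus> ?x) + hnorm H (?N (y (r j)))" for j
    proof -
      have "hnorm H (?N ?x) \<le> hnorm H (?N ?x \<ominus> ?N (y (r j))) + hnorm H (?N (y (r j)))"
        by (rule hnorm_le_diff_add[OF Nm[OF xc] Nm[OF yc]])
      also have "?N ?x \<ominus> ?N (y (r j)) = ?N (?x \<ominus> y (r j))"
        using HH.bops_diff[OF Nb xc yc] by simp
      also have "hnorm H \<dots> \<le> C * hnorm H (?x \<ominus> y (r j))" by (rule C(2)) (use xc yc in simp)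
      also have "hnorm H (?x \<ominus> y (r j)) = hnorm H (y (r j) \<ominus> ?x)" by (rule hnorm_minus_commute[OF xc yc])
      finally show ?thesis by simp
    qed
    then show "\<exists>N. \<forall>j\<ge>N. hnorm H (?N ?x) \<le> C * hnorm H (y (r j) \<ominus> ?x) + hnorm H (?N (y (r j)))" by blast
  qed
  then have "?N ?x = \<zero>" by (rule hnorm_le_0[OF _ Nm[OF xc]])
  then have "R ?x = complex_of_real s \<odot> ?x"
    using diff_eq_zero_iff[of "complex_of_real s \<odot> ?x" "R ?x"] Rm[OF xc] xc by simp
  then show ?thesis
    by (intro bexI[OF _ xc] exI[of _ s] conjI) (use s0 x1 xM le in \<open>simp_all add: M_def\<close>)
qed

text \<open>Eigenvectors are chosen recursively, each maximizing the form on the orthogonal complement of its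
  predecessors. By compactness the eigenvalues tend to 0, so the form vanishes on vectors
  orthogonal to all eigenvectors; as \<open>R\<close> is injective, there is no such vector except 0.\<close>

theorem spectral_theorem_compact:
  assumes R: "R \<in> K01 H" and inf: "\<not> vectorspace.fin_dim (class_ring :: complex ring) H"
  shows "\<exists>e \<mu>. eigenbasis H R e \<mu>"
proof -
  have RB: "R \<in> B01 H" and Rc: "compact_op H R" using R by (simp_all add: K01_def)
  note S = B01_symmetric[OF RB]
  note Rb = symmetric_opD(1)[OF S] and Rm = symmetric_opD(2)[OF S]
  define m where "m x = Re (ip H x (R x))" for x
  define Q where "Q n u \<longleftrightarrow> u n \<in> carrier H \<and> hnorm H (u n) = 1 \<and> (\<forall>k<n. ip H (u k) (u n) = 0) \<and>
      R (u n) = complex_of_real (m (u n)) \<odot> u n \<and> 0 < m (u n) \<and>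
      (\<forall>y\<in>carrier H. (\<forall>k<n. ip H (u k) y = 0) \<longrightarrow> Re (ip H y (R y)) \<le> m (u n) * (hnorm H y)\<^sup>2)" for n :: nat and u
  have "\<exists>u. \<forall>n. Q n u"
  proof (rule recursive_choice)
    fix n u v assume eq: "\<And>k. k \<le> n \<Longrightarrow> u k = v k" and q: "Q n u"
    have "u n = v n" "\<And>k. k < n \<Longrightarrow> u k = v k" using eq by simp_all
    then show "Q n v" using q unfolding Q_def by simp
  next
    fix n u assume q: "\<And>k. k < n \<Longrightarrow> Q k u"
    have uc: "u k \<in> carrier H" "hnorm H (u k) = 1" "R (u k) = complex_of_real (m (u k)) \<odot> u k" if "k < n" for k
      using q[OF that] by (simp_all add: Q_def)
    have o: "orthonormal H u n"
      unfolding orthonormal_def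
    proof (intro conjI allI impI)
      fix i j assume ij: "i < n" "j < n"
      consider "i = j" | "i < j" | "j < i" by linarith
      then show "ip H (u i) (u j) = (if i = j then 1 else 0)"
      proof cases
        case 1
        then show ?thesis using ip_self[OF uc(1)[OF ij(1)]] uc(2)[OF ij(1)] by simp
      next
        case 2
        then show ?thesis using q[OF ij(2)] by (simp add: Q_def)
      next
        case 3
        then have "ip H (u j) (u i) = 0" using q[OF ij(1)] by (simp add: Q_def)
        then show ?thesis using ip_cnj[OF uc(1)[OF ij(2)] uc(1)[OF ij(1)]] 3 by simp
      qed
    qed (rule uc(1))
    obtain y0 where y0: "y0 \<in> carrier H" "y0 \<noteq> \<zero>" "\<And>k. k < n \<Longrightarrow> ip H (u k) y0 = 0"
      using orthogonal_vector_exists[OF inf o] by blast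
    obtain x s where x: "x \<in> carrier H" "s > 0" "hnorm H x = 1" "\<forall>k<n. ip H (u k) x = 0" "R x = complex_of_real s \<odot> x"
        "\<forall>y\<in>carrier H. (\<forall>k<n. ip H (u k) y = 0) \<longrightarrow> Re (ip H y (R y)) \<le> s * (hnorm H y)\<^sup>2"
      using maximal_eigenvector[of R n u "\<lambda>k. m (u k)" y0, OF R uc(1) uc(3) y0] by blast
    have "m x = s" unfolding m_def x(5) using x(1,3) by (simp add: ip_smult_right ip_self)
    then have "Q n (u(n := x))" unfolding Q_def using x by simp
    then show "\<exists>x. Q n (u(n := x))" by blast
  qed
  then obtain e where e: "\<And>n. Q n e" by blast
  define \<mu> where "\<mu> n = m (e n)" for n
  have ec: "e n \<in> carrier H" and en: "hnorm H (e n) = 1" and Re: "R (e n) = complex_of_real (\<mu> n) \<odot> e n"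
    and mp: "0 < \<mu> n" for n using e[of n] by (simp_all add: Q_def \<mu>_def)
  have lt: "ip H (e i) (e j) = 0" if "i < j" for i j using e[of j] that by (simp add: Q_def)
  have eo: "ip H (e i) (e j) = (if i = j then 1 else 0)" for i j
  proof -
    consider "i = j" | "i < j" | "j < i" by linarith
    then show ?thesis
    proof cases
      case 1
      then show ?thesis using ip_self[OF ec[of i]] en[of i] by simp
    next
      case 2
      then show ?thesis using lt by simp
    next
      case 3
      then show ?thesis using lt[of j i] ip_cnj[OF ec[of j] ec[of i]] by simp
    qed
  qed
  have max: "Re (ip H y (R y)) \<le> \<mu> n * (hnorm H y)\<^sup>2" if "y \<in> carrier H" "\<And>k. k < n \<Longrightarrow> ip H (e k) y = 0" for y n
    using e[of n] that by (simp add: Q_def \<mu>_def)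
  have form: "Re (ip H (e n) (R (e n))) = \<mu> n" for n by (simp add: \<mu>_def m_def)
  have dec: "\<mu> (Suc n) \<le> \<mu> n" for n
    using max[OF ec[of "Suc n"], of n] lt en[of "Suc n"] form[of "Suc n"] by simp
  then have decs: "decseq \<mu>" by (rule decseq_SucI)
  have le1: "\<mu> n \<le> 1" for n using B01_form_le[OF RB ec[of n]] en[of n] form[of n] by simp
  have "\<mu> \<longlonglongrightarrow> 0"
  proof -
    have e1: "hnorm H (e n) \<le> 1" for n using en[of n] by simp
    obtain w r where w: "w \<in> carrier H" "strict_mono (r::nat \<Rightarrow> nat)" "(\<lambda>n. hnorm H (R (e (r n)) \<ominus> w)) \<longlonglongrightarrow> 0"
      using compact_op_subsequence[of R e, OF Rc ec e1] by blast
    show ?thesis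
    proof (rule LIMSEQ_I)
      fix \<epsilon> :: real assume eps: "\<epsilon> > 0"
      then have "\<forall>\<^sub>F n in sequentially. hnorm H (R (e (r n)) \<ominus> w) < \<epsilon> / 2"
        using w(3) by (intro order_tendstoD(2)) auto
      then obtain N where N: "\<And>n. n \<ge> N \<Longrightarrow> hnorm H (R (e (r n)) \<ominus> w) < \<epsilon> / 2"
        by (auto simp: eventually_sequentially)
      let ?i = "r N" and ?j = "r (Suc N)"
      have ij: "?i \<noteq> ?j" using w(2) by (simp add: strict_mono_eq)
      have "(hnorm H (R (e ?i) \<ominus> R (e ?j)))\<^sup>2 = (\<mu> ?i)\<^sup>2 + (\<mu> ?j)\<^sup>2"
        using hnorm_sq_diff[OF Rm[OF ec] Rm[OF ec], of ?i ?j] ec eo ij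
        by (simp add: Re hnorm_smult en ip_simps)
      then have "(\<mu> ?i)\<^sup>2 \<le> (hnorm H (R (e ?i) \<ominus> R (e ?j)))\<^sup>2" by simp
      then have "\<mu> ?i \<le> hnorm H (R (e ?i) \<ominus> R (e ?j))"
        by (rule power2_le_imp_le) (use Rm ec in simp)
      also have "\<dots> \<le> hnorm H (R (e ?i) \<ominus> w) + hnorm H (w \<ominus> R (e ?j))"
        by (rule hnorm_triangle_via) (use Rm ec w in simp_all)
      also have "\<dots> < \<epsilon>"
        using N[of N] N[of "Suc N"] hnorm_minus_commute[OF w(1) Rm[OF ec], of ?j] by simp
      finally have "\<mu> ?i < \<epsilon>" .
      then have "norm (\<mu> n - 0) < \<epsilon>" if "n \<ge> ?i" for n
        using decseqD[OF decs that] mp[of n] by simp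
      then show "\<exists>no. \<forall>n\<ge>no. norm (\<mu> n - 0) < \<epsilon>" by blast
    qed
  qed
  note lim = this
  have "onb H e"
    unfolding onb_def
  proof (intro conjI allI ballI impI)
    fix x assume x: "x \<in> carrier H" "\<forall>n. ip H (e n) x = 0"
    have "(\<lambda>n. \<mu> n * (hnorm H x)\<^sup>2) \<longlonglongrightarrow> 0" using tendsto_mult_right[OF lim, of "(hnorm H x)\<^sup>2"] by simp
    then have "Re (ip H x (R x)) \<le> 0" by (rule LIMSEQ_le_const) (use max[OF x(1)] x(2) in blast)
    then have "(hnorm H (R x))\<^sup>2 \<le> 0" using B01_norm_sq_le_form[OF RB x(1)] by linarith
    then have "R x = \<zero>" using hnorm_eq_0_iff[OF Rm[OF x(1)]] by simp
    then show "x = \<zero>" by (rule B01_kernel[OF RB x(1)])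
  qed (use ec eo in auto)
  moreover have "\<mu> \<in> Sigma_seq" unfolding Sigma_seq_def using lim mp dec le1 by simp
  ultimately show ?thesis using S Re unfolding eigenbasis_def by blast
qed

section \<open>Compact operators with prescribed eigenvalues\<close>

text \<open>Nets with points outside of \<open>S\<close> suffice, because every useful point of a net for \<open>\<epsilon>/2\<close> can be replaced
  by a point of \<open>S\<close>.\<close>

lemma mtotally_bounded_of_nets:
  assumes S: "S \<subseteq> carrier H"
    and net: "\<And>\<epsilon>. \<epsilon> > 0 \<Longrightarrow> \<exists>K. finite K \<and> K \<subseteq> carrier H \<and> (\<forall>x\<in>S. \<exists>y\<in>K. hnorm H (x \<ominus> y) < \<epsilon>)"
  shows "MS.mtotally_bounded S"
  unfolding MS.mtotally_bounded_def
proof (intro allI impI)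
  fix \<epsilon> :: real assume eps: "\<epsilon> > 0"
  obtain K where K: "finite K" "K \<subseteq> carrier H" "\<And>x. x \<in> S \<Longrightarrow> \<exists>y\<in>K. hnorm H (x \<ominus> y) < \<epsilon> / 2"
    using net[OF half_gt_zero[OF eps]] by blast
  define g where "g y = (SOME x. x \<in> S \<and> hnorm H (x \<ominus> y) < \<epsilon> / 2)" for y
  define L where "L = g ` {y \<in> K. \<exists>x\<in>S. hnorm H (x \<ominus> y) < \<epsilon> / 2}"
  have g: "g y \<in> S \<and> hnorm H (g y \<ominus> y) < \<epsilon> / 2" if "\<exists>x\<in>S. hnorm H (x \<ominus> y) < \<epsilon> / 2" for y
  proof -
    have "\<exists>x. x \<in> S \<and> hnorm H (x \<ominus> y) < \<epsilon> / 2" using that by blast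
    then show ?thesis unfolding g_def by (rule someI_ex)
  qed
  have "finite L" using K by (simp add: L_def)
  moreover have "L \<subseteq> S" using g by (auto simp: L_def)
  moreover have "S \<subseteq> (\<Union>x\<in>L. MS.mball x \<epsilon>)"
  proof
    fix x assume x: "x \<in> S"
    obtain y where y: "y \<in> K" "hnorm H (x \<ominus> y) < \<epsilon> / 2" using K(3)[OF x] by blast
    have gy: "g y \<in> S" "hnorm H (g y \<ominus> y) < \<epsilon> / 2" using g[of y] x y by blast+
    have c: "x \<in> carrier H" "y \<in> carrier H" "g y \<in> carrier H" using x y K S gy by auto
    have "hnorm H (g y \<ominus> x) < \<epsilon>"
      using hnorm_triangle_via[OF c(3,2,1)] hnorm_minus_commute[OF c(1,2)] gy y by simp
    moreover have "g y \<in> L" unfolding L_def using x y by blast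
    ultimately show "x \<in> (\<Union>x\<in>L. MS.mball x \<epsilon>)" using c by (force simp: hdist_def)
  qed
  ultimately show "\<exists>K. finite K \<and> K \<subseteq> S \<and> S \<subseteq> (\<Union>x\<in>K. MS.mball x \<epsilon>)" by blast
qed

text \<open>Up to \<open>\<epsilon>/2\<close>, only the first \<open>N\<close> coordinates of \<open>Rx\<close> matter; they lie in the unit disc, which has
  a finite net.\<close>

lemma diag_map_compact:
  assumes e: "onb H e" and mu: "\<mu> \<in> Sigma_seq"
  shows "compact_op H (diag_map H e H e (\<lambda>k. complex_of_real (\<mu> k)))"
proof -
  let ?a = "\<lambda>k. complex_of_real (\<mu> k)"
  let ?R = "diag_map H e H e ?a"
  have a: "cmod (?a k) \<le> 1" for k
    using Sigma_seqD(2)[OF mu, of k] Sigma_seqD(3)[OF mu, of k] by simp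
  note d = HH.diag_map_props[where a = ?a, OF e e a] and ec = onbD(1)[OF e]
  let ?S = "?R ` {x \<in> carrier H. hnorm H x \<le> 1}"
  have Sc: "?S \<subseteq> carrier H" using d(1) by auto
  have "MS.mtotally_bounded ?S"
  proof (rule mtotally_bounded_of_nets[OF Sc])
    fix \<epsilon> :: real assume eps: "\<epsilon> > 0"
    have "\<forall>\<^sub>F k in sequentially. \<mu> k < \<epsilon> / 4"
      by (rule order_tendstoD(2)[OF Sigma_seqD(1)[OF mu]]) (use eps in simp)
    then obtain N where N: "\<And>k. k \<ge> N \<Longrightarrow> \<mu> k < \<epsilon> / 4" by (auto simp: eventually_sequentially)
    define \<delta> where "\<delta> = \<epsilon> / (4 * real (Suc N))"
    have del: "\<delta> > 0" "real (Suc N) * \<delta> = \<epsilon> / 4" using eps by (simp_all add: \<delta>_def del: of_nat_Suc)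
    obtain C where C: "finite C" "cball (0::complex) 1 \<subseteq> (\<Union>x\<in>C. ball x \<delta>)"
      using compact_eq_totally_bounded[of "cball (0::complex) 1"] del(1) by (metis compact_cball)
    let ?K = "(\<lambda>c. lin_comb H c e N) ` (PiE {..<N} (\<lambda>_. C))"
    have K1: "finite ?K" using C(1) by (intro finite_imageI finite_PiE) auto
    have K2: "?K \<subseteq> carrier H" using lin_comb_mem[OF ec] by auto
    have K3: "\<exists>y\<in>?K. hnorm H (v \<ominus> y) < \<epsilon>" if v: "v \<in> ?S" for v
    proof -
      obtain x where x: "x \<in> carrier H" "hnorm H x \<le> 1" "v = ?R x" using v unfolding image_iff by blast
      have "\<exists>c\<in>C. cmod (?a k * ip H (e k) x - c) \<le> \<delta>" for k
      proof -
        have "hnorm H (e k) = 1" using onbD(2)[OF e, of k k] by (simp add: hnorm_def)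
        then have "cmod (ip H (e k) x) \<le> 1" using cauchy_schwarz[OF ec x(1), of k] x(2) by simp
        then have "cmod (?a k) * cmod (ip H (e k) x) \<le> 1 * 1" by (intro mult_mono a) simp_all
        then have "?a k * ip H (e k) x \<in> cball 0 1" by (simp add: norm_mult)
        then obtain c where "c \<in> C" "?a k * ip H (e k) x \<in> ball c \<delta>" using C(2) by blast
        then show ?thesis by (intro bexI[of _ c]) (simp_all add: dist_norm norm_minus_commute)
      qed
      then obtain c where c: "\<And>k. c k \<in> C" "\<And>k. cmod (?a k * ip H (e k) x - c k) \<le> \<delta>" by metis
      let ?c = "restrict c {..<N}"
      let ?d = "\<lambda>k. ?a k * ip H (e k) x - c k"
      \<comment> \<open>The part of \<open>Rx\<close> beyond the first \<open>N\<close> coordinates is the image of \<open>x\<close> under this diagonal operator.\<close>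
      let ?t = "\<lambda>k. if k < N then 0 else ?a k"
      have t: "cmod (?t k) \<le> \<epsilon> / 4" for k
      proof (cases "k < N")
        case False
        then have "\<mu> k < \<epsilon> / 4" using N[of k] by simp
        then show ?thesis using False Sigma_seqD(2)[OF mu, of k] by simp
      qed (use eps in simp)
      note dt = HH.diag_map_props[where a = ?t, OF e e t x(1)]
      have Rx: "?R x \<in> carrier H" by (rule d(1)[OF x(1)])
      have lcc: "lin_comb H b e N \<in> carrier H" for b by (rule lin_comb_mem[OF ec])
      have "?R x \<ominus> lin_comb H ?c e N = lin_comb H ?d e N \<oplus> diag_map H e H e ?t x"
      proof (rule onb_ext[OF e])
        fix k
        show "ip H (e k) (?R x \<ominus> lin_comb H ?c e N) = ip H (e k) (lin_comb H ?d e N \<oplus> diag_map H e H e ?t x)"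
          unfolding ip_diff_right[OF ec Rx lcc] ip_add_right[OF ec lcc dt(1)] onb_ip_lin_comb[OF e] d(2)[OF x(1)] dt(2)
          by simp
      qed (use Rx lcc dt(1) in simp_all)
      then have "hnorm H (?R x \<ominus> lin_comb H ?c e N) \<le> hnorm H (lin_comb H ?d e N) + hnorm H (diag_map H e H e ?t x)"
        using hnorm_triangle[OF lcc dt(1)] by simp
      moreover have "hnorm H (diag_map H e H e ?t x) \<le> \<epsilon> / 4"
      proof -
        have "\<epsilon> / 4 * hnorm H x \<le> \<epsilon> / 4 * 1" by (rule mult_left_mono[OF x(2)]) (use eps in simp)
        then show ?thesis using dt(3) by linarith
      qed
      moreover have "hnorm H (lin_comb H ?d e N) \<le> \<epsilon> / 4"
      proof (rule power2_le_imp_le)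
        have "(hnorm H (lin_comb H ?d e N))\<^sup>2 = (\<Sum>k<N. (cmod (?d k))\<^sup>2)" by (rule orthonormal_hnorm_lin_comb[OF onbD(3)[OF e]])
        also have "\<dots> \<le> (\<Sum>k<N. \<delta>\<^sup>2)" using c(2) by (intro sum_mono power_mono) auto
        also have "\<dots> = real N * \<delta>\<^sup>2" by simp
        also have "\<dots> \<le> (real (Suc N))\<^sup>2 * \<delta>\<^sup>2"
          by (rule mult_right_mono) (simp_all add: power2_eq_square algebra_simps)
        also have "\<dots> = (\<epsilon> / 4)\<^sup>2" unfolding del(2)[symmetric] by (simp add: power_mult_distrib)
        finally show "(hnorm H (lin_comb H ?d e N))\<^sup>2 \<le> (\<epsilon> / 4)\<^sup>2" .
      qed (use eps in simp)
      ultimately have "hnorm H (v \<ominus> lin_comb H ?c e N) < \<epsilon>" using x(3) eps by simp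
      moreover have "?c \<in> PiE {..<N} (\<lambda>_. C)" using c(1) by auto
      ultimately show ?thesis by blast
    qed
    show "\<exists>K. finite K \<and> K \<subseteq> carrier H \<and> (\<forall>x\<in>?S. \<exists>y\<in>K. hnorm H (x \<ominus> y) < \<epsilon>)"
      by (intro exI[of _ ?K] conjI ballI K1 K2 K3)
  qed
  then have "compactin MS.mtopology (MS.mtopology closure_of ?S)"
    using MS.mtotally_bounded_eq_compact_closure_of[OF complete] by simp
  then show ?thesis using HH.diag_map_bops[OF e e a] by (simp add: compact_op_def htopology_def)
qed

lemma eigenbasis_exists:
  assumes e: "onb H e" and mu: "\<mu> \<in> Sigma_seq"
  shows "\<exists>R\<in>K01 H. eigenbasis H R e \<mu>"
proof -
  let ?a = "\<lambda>k. complex_of_real (\<mu> k)"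
  let ?R = "diag_map H e H e ?a"
  have a: "cmod (?a k) \<le> 1" for k
    using Sigma_seqD(2)[OF mu, of k] Sigma_seqD(3)[OF mu, of k] by simp
  note d = HH.diag_map_props[where a = ?a, OF e e a] and ec = onbD(1)[OF e]
  have Rb: "?R \<in> bounded_ops H H" by (rule HH.diag_map_bops[OF e e a])
  have sym: "symmetric_op H ?R"
    unfolding symmetric_op_def using Rb HH.diag_map_adjoint[OF e e a] by simp
  have "?R (e k) = ?a k \<odot> e k" for k
    by (rule onb_ext[OF e]) (use d ec in \<open>auto simp: ip_simps onbD(2)[OF e]\<close>)
  then have E: "eigenbasis H ?R e \<mu>" unfolding eigenbasis_def using e sym mu by simp
  have adj: "adj H H ?R x = ?R x" if x: "x \<in> carrier H" for x
    by (rule HH.adj_eqI[OF Rb x d(1)[OF x]]) (use symmetric_opD(3)[OF sym _ x] in simp)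
  have inj: "inj_on ?R (carrier H)"
  proof (rule inj_onI)
    fix x y assume xy: "x \<in> carrier H" "y \<in> carrier H" "?R x = ?R y"
    show "x = y"
    proof (rule onb_ext[OF e xy(1,2)])
      fix k
      have "?a k * ip H (e k) x = ?a k * ip H (e k) y" 
        unfolding d(2)[OF xy(1), symmetric] d(2)[OF xy(2), symmetric] xy(3) ..
      moreover have "?a k \<noteq> 0" using Sigma_seqD(2)[OF mu, of k] by simp
      ultimately show "ip H (e k) x = ip H (e k) y" by (simp only: mult_cancel_left) blast
    qed
  qed
  have "spectrum H ?R \<subseteq> complex_of_real ` {0..1}"
  proof
    fix z assume "z \<in> spectrum H ?R"
    then consider "z = 0" | k where "z = ?a k" using eigenbasis_spectrum[OF E] by blast
    then show "z \<in> complex_of_real ` {0..1}"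
    proof cases
      case 1
      then show ?thesis by (intro image_eqI[of _ _ 0]) auto
    next
      case (2 k)
      then show ?thesis
        using Sigma_seqD(2)[OF mu, of k] Sigma_seqD(3)[OF mu, of k] by (intro image_eqI[of _ _ "\<mu> k"]) auto
    qed
  qed
  then have "?R \<in> K01 H"
    using Rb adj inj diag_map_compact[OF e mu] by (simp add: K01_def B01_def)
  then show ?thesis using E by blast
qed

end

section \<open>The distance\<close>

context hilbert_pair
begin

lemma B01_bops: "R \<in> B01 H \<Longrightarrow> R \<in> bounded_ops H H" "S \<in> B01 K \<Longrightarrow> S \<in> bounded_ops K K"
  by (simp_all add: B01_def)

lemma d_quni_eq:
  assumes "R \<in> B01 H" "S \<in> B01 K"
  shows "d_quni (H, R) (K, S) = Inf {\<delta>. 0 \<le> \<delta> \<and> (\<exists>J J'. quasi_unitary \<delta> H R K S J J')}"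
  unfolding d_quni_def
  using quasi_unitarily_equivalent_iff[OF B01_bops(1)[OF assms(1)] B01_bops(2)[OF assms(2)]]
  by (intro arg_cong[of _ _ Inf]) auto

lemma d_quni_le:
  assumes "R \<in> B01 H" "S \<in> B01 K" "0 \<le> \<delta>" "quasi_unitary \<delta> H R K S J J'"
  shows "d_quni (H, R) (K, S) \<le> \<delta>"
  unfolding d_quni_eq[OF assms(1,2)]
proof (rule cInf_lower)
  show "\<delta> \<in> {\<delta>. 0 \<le> \<delta> \<and> (\<exists>J J'. quasi_unitary \<delta> H R K S J J')}" using assms(3,4) by auto
  show "bdd_below {\<delta>. 0 \<le> \<delta> \<and> (\<exists>J J'. quasi_unitary \<delta> H R K S J J')}" by (rule bdd_belowI[of _ 0]) simp
qed

lemma quasi_unitary_1: "R \<in> B01 H \<Longrightarrow> S \<in> B01 K \<Longrightarrow> quasi_unitary 1 H R K S (\<lambda>x. \<zero>\<^bsub>K\<^esub>) (\<lambda>y. \<zero>\<^bsub>H\<^esub>)"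
  by (rule quasi_unitary_one) (auto intro: B01_bops H.B01_contraction K.B01_contraction)

lemma d_quni_le_1: "R \<in> B01 H \<Longrightarrow> S \<in> B01 K \<Longrightarrow> d_quni (H, R) (K, S) \<le> 1"
  by (rule d_quni_le[OF _ _ _ quasi_unitary_1]) simp_all

lemma d_quni_nonempty:
  assumes "R \<in> B01 H" "S \<in> B01 K"
  shows "{\<delta>. 0 \<le> \<delta> \<and> (\<exists>J J'. quasi_unitary \<delta> H R K S J J')} \<noteq> {}"
proof -
  have "1 \<in> {\<delta>. 0 \<le> \<delta> \<and> (\<exists>J J'. quasi_unitary \<delta> H R K S J J')}" using quasi_unitary_1[OF assms] by auto
  then show ?thesis by blast
qed

lemma d_quni_nonneg:
  assumes "R \<in> B01 H" "S \<in> B01 K"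
  shows "0 \<le> d_quni (H, R) (K, S)"
  unfolding d_quni_eq[OF assms] by (rule cInf_greatest[OF d_quni_nonempty[OF assms]]) simp

lemma quasi_unitary_of_d_quni_less:
  assumes "R \<in> B01 H" "S \<in> B01 K" "d_quni (H, R) (K, S) < \<delta>"
  shows "\<exists>J J'. quasi_unitary \<delta> H R K S J J'"
proof -
  obtain \<epsilon> where "\<epsilon> \<in> {\<delta>. 0 \<le> \<delta> \<and> (\<exists>J J'. quasi_unitary \<delta> H R K S J J')}" "\<epsilon> < \<delta>"
    using cInf_lessD[OF d_quni_nonempty[OF assms(1,2)]] assms(3) unfolding d_quni_eq[OF assms(1,2)] by blast
  then obtain J J' where "quasi_unitary \<epsilon> H R K S J J'" "\<epsilon> \<le> \<delta>" by auto
  then show ?thesis using quasi_unitary_mono by blast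
qed

lemma d_quni_commute:
  assumes "R \<in> B01 H" "S \<in> B01 K"
  shows "d_quni (H, R) (K, S) = d_quni (K, S) (H, R)"
proof -
  interpret KH: hilbert_pair K H by unfold_locales
  have "(\<exists>J J'. quasi_unitary \<delta> H R K S J J') \<longleftrightarrow> (\<exists>J J'. quasi_unitary \<delta> K S H R J J')" for \<delta>
    using quasi_unitary_sym KH.quasi_unitary_sym by blast
  then show ?thesis unfolding d_quni_eq[OF assms] KH.d_quni_eq[OF assms(2,1)] by simp
qed

end

lemma (in hilbert_space) d_quni_self:
  assumes R: "R \<in> B01 H"
  shows "d_quni (H, R) (H, R) = 0"
  using HH.d_quni_le[OF R R _ quasi_unitary_refl[OF HH.B01_bops(1)[OF R]]] HH.d_quni_nonneg[OF R R] by simp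

text \<open>If \<open>a + b \<ge> 1/3\<close>, then \<open>\<Phi> a b \<ge> 1\<close>, and 1 bounds every distance. Otherwise the estimate
  for compositions applies to all parameters slightly larger than \<open>a\<close> and \<open>b\<close>.\<close>

lemma d_quni_triangle:
  assumes hs: "hilbert_space H1" "hilbert_space H2" "hilbert_space H3"
    and R: "R1 \<in> B01 H1" "R2 \<in> B01 H2" "R3 \<in> B01 H3"
  shows "d_quni (H1, R1) (H3, R3) \<le> \<Phi> (d_quni (H1, R1) (H2, R2)) (d_quni (H2, R2) (H3, R3))"
proof -
  interpret P12: hilbert_pair H1 H2 using hs by (simp add: hilbert_pair_def)
  interpret P23: hilbert_pair H2 H3 using hs by (simp add: hilbert_pair_def)
  interpret P13: hilbert_pair H1 H3 using hs by (simp add: hilbert_pair_def)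
  define a where "a = d_quni (H1, R1) (H2, R2)"
  define b where "b = d_quni (H2, R2) (H3, R3)"
  have a: "0 \<le> a" unfolding a_def by (rule P12.d_quni_nonneg[OF R(1,2)])
  have b: "0 \<le> b" unfolding b_def by (rule P23.d_quni_nonneg[OF R(2,3)])
  have "d_quni (H1, R1) (H3, R3) \<le> \<Phi> a b"
  proof (cases "1 / 3 \<le> a + b")
    case True
    have "3 * (a + b) \<le> \<Phi> a b" unfolding \<Phi>_def using a b by simp
    moreover have "1 \<le> 3 * (a + b)" using True by simp
    ultimately have "1 \<le> \<Phi> a b" by (rule order_trans[rotated])
    then show ?thesis by (rule order_trans[OF P13.d_quni_le_1[OF R(1,3)]])
  next
    case False
    \<comment> \<open>The bound on \<open>t\<close> keeps \<open>1 + a + t\<close> and \<open>1 + b + t\<close> below \<open>7/5\<close>, whose square is less than 2.\<close>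
    have small: "d_quni (H1, R1) (H3, R3) \<le> \<Phi> (a + t) (b + t)" if t: "0 < t" "t < 1 / 20" for t
    proof -
      obtain J J' where q1: "quasi_unitary (a + t) H1 R1 H2 R2 J J'"
        using P12.quasi_unitary_of_d_quni_less[OF R(1,2), of "a + t"] t a_def by auto
      obtain L L' where q2: "quasi_unitary (b + t) H2 R2 H3 R3 L L'"
        using P23.quasi_unitary_of_d_quni_less[OF R(2,3), of "b + t"] t b_def by auto
      have sq: "(1 + c)\<^sup>2 \<le> 2" if "0 \<le> c" "c \<le> 2 / 5" for c :: real
      proof -
        have "(1 + c)\<^sup>2 \<le> (7 / 5)\<^sup>2" using that by (intro power_mono) auto
        also have "\<dots> \<le> 2" by (simp add: power2_eq_square)
        finally show ?thesis .
      qed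
      have "quasi_unitary (\<Phi> (a + t) (b + t)) H1 R1 H3 R3 (\<lambda>x. L (J x)) (\<lambda>y. J' (L' y))"
        by (rule quasi_unitary_trans[OF hs _ _ sq sq _ _ _ q1 q2])
          (use a b t False R P12.B01_bops P23.B01_bops in simp_all)
      moreover have "0 \<le> \<Phi> (a + t) (b + t)" unfolding \<Phi>_def using a b t by simp
      ultimately show ?thesis using P13.d_quni_le[OF R(1,3)] by blast
    qed
    have "((\<lambda>t. \<Phi> (a + t) (b + t)) \<longlongrightarrow> \<Phi> (a + 0) (b + 0)) (at_right 0)"
      unfolding \<Phi>_def by (intro tendsto_intros)
    moreover have "\<forall>\<^sub>F t in at_right 0. d_quni (H1, R1) (H3, R3) \<le> \<Phi> (a + t) (b + t)"
      unfolding eventually_at_right_field by (intro exI[of _ "1 / 20"]) (use small in simp)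
    ultimately have "d_quni (H1, R1) (H3, R3) \<le> \<Phi> (a + 0) (b + 0)"
      by (rule tendsto_lowerbound) simp
    then show ?thesis by simp
  qed
  then show ?thesis by (simp add: a_def b_def)
qed

text \<open>The relaxed triangle inequality would only give the bound \<open>\<Phi> 0 d\<close>, which exceeds \<open>d\<close> for \<open>d > 0\<close>.
  Composing the identification operators with the unitary operator loses nothing.\<close>

lemma d_quni_unitary_le:
  assumes hs: "hilbert_space H" "hilbert_space H'" "hilbert_space K"
    and R: "R \<in> B01 H" "R' \<in> B01 H'" "S \<in> B01 K"
    and ue: "unitarily_equivalent (H, R) (H', R')"
  shows "d_quni (H', R') (K, S) \<le> d_quni (H, R) (K, S)"
proof -
  interpret P: hilbert_pair H K using hs by (simp add: hilbert_pair_def)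
  interpret P': hilbert_pair H' K using hs by (simp add: hilbert_pair_def)
  obtain U where U: "unitary H H' U" "\<And>y. y \<in> carrier H' \<Longrightarrow> R' y = U (R (adj H H' U y))"
    using ue unfolding unitarily_equivalent_def by auto
  have sub: "{\<delta>. 0 \<le> \<delta> \<and> (\<exists>J J'. quasi_unitary \<delta> H R K S J J')} \<subseteq> {\<delta>. 0 \<le> \<delta> \<and> (\<exists>J J'. quasi_unitary \<delta> H' R' K S J J')}"
    using quasi_unitary_unitary[OF hs U(1) P.B01_bops(1)[OF R(1)] P.B01_bops(2)[OF R(3)] U(2)] by blast
  show ?thesis
    unfolding P.d_quni_eq[OF R(1,3)] P'.d_quni_eq[OF R(2,3)]
    by (rule cInf_superset_mono[OF P.d_quni_nonempty[OF R(1,3)] _ sub])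
      (rule bdd_belowI[of _ 0], simp)
qed

section \<open>Unitary equivalence classes of compact operators\<close>

lemma separable_infinite_hilbertD:
  assumes "separable_infinite_hilbert H"
  shows "hilbert_space H" "separable_space (htopology H)"
    "\<not> vectorspace.fin_dim (class_ring :: complex ring) H"
  using assms by (simp_all add: separable_infinite_hilbert_def)

locale hilbert_spaces =
  fixes HS :: "'a hspace set"
  assumes nonempty: "HS \<noteq> {}"
    and separable_infinite: "H \<in> HS \<Longrightarrow> separable_infinite_hilbert H"
begin

lemma hilbert: "H \<in> HS \<Longrightarrow> hilbert_space H"
  by (rule separable_infinite_hilbertD(1)[OF separable_infinite])

lemma pair: "H \<in> HS \<Longrightarrow> K \<in> HS \<Longrightarrow> hilbert_pair H K"
  by (simp add: hilbert_pair_def hilbert)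

lemma Kops_Bops: "p \<in> Kops HS \<Longrightarrow> p \<in> Bops HS"
  by (auto simp: Kops_def Bops_def K01_def)

lemma BopsE:
  assumes "p \<in> Bops HS"
  obtains H R where "p = (H, R)" "H \<in> HS" "R \<in> B01 H"
  using assms by (auto simp: Bops_def)

lemma d_nonneg: "p \<in> Bops HS \<Longrightarrow> q \<in> Bops HS \<Longrightarrow> 0 \<le> d_quni p q"
  by (elim BopsE) (simp add: hilbert_pair.d_quni_nonneg[OF pair])

lemma d_self: "p \<in> Bops HS \<Longrightarrow> d_quni p p = 0"
  by (elim BopsE) (simp add: hilbert_space.d_quni_self[OF hilbert])

lemma d_commute: "p \<in> Bops HS \<Longrightarrow> q \<in> Bops HS \<Longrightarrow> d_quni p q = d_quni q p"
  by (elim BopsE) (simp add: hilbert_pair.d_quni_commute[OF pair])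

lemma d_triangle: "p \<in> Bops HS \<Longrightarrow> q \<in> Bops HS \<Longrightarrow> r \<in> Bops HS \<Longrightarrow> d_quni p r \<le> \<Phi> (d_quni p q) (d_quni q r)"
  by (elim BopsE) (simp add: d_quni_triangle[OF hilbert hilbert hilbert])

lemma d_zero_spectra:
  assumes "(H, R) \<in> Bops HS" "(K, S) \<in> Bops HS" "d_quni (H, R) (K, S) = 0"
  shows "ess_spectrum H R = ess_spectrum K S" "disc_spectrum H R = disc_spectrum K S"
    "z \<in> disc_spectrum H R \<Longrightarrow> mult_eig H R z = mult_eig K S z"
proof -
  have H: "H \<in> HS" "R \<in> B01 H" "K \<in> HS" "S \<in> B01 K" using assms by (auto simp: Bops_def)
  interpret hilbert_pair H K by (rule pair[OF H(1,3)])
  have "\<exists>J J'. quasi_unitary \<delta> H R K S J J'" if "\<delta> > 0" for \<delta>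
    by (rule quasi_unitary_of_d_quni_less[OF H(2,4)]) (use that assms(3) in simp)
  note s = spectra_of_distance_zero[OF H(2,4) this]
  show "ess_spectrum H R = ess_spectrum K S" "disc_spectrum H R = disc_spectrum K S"
    "z \<in> disc_spectrum H R \<Longrightarrow> mult_eig H R z = mult_eig K S z"
    using s by blast+
qed

lemma KopsE:
  assumes "p \<in> Kops HS"
  obtains H R e where "p = (H, R)" "H \<in> HS" "R \<in> B01 H" "eigenbasis H R e (eig_seq p)" "eig_seq p \<in> Sigma_seq"
proof -
  obtain H R where p: "p = (H, R)" "H \<in> HS" "R \<in> K01 H" using assms by (auto simp: Kops_def)
  interpret hilbert_space H by (rule hilbert[OF p(2)])
  obtain e \<mu> where E: "eigenbasis H R e \<mu>"
    using spectral_theorem_compact[OF p(3) separable_infinite_hilbertD(3)[OF separable_infinite[OF p(2)]]] by blast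
  have "eig_seq p = \<mu>" unfolding p(1) by (rule eigenbasis_eig_seq[OF E])
  then show thesis using that[OF p(1,2) _ _ , of e] E eigenbasisD(3)[OF E] p(3) by (simp add: K01_def)
qed

text \<open>Consequently unitary equivalence is an equivalence relation on compact operators, and its classes
  are the fibres of \<^const>\<open>eig_seq\<close>.\<close>

lemma unitarily_equivalent_iff_eig_seq:
  assumes p: "p \<in> Kops HS" and q: "q \<in> Kops HS"
  shows "unitarily_equivalent p q \<longleftrightarrow> eig_seq p = eig_seq q"
proof -
  obtain H R e where P: "p = (H, R)" "H \<in> HS" "R \<in> B01 H" "eigenbasis H R e (eig_seq p)" by (rule KopsE[OF p])
  obtain K S f where Q: "q = (K, S)" "K \<in> HS" "S \<in> B01 K" "eigenbasis K S f (eig_seq q)" by (rule KopsE[OF q])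
  interpret hilbert_pair H K by (rule pair[OF P(2) Q(2)])
  show ?thesis
  proof
    assume "unitarily_equivalent p q"
    then obtain g where "eigenbasis K S g (eig_seq p)"
      using unitarily_equivalent_eigenbasis[OF _ P(4) K.B01_symmetric[OF Q(3)]] P(1) Q(1) by blast
    then show "eig_seq p = eig_seq q" using K.eigenbasis_eig_seq Q(1) by simp
  next
    assume "eig_seq p = eig_seq q"
    then show "unitarily_equivalent p q"
      using eigenbasis_unitarily_equivalent[of R e "eig_seq q" S f] P(1,4) Q(1,4) by simp
  qed
qed

lemma d_unitary_le:
  assumes "p \<in> Bops HS" "p' \<in> Bops HS" "q \<in> Bops HS" "unitarily_equivalent p p'"
  shows "d_quni p' q \<le> d_quni p q"
proof -
  obtain H R where p: "p = (H, R)" "H \<in> HS" "R \<in> B01 H" by (rule BopsE[OF assms(1)])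
  obtain H' R' where p': "p' = (H', R')" "H' \<in> HS" "R' \<in> B01 H'" by (rule BopsE[OF assms(2)])
  obtain K S where q: "q = (K, S)" "K \<in> HS" "S \<in> B01 K" by (rule BopsE[OF assms(3)])
  show ?thesis
    unfolding p(1) p'(1) q(1)
    by (rule d_quni_unitary_le[OF hilbert[OF p(2)] hilbert[OF p'(2)] hilbert[OF q(2)] p(3) p'(3) q(3)])
      (use assms(4) p(1) p'(1) in simp)
qed

lemma d_eq_zero_iff_eig_seq:
  assumes p: "p \<in> Kops HS" and q: "q \<in> Kops HS"
  shows "d_quni p q = 0 \<longleftrightarrow> eig_seq p = eig_seq q"
proof
  assume d: "d_quni p q = 0"
  obtain H R e where P: "p = (H, R)" "H \<in> HS" "R \<in> B01 H" "eigenbasis H R e (eig_seq p)" by (rule KopsE[OF p])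
  obtain K S f where Q: "q = (K, S)" "K \<in> HS" "S \<in> B01 K" "eigenbasis K S f (eig_seq q)" by (rule KopsE[OF q])
  interpret hilbert_pair H K by (rule pair[OF P(2) Q(2)])
  have B: "(H, R) \<in> Bops HS" "(K, S) \<in> Bops HS" using P Q by (simp_all add: Bops_def)
  note s = d_zero_spectra[OF B d[unfolded P(1) Q(1)]]
  have ev: "is_eigenvalue H R z \<longleftrightarrow> is_eigenvalue K S z" for z
    using s(2) H.eigenbasis_disc_spectrum[OF P(4)] K.eigenbasis_disc_spectrum[OF Q(4)] by blast
  have mu: "mult_eig H R z = mult_eig K S z" if "is_eigenvalue K S z" for z
    using s(3) H.eigenbasis_disc_spectrum[OF P(4)] that ev by blast
  have "eig_enum H R = eig_enum K S"
    by (rule ext) (unfold eig_enum_def ev, use mu in auto)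
  then show "eig_seq p = eig_seq q" unfolding P(1) Q(1) eig_seq_def' by simp
next
  assume "eig_seq p = eig_seq q"
  then have "unitarily_equivalent p q" using unitarily_equivalent_iff_eig_seq[OF p q] by blast
  from d_unitary_le[OF Kops_Bops[OF p] Kops_Bops[OF q] Kops_Bops[OF p] this]
  have "d_quni q p \<le> 0" using d_self[OF Kops_Bops[OF p]] by simp
  then show "d_quni p q = 0"
    using d_nonneg[OF Kops_Bops[OF q] Kops_Bops[OF p]] d_commute[OF Kops_Bops[OF p] Kops_Bops[OF q]] by simp
qed

lemma d_cong_eig_seq:
  assumes "p \<in> Kops HS" "p' \<in> Kops HS" "q \<in> Kops HS" "q' \<in> Kops HS"
    and "eig_seq p' = eig_seq p" "eig_seq q' = eig_seq q"
  shows "d_quni p' q' = d_quni p q"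
proof -
  have left: "d_quni x r = d_quni y r" if "x \<in> Kops HS" "y \<in> Kops HS" "r \<in> Kops HS" "eig_seq x = eig_seq y" for x y r
  proof (rule antisym)
    have u: "unitarily_equivalent x y" "unitarily_equivalent y x"
      using unitarily_equivalent_iff_eig_seq that by simp_all
    show "d_quni x r \<le> d_quni y r" by (rule d_unitary_le) (use that u Kops_Bops in simp_all)
    show "d_quni y r \<le> d_quni x r" by (rule d_unitary_le) (use that u Kops_Bops in simp_all)
  qed
  have "d_quni p' q' = d_quni p q'" by (rule left) (use assms in simp_all)
  also have "\<dots> = d_quni q' p" by (rule d_commute) (use assms Kops_Bops in simp_all)
  also have "\<dots> = d_quni q p" by (rule left) (use assms in simp_all)
  also have "\<dots> = d_quni p q" by (rule d_commute) (use assms Kops_Bops in simp_all)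
  finally show ?thesis .
qed

abbreviation cls :: "'a hop \<Rightarrow> 'a hop set" where
  "cls p \<equiv> unitary_rel HS `` {p}"

lemma mem_cls_iff: "p \<in> Kops HS \<Longrightarrow> q \<in> cls p \<longleftrightarrow> q \<in> Kops HS \<and> eig_seq q = eig_seq p"
  using unitarily_equivalent_iff_eig_seq[of p q] by (auto simp: unitary_rel_def)

lemma some_cls:
  assumes p: "p \<in> Kops HS"
  shows "(SOME q. q \<in> cls p) \<in> Kops HS" "eig_seq (SOME q. q \<in> cls p) = eig_seq p"
proof -
  have "p \<in> cls p" using p mem_cls_iff[OF p] by blast
  then have "(SOME q. q \<in> cls p) \<in> cls p" by (rule someI)
  then show "(SOME q. q \<in> cls p) \<in> Kops HS" "eig_seq (SOME q. q \<in> cls p) = eig_seq p"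
    using mem_cls_iff[OF p] by simp_all
qed

lemma cls_eq_iff:
  assumes "p \<in> Kops HS" "q \<in> Kops HS"
  shows "cls p = cls q \<longleftrightarrow> eig_seq p = eig_seq q"
proof
  assume "cls p = cls q"
  then have "p \<in> cls q" using mem_cls_iff[OF assms(1), of p] assms by simp
  then show "eig_seq p = eig_seq q" using mem_cls_iff[OF assms(2)] by simp
next
  assume "eig_seq p = eig_seq q"
  then show "cls p = cls q"
    by (intro Set.set_eqI) (simp only: mem_cls_iff[OF assms(1)] mem_cls_iff[OF assms(2)])
qed

lemma d_class_cls: "p \<in> Kops HS \<Longrightarrow> q \<in> Kops HS \<Longrightarrow> d_class (cls p) (cls q) = d_quni p q"
  unfolding d_class_def by (rule d_cong_eig_seq) (simp_all only: some_cls)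

lemma KclassesE:
  assumes "X \<in> Kclasses HS"
  obtains p where "p \<in> Kops HS" "X = cls p"
  using assms unfolding Kclasses_def by (rule quotientE)

lemma semimetric_Kclasses: "semimetric_on (Kclasses HS) d_class"
  unfolding semimetric_on_def
proof (intro ballI)
  fix X Y assume "X \<in> Kclasses HS" "Y \<in> Kclasses HS"
  then obtain p q where p: "p \<in> Kops HS" "X = cls p" and q: "q \<in> Kops HS" "Y = cls q" by (elim KclassesE)
  show "0 \<le> d_class X Y \<and> d_class X Y = d_class Y X \<and> (d_class X Y = 0 \<longleftrightarrow> X = Y)"
    unfolding p(2) q(2) d_class_cls[OF p(1) q(1)] d_class_cls[OF q(1) p(1)] cls_eq_iff[OF p(1) q(1)]
    using d_nonneg[OF Kops_Bops Kops_Bops] d_commute[OF Kops_Bops Kops_Bops] d_eq_zero_iff_eig_seq p(1) q(1) by blast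
qed

lemma relaxed_triangle_Kclasses: "relaxed_triangle_on (Kclasses HS) d_class"
  unfolding relaxed_triangle_on_def
proof (intro ballI)
  fix X Y Z assume "X \<in> Kclasses HS" "Y \<in> Kclasses HS" "Z \<in> Kclasses HS"
  then obtain p q r where p: "p \<in> Kops HS" "X = cls p" and q: "q \<in> Kops HS" "Y = cls q"
    and r: "r \<in> Kops HS" "Z = cls r" by (elim KclassesE)
  show "d_class X Z \<le> \<Phi> (d_class X Y) (d_class Y Z)"
    unfolding p(2) q(2) r(2) d_class_cls[OF p(1) q(1)] d_class_cls[OF q(1) r(1)] d_class_cls[OF p(1) r(1)]
    by (rule d_triangle[OF Kops_Bops[OF p(1)] Kops_Bops[OF q(1)] Kops_Bops[OF r(1)]])
qed

section \<open>Transport to eigenvalue sequences\<close>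

lemma class_eig_seq_cls: "p \<in> Kops HS \<Longrightarrow> class_eig_seq (cls p) = eig_seq p"
  unfolding class_eig_seq_def by (rule some_cls(2))

lemma inv_class_eig_seq:
  assumes p: "p \<in> Kops HS"
  shows "inv_into (Kclasses HS) class_eig_seq (eig_seq p) = cls p"
proof -
  have "inj_on class_eig_seq (Kclasses HS)"
  proof (rule inj_onI)
    fix X Y assume "X \<in> Kclasses HS" "Y \<in> Kclasses HS" and eq: "class_eig_seq X = class_eig_seq Y"
    then obtain p q where p: "p \<in> Kops HS" "X = cls p" and q: "q \<in> Kops HS" "Y = cls q" by (elim KclassesE)
    then show "X = Y" using eq cls_eq_iff[OF p(1) q(1)] class_eig_seq_cls by simp
  qed
  moreover have "cls p \<in> Kclasses HS" unfolding Kclasses_def by (rule quotientI[OF p])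
  ultimately have "inv_into (Kclasses HS) class_eig_seq (class_eig_seq (cls p)) = cls p"
    by (rule inv_into_f_f)
  then show ?thesis by (simp only: class_eig_seq_cls[OF p])
qed

lemma d_Sigma_eig_seq:
  "p \<in> Kops HS \<Longrightarrow> q \<in> Kops HS \<Longrightarrow> d_Sigma HS (eig_seq p) (eig_seq q) = d_quni p q"
  unfolding d_Sigma_def by (simp only: inv_class_eig_seq d_class_cls)

lemma Sigma_seqE:
  assumes mu: "\<mu> \<in> Sigma_seq"
  obtains p where "p \<in> Kops HS" "\<mu> = eig_seq p"
proof -
  obtain H where H: "H \<in> HS" using nonempty by blast
  interpret hilbert_space H by (rule hilbert[OF H])
  note sep = separable_infinite_hilbertD[OF separable_infinite[OF H]]
  obtain e where e: "onb H e" using onb_exists[OF sep(2,3)] by blast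
  obtain R where R: "R \<in> K01 H" "eigenbasis H R e \<mu>" using eigenbasis_exists[OF e mu] by blast
  show thesis
    by (rule that[of "(H, R)"]) (use H R eigenbasis_eig_seq[OF R(2)] in \<open>simp_all add: Kops_def\<close>)
qed

lemma semimetric_Sigma: "semimetric_on Sigma_seq (d_Sigma HS)"
  unfolding semimetric_on_def
proof (intro ballI)
  fix \<mu> \<nu> assume "\<mu> \<in> Sigma_seq" "\<nu> \<in> Sigma_seq"
  then obtain p q where p: "p \<in> Kops HS" "\<mu> = eig_seq p" and q: "q \<in> Kops HS" "\<nu> = eig_seq q"
    by (elim Sigma_seqE)
  show "0 \<le> d_Sigma HS \<mu> \<nu> \<and> d_Sigma HS \<mu> \<nu> = d_Sigma HS \<nu> \<mu> \<and> (d_Sigma HS \<mu> \<nu> = 0 \<longleftrightarrow> \<mu> = \<nu>)"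
    unfolding p(2) q(2) d_Sigma_eig_seq[OF p(1) q(1)] d_Sigma_eig_seq[OF q(1) p(1)]
    using d_nonneg[OF Kops_Bops Kops_Bops] d_commute[OF Kops_Bops Kops_Bops] d_eq_zero_iff_eig_seq p(1) q(1) by blast
qed

lemma relaxed_triangle_Sigma: "relaxed_triangle_on Sigma_seq (d_Sigma HS)"
  unfolding relaxed_triangle_on_def
proof (intro ballI)
  fix \<mu> \<nu> \<rho> assume "\<mu> \<in> Sigma_seq" "\<nu> \<in> Sigma_seq" "\<rho> \<in> Sigma_seq"
  then obtain p q r where p: "p \<in> Kops HS" "\<mu> = eig_seq p" and q: "q \<in> Kops HS" "\<nu> = eig_seq q"
    and r: "r \<in> Kops HS" "\<rho> = eig_seq r" by (elim Sigma_seqE)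
  show "d_Sigma HS \<mu> \<rho> \<le> \<Phi> (d_Sigma HS \<mu> \<nu>) (d_Sigma HS \<nu> \<rho>)"
    unfolding p(2) q(2) r(2) d_Sigma_eig_seq[OF p(1) q(1)] d_Sigma_eig_seq[OF q(1) r(1)] d_Sigma_eig_seq[OF p(1) r(1)]
    by (rule d_triangle[OF Kops_Bops[OF p(1)] Kops_Bops[OF q(1)] Kops_Bops[OF r(1)]])
qed

end

theorem proposition2p15:
  fixes HS :: "'a hspace set"
  assumes "HS \<noteq> {}"
    and "\<And>H. H \<in> HS \<Longrightarrow> separable_infinite_hilbert H"
  shows
    "(\<forall>R\<in>Bops HS. \<forall>S\<in>Bops HS. 0 \<le> d_quni R S \<and> d_quni R R = 0 \<and> d_quni R S = d_quni S R)
   \<and> (\<forall>R1\<in>Bops HS. \<forall>R2\<in>Bops HS. \<forall>R3\<in>Bops HS.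
        d_quni R1 R3 \<le> \<Phi> (d_quni R1 R2) (d_quni R2 R3))
   \<and> (\<forall>(H, R)\<in>Bops HS. \<forall>(K, S)\<in>Bops HS. d_quni (H, R) (K, S) = 0 \<longrightarrow>
        ess_spectrum H R = ess_spectrum K S \<and>
        disc_spectrum H R = disc_spectrum K S \<and>
        (\<forall>z\<in>disc_spectrum H R. mult_eig H R z = mult_eig K S z))
   \<and> (\<forall>R\<in>Kops HS. \<forall>S\<in>Kops HS. d_quni R S = 0 \<longleftrightarrow> unitarily_equivalent R S)
   \<and> (\<forall>R\<in>Kops HS. \<forall>S\<in>Kops HS.
        d_class (unitary_rel HS `` {R}) (unitary_rel HS `` {S}) = d_quni R S)
   \<and> semimetric_on (Kclasses HS) d_class
   \<and> relaxed_triangle_on (Kclasses HS) d_class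
   \<and> (\<forall>R\<in>Kops HS. \<forall>S\<in>Kops HS. d_Sigma HS (eig_seq R) (eig_seq S) = d_quni R S)
   \<and> semimetric_on Sigma_seq (d_Sigma HS)
   \<and> relaxed_triangle_on Sigma_seq (d_Sigma HS)"
proof -
  interpret hilbert_spaces HS by unfold_locales (rule assms)+
  have spectra: "\<forall>(H, R)\<in>Bops HS. \<forall>(K, S)\<in>Bops HS. d_quni (H, R) (K, S) = 0 \<longrightarrow>
        ess_spectrum H R = ess_spectrum K S \<and>
        disc_spectrum H R = disc_spectrum K S \<and>
        (\<forall>z\<in>disc_spectrum H R. mult_eig H R z = mult_eig K S z)"
  proof (intro ballI case_prodI2 impI)
    fix x y H R K S
    assume "x \<in> Bops HS" "x = (H, R)" "y \<in> Bops HS" "y = (K, S)" and d: "d_quni (H, R) (K, S) = 0"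
    then have B: "(H, R) \<in> Bops HS" "(K, S) \<in> Bops HS" by simp_all
    show "ess_spectrum H R = ess_spectrum K S \<and> disc_spectrum H R = disc_spectrum K S \<and>
        (\<forall>z\<in>disc_spectrum H R. mult_eig H R z = mult_eig K S z)"
      by (intro conjI ballI d_zero_spectra[OF B d])
  qed
  show ?thesis
    by (intro conjI spectra semimetric_Kclasses relaxed_triangle_Kclasses semimetric_Sigma relaxed_triangle_Sigma
        ballI d_nonneg d_self d_triangle d_class_cls d_Sigma_eig_seq)
      (simp_all add: d_commute d_eq_zero_iff_eig_seq unitarily_equivalent_iff_eig_seq)
qed

end
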